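(* Let $A$ be a Green biset functor (for $\mathcal{D}$ over $k$) and let $G$ be an object of $\mathcal{D}$. Then the morphisms $$Res_H=A(Res_H^{H\times G}):A_G(H)=A(H\times G)\longrightarrow A(H),$$ for $H$ in $Ob(\mathcal{P}_A)=Ob(\mathcal{D})$, define a morphism of Green biset functors $Res:A_G\longrightarrow A$.
   Context: Conventions. $k$ is a commutative ring; all groups are finite; rings and algebras are associative and unital. Bisets. For groups $H,G$, an $(H,G)$-biset is a finite set with commuting left $H$-action and right $G$-action. $B(H,G)$ is the Grothendieck group of the category of $(H,G)$-bisets with respect to disjoint union. If $Y$ is a $(K,H)$-biset and $X$ an $(H,G)$-biset, $Y\circ X=Y\times_H X$ is the set of $H$-orbits of $Y\times X$ under $h\cdot(y,x)=(yh^{-1},hx)$, a $(K,G)$-biset. The biset category $\mathcal{C}$ has all finite groups as objects, $\mathcal{C}(G,H)=B(H,G)$, composition induced by $\circ$, and identity $Id_G=[G]$. $\mathcal{D}$ is a full subcategory of $\mathcal{C}$ such that any group isomorphic to a subquotient of an object of $\mathcal{D}$ or to a product of two objects of $\mathcal{D}$ is an object of $\mathcal{D}$; $k\mathcal{D}$ is its $k$-linearization. A biset functor is a $k$-linear functor $k\mathcal{D}\to k\text{-Mod}$; morphisms are natural transformations. For an isomorphism $\psi:H\to G$, $Iso(\psi)$ is the $(G,H)$-biset $G$ with $g\cdot x\cdot h=gx\psi(h)$. For $H$ and $G$, $Inf_H^{H\times G}$ is the $(H\times G,H)$-biset $H$ with $(h,g)\cdot x\cdot h'=hxh'$, and $Res_H^{H\times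 G}$ is shorthand for $Iso(\rho_H)\circ Res^{H\times G}_{H\times 1}$ (with $\rho_H:H\times1\to H$ canonical), i.e. the $(H,H\times G)$-biset $H\times G$ with $h\cdot(x,y)\cdot(h',g')=(hxh',yg')$. The external product of an $(L,K)$-biset $Y$ and an $(H,G)$-biset $X$ is the $(L\times H,K\times G)$-biset $Y\times X$ with $(l,h)(y,x)(k,g)=(lyk,hxg)$, extended bilinearly to $(\alpha,\beta)\mapsto\alpha\times\beta$. Green biset functors. A Green biset functor is a biset functor $A$ with bilinear products $A(K)\times A(H)\to A(K\times H)$, $(a,b)\mapsto a\times b$, for all objects $K,H$, and an element $\epsilon_A\in A(1)$, such that: (1) $(a\times b)\times c=A(Iso(\alpha_{L,K,H}))(a\times(b\times c))$ for $a\in A(L)$, $b\in A(K)$, $c\in A(H)$, with $\alpha_{L,K,H}:L\times(K\times H)\to(L\times K)\times H$ the canonical isomorphism; (2) $A(Iso(\lambda_H))(\epsilon_A\times a)=a=A(Iso(\rho_H))(a\times\epsilon_A)$ for $a\in A(H)$, with $\lambda_H:1\times H\to H$ and $\rho_H:H\times 1\to H$ canonical; (3) $A(\alpha\times\beta)(a\times b)=A(\alpha)(a)\times A(\beta)(b)$ for all morphisms $\alpha:K\to T$, $\beta:H\to L$ of $k\mathcal{D}$ and $a\in A(K)$, $b\in A(H)$. A morphism of Green biset functors $f:A\to C$ is a morphism of biset functors with $f_{K\times H}(a\times b)=f_K(a)\times f_H(b)$ for all $a\in A(K)$, $b\in A(H)$ and $f_1(\epsilon_A)=\epsilon_C$.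 Associated category. $\mathcal{P}_A$ denotes the category associated with $A$; its objects are those of $\mathcal{D}$. Shifted functor. $A_G$ is the biset functor with $A_G(H)=A(H\times G)$ and $A_G(\alpha)=A(\alpha\times Id_G)$. It is a Green biset functor with products $\times^d:A_G(K)\times A_G(H)\to A_G(K\times H)$ given by $a\times^d b=A(U_{K,H})(a\times b)$ for $a\in A(K\times G)$, $b\in A(H\times G)$, where $U_{K,H}$ is the $(K\times H\times G,\,K\times G\times H\times G)$-biset $K\times G\times H\times G$ with right action by multiplication and left action $(k,h,g)\cdot(k',g_1,h',g_2)=(kk',gg_1,hh',gg_2)$, and identity element $\epsilon_{A_G}=A(Inf_1^{1\times G})(\epsilon_A)$. *)

theory Defs
  imports "HOL-Algebra.Free_Abelian_Groups" "HOL-Algebra.Module" "HOL-Library.FSet"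
begin

section \<open>A universe of points for finite groups and bisets\<close>

text \<open>HOL has no type of all groups, so the elements of all groups and bisets are taken from one
  type, which contains a copy of an arbitrary type \<open>'a\<close> and is closed under ordered pairs, tagged
  unions and finite sets. Hence every finite group (biset) is isomorphic to one over this type, and
  direct products, disjoint unions and sets of orbits can be formed literally.\<close>

datatype 'a univ =
    UAtom 'a
  | UPair (ufst: "'a univ") (usnd: "'a univ")
  | UInl "'a univ"
  | UInr "'a univ"
  | USet (uelems: "'a univ fset")

type_synonym 'a ugroup = "'a univ monoid"

definition uprod :: "'a ugroup \<Rightarrow> 'a ugroup \<Rightarrow> 'a ugroup"  (infixl \<open>\<boxtimes>\<close> 75) where
  "H \<boxtimes> G = \<lparr>carrier = {UPair h g | h g. h \<in> carrier H \<and> g \<in> carrier G},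
            mult = (\<lambda>p q. UPair (ufst p \<otimes>\<^bsub>H\<^esub> ufst q) (usnd p \<otimes>\<^bsub>G\<^esub> usnd q)),
            one = UPair \<one>\<^bsub>H\<^esub> \<one>\<^bsub>G\<^esub>\<rparr>"

definition utriv :: "'a ugroup" where
  "utriv = \<lparr>carrier = {USet {||}}, mult = (\<lambda>_ _. USet {||}), one = USet {||}\<rparr>"


section \<open>Bisets\<close>

record 'x biset =
  points :: "'x set"
  lact :: "'x \<Rightarrow> 'x \<Rightarrow> 'x"
  ract :: "'x \<Rightarrow> 'x \<Rightarrow> 'x"

definition is_biset :: "'x monoid \<Rightarrow> 'x monoid \<Rightarrow> 'x biset \<Rightarrow> bool" where
  "is_biset H G X \<longleftrightarrow>
     finite (points X) \<and>
     (\<forall>h\<in>carrier H. \<forall>x\<in>points X. lact X h x \<in> points X) \<and>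
     (\<forall>x\<in>points X. \<forall>g\<in>carrier G. ract X x g \<in> points X) \<and>
     (\<forall>x\<in>points X. lact X \<one>\<^bsub>H\<^esub> x = x) \<and>
     (\<forall>h\<in>carrier H. \<forall>h'\<in>carrier H. \<forall>x\<in>points X.
        lact X (h \<otimes>\<^bsub>H\<^esub> h') x = lact X h (lact X h' x)) \<and>
     (\<forall>x\<in>points X. ract X x \<one>\<^bsub>G\<^esub> = x) \<and>
     (\<forall>x\<in>points X. \<forall>g\<in>carrier G. \<forall>g'\<in>carrier G.
        ract X x (g \<otimes>\<^bsub>G\<^esub> g') = ract X (ract X x g) g') \<and>
     (\<forall>h\<in>carrier H. \<forall>x\<in>points X. \<forall>g\<in>carrier G.
        ract X (lact X h x) g = lact X h (ract X x g))"

definition biset_iso :: "'x monoid \<Rightarrow> 'x monoid \<Rightarrow> 'x biset \<Rightarrow> 'x biset \<Rightarrow> bool" where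
  "biset_iso H G X Y \<longleftrightarrow> (\<exists>f. bij_betw f (points X) (points Y) \<and>
     (\<forall>h\<in>carrier H. \<forall>x\<in>points X. f (lact X h x) = lact Y h (f x)) \<and>
     (\<forall>x\<in>points X. \<forall>g\<in>carrier G. f (ract X x g) = ract Y (f x) g))"

definition usum_map ::
    "('a univ \<Rightarrow> 'a univ) \<Rightarrow> ('a univ \<Rightarrow> 'a univ) \<Rightarrow> 'a univ \<Rightarrow> 'a univ" where
  "usum_map f f' z = (case z of UInl x \<Rightarrow> UInl (f x) | UInr y \<Rightarrow> UInr (f' y) | _ \<Rightarrow> undefined)"

definition biset_union :: "'a univ biset \<Rightarrow> 'a univ biset \<Rightarrow> 'a univ biset" where
  "biset_union X Y =
    \<lparr>points = UInl ` points X \<union> UInr ` points Y,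
     lact = (\<lambda>h. usum_map (lact X h) (lact Y h)),
     ract = (\<lambda>z g. usum_map (\<lambda>x. ract X x g) (\<lambda>y. ract Y y g) z)\<rparr>"

definition orbit_pt ::
    "'a ugroup \<Rightarrow> 'a univ biset \<Rightarrow> 'a univ biset \<Rightarrow> 'a univ \<Rightarrow> 'a univ \<Rightarrow> 'a univ" where
  "orbit_pt H Y X y x =
     USet (Abs_fset ((\<lambda>h. UPair (ract Y y (inv\<^bsub>H\<^esub> h)) (lact X h x)) ` carrier H))"

text \<open>\<open>biset_comp H Y X\<close> is the set of \<open>H\<close>-orbits on pairs; the outer groups act on an orbit by
  acting on all of its members.\<close>

definition biset_comp ::
    "'a ugroup \<Rightarrow> 'a univ biset \<Rightarrow> 'a univ biset \<Rightarrow> 'a univ biset" where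
  "biset_comp H Y X =
    \<lparr>points = {orbit_pt H Y X y x | y x. y \<in> points Y \<and> x \<in> points X},
     lact = (\<lambda>k P. USet ((\<lambda>p. UPair (lact Y k (ufst p)) (usnd p)) |`| uelems P)),
     ract = (\<lambda>P g. USet ((\<lambda>p. UPair (ufst p) (ract X (usnd p) g)) |`| uelems P))\<rparr>"

definition biset_ext :: "'a univ biset \<Rightarrow> 'a univ biset \<Rightarrow> 'a univ biset" where
  "biset_ext Y X =
    \<lparr>points = {UPair y x | y x. y \<in> points Y \<and> x \<in> points X},
     lact = (\<lambda>p z. UPair (lact Y (ufst p) (ufst z)) (lact X (usnd p) (usnd z))),
     ract = (\<lambda>z p. UPair (ract Y (ufst z) (ufst p)) (ract X (usnd z) (usnd p)))\<rparr>"

definition id_biset :: "'a ugroup \<Rightarrow> 'a univ biset" where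
  "id_biset G = \<lparr>points = carrier G, lact = (\<lambda>g x. g \<otimes>\<^bsub>G\<^esub> x), ract = (\<lambda>x g. x \<otimes>\<^bsub>G\<^esub> g)\<rparr>"

text \<open>\<open>iso_biset G \<psi>\<close> is the \<open>(G, H)\<close>-biset \<open>Iso(\<psi>)\<close> for an isomorphism \<open>\<psi>\<close> from \<open>H\<close> to \<open>G\<close>.\<close>

definition iso_biset :: "'a ugroup \<Rightarrow> ('a univ \<Rightarrow> 'a univ) \<Rightarrow> 'a univ biset" where
  "iso_biset G \<psi> =
    \<lparr>points = carrier G, lact = (\<lambda>g x. g \<otimes>\<^bsub>G\<^esub> x), ract = (\<lambda>x h. x \<otimes>\<^bsub>G\<^esub> \<psi> h)\<rparr>"

definition inf_biset :: "'a ugroup \<Rightarrow> 'a univ biset" where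
  "inf_biset H =
    \<lparr>points = carrier H, lact = (\<lambda>p x. ufst p \<otimes>\<^bsub>H\<^esub> x), ract = (\<lambda>x h. x \<otimes>\<^bsub>H\<^esub> h)\<rparr>"

definition res_biset :: "'a ugroup \<Rightarrow> 'a ugroup \<Rightarrow> 'a univ biset" where
  "res_biset H G =
    \<lparr>points = carrier (H \<boxtimes> G),
     lact = (\<lambda>h z. UPair (h \<otimes>\<^bsub>H\<^esub> ufst z) (usnd z)),
     ract = (\<lambda>z p. z \<otimes>\<^bsub>H \<boxtimes> G\<^esub> p)\<rparr>"

text \<open>The \<open>((K \<times> H) \<times> G, (K \<times> G) \<times> (H \<times> G))\<close>-biset \<open>U\<close>, with left action
  \<open>((k,h),g) \<cdot> ((k',g\<^sub>1),(h',g\<^sub>2)) = ((k k', g g\<^sub>1), (h h', g g\<^sub>2))\<close>.\<close>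

definition U_biset :: "'a ugroup \<Rightarrow> 'a ugroup \<Rightarrow> 'a ugroup \<Rightarrow> 'a univ biset" where
  "U_biset K H G =
    \<lparr>points = carrier ((K \<boxtimes> G) \<boxtimes> (H \<boxtimes> G)),
     lact = (\<lambda>t z. UPair (UPair (ufst (ufst t) \<otimes>\<^bsub>K\<^esub> ufst (ufst z)) (usnd t \<otimes>\<^bsub>G\<^esub> usnd (ufst z)))
                         (UPair (usnd (ufst t) \<otimes>\<^bsub>H\<^esub> ufst (usnd z)) (usnd t \<otimes>\<^bsub>G\<^esub> usnd (usnd z)))),
     ract = (\<lambda>z p. z \<otimes>\<^bsub>(K \<boxtimes> G) \<boxtimes> (H \<boxtimes> G)\<^esub> p)\<rparr>"


section \<open>Abelian groups by generators and relations\<close>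

definition pres_rels :: "'x set \<Rightarrow> ('x \<Rightarrow>\<^sub>0 int) set \<Rightarrow> ('x \<Rightarrow>\<^sub>0 int) set" where
  "pres_rels S R = generate (free_Abelian_group S) R"

definition pres_group :: "'x set \<Rightarrow> ('x \<Rightarrow>\<^sub>0 int) set \<Rightarrow> ('x \<Rightarrow>\<^sub>0 int) set monoid" where
  "pres_group S R = free_Abelian_group S Mod pres_rels S R"

definition pres_class :: "'x set \<Rightarrow> ('x \<Rightarrow>\<^sub>0 int) set \<Rightarrow> ('x \<Rightarrow>\<^sub>0 int) \<Rightarrow> ('x \<Rightarrow>\<^sub>0 int) set" where
  "pres_class S R f = pres_rels S R #>\<^bsub>free_Abelian_group S\<^esub> f"

text \<open>Extension of a map of generators to an additive (biadditive) map into the group presented by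
  \<open>S\<close> and \<open>R\<close>. The unions run over all representatives; when the map respects the relations, all
  the cosets in the union coincide.\<close>

definition pres_ext1 ::
    "'z set \<Rightarrow> ('z \<Rightarrow>\<^sub>0 int) set \<Rightarrow> ('x \<Rightarrow> 'z) \<Rightarrow> ('x \<Rightarrow>\<^sub>0 int) set \<Rightarrow> ('z \<Rightarrow>\<^sub>0 int) set" where
  "pres_ext1 S R \<phi> P = (\<Union>f\<in>P. pres_class S R (frag_extend (\<lambda>x. frag_of (\<phi> x)) f))"

definition pres_ext2 ::
    "'z set \<Rightarrow> ('z \<Rightarrow>\<^sub>0 int) set \<Rightarrow> ('x \<Rightarrow> 'y \<Rightarrow> 'z) \<Rightarrow>
     ('x \<Rightarrow>\<^sub>0 int) set \<Rightarrow> ('y \<Rightarrow>\<^sub>0 int) set \<Rightarrow> ('z \<Rightarrow>\<^sub>0 int) set" where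
  "pres_ext2 S R \<phi> P Q =
     (\<Union>f\<in>P. \<Union>g\<in>Q. pres_class S R (frag_extend (\<lambda>x. frag_extend (\<lambda>y. frag_of (\<phi> x y)) g) f))"


section \<open>The biset category\<close>

definition bisets :: "'a ugroup \<Rightarrow> 'a ugroup \<Rightarrow> 'a univ biset set" where
  "bisets H G = {X. is_biset H G X}"

text \<open>The Grothendieck group \<open>B(H,G)\<close>, with group operation written multiplicatively, as for
  \<^const>\<open>free_Abelian_group\<close>.\<close>

definition B_rel :: "'a ugroup \<Rightarrow> 'a ugroup \<Rightarrow> ('a univ biset \<Rightarrow>\<^sub>0 int) set" where
  "B_rel H G = {frag_of Z - (frag_of X + frag_of Y) | X Y Z.
      X \<in> bisets H G \<and> Y \<in> bisets H G \<and> Z \<in> bisets H G \<and> biset_iso H G Z (biset_union X Y)}"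

type_synonym 'a bclass = "('a univ biset \<Rightarrow>\<^sub>0 int) set"

definition B :: "'a ugroup \<Rightarrow> 'a ugroup \<Rightarrow> 'a bclass monoid" where
  "B H G = pres_group (bisets H G) (B_rel H G)"

definition B_class :: "'a ugroup \<Rightarrow> 'a ugroup \<Rightarrow> 'a univ biset \<Rightarrow> 'a bclass" where
  "B_class H G X = pres_class (bisets H G) (B_rel H G) (frag_of X)"

text \<open>Composition \<open>B(K,H) \<times> B(H,G) \<rightarrow> B(K,G)\<close>.\<close>

definition B_comp ::
    "'a ugroup \<Rightarrow> 'a ugroup \<Rightarrow> 'a ugroup \<Rightarrow> 'a bclass \<Rightarrow> 'a bclass \<Rightarrow> 'a bclass" where
  "B_comp K H G = pres_ext2 (bisets K G) (B_rel K G) (biset_comp H)"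

text \<open>External product \<open>B(L,K) \<times> B(H,G) \<rightarrow> B(L \<times> H, K \<times> G)\<close>.\<close>

definition B_ext ::
    "'a ugroup \<Rightarrow> 'a ugroup \<Rightarrow> 'a ugroup \<Rightarrow> 'a ugroup \<Rightarrow> 'a bclass \<Rightarrow> 'a bclass \<Rightarrow> 'a bclass" where
  "B_ext L K H G = pres_ext2 (bisets (L \<boxtimes> H) (K \<boxtimes> G)) (B_rel (L \<boxtimes> H) (K \<boxtimes> G)) biset_ext"


section \<open>Its \<open>k\<close>-linearization\<close>

text \<open>\<open>k\<close> tensored over the integers with an abelian group \<open>M\<close> (written multiplicatively): the
  abelian group generated by \<open>carrier k \<times> carrier M\<close> modulo biadditivity.\<close>

definition tensor_rel ::
    "('k, 'r) ring_scheme \<Rightarrow> 'm monoid \<Rightarrow> ('k \<times> 'm \<Rightarrow>\<^sub>0 int) set" where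
  "tensor_rel k M =
     {frag_of (r \<oplus>\<^bsub>k\<^esub> s, m) - (frag_of (r, m) + frag_of (s, m)) | r s m.
        r \<in> carrier k \<and> s \<in> carrier k \<and> m \<in> carrier M} \<union>
     {frag_of (r, m \<otimes>\<^bsub>M\<^esub> n) - (frag_of (r, m) + frag_of (r, n)) | r m n.
        r \<in> carrier k \<and> m \<in> carrier M \<and> n \<in> carrier M}"

type_synonym ('k, 'a) kmor = "('k \<times> 'a bclass \<Rightarrow>\<^sub>0 int) set"

abbreviation kB_gens :: "('k, 'r) ring_scheme \<Rightarrow> 'a ugroup \<Rightarrow> 'a ugroup \<Rightarrow> ('k \<times> 'a bclass) set" where
  "kB_gens k H G \<equiv> carrier k \<times> carrier (B H G)"

abbreviation kB_rel :: "('k, 'r) ring_scheme \<Rightarrow> 'a ugroup \<Rightarrow> 'a ugroup \<Rightarrow> ('k \<times> 'a bclass \<Rightarrow>\<^sub>0 int) set" where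
  "kB_rel k H G \<equiv> tensor_rel k (B H G)"

text \<open>The \<open>k\<close>-module of morphisms from \<open>G\<close> to \<open>H\<close>. The ring fields \<open>mult\<close> and \<open>one\<close> of the
  record are irrelevant for a module.\<close>

definition kB :: "('k, 'r) ring_scheme \<Rightarrow> 'a ugroup \<Rightarrow> 'a ugroup \<Rightarrow> ('k, ('k, 'a) kmor) module" where
  "kB k H G = (let Q = pres_group (kB_gens k H G) (kB_rel k H G) in
    \<lparr>carrier = carrier Q, mult = undefined, one = undefined, zero = one Q, add = mult Q,
     smult = (\<lambda>r. pres_ext1 (kB_gens k H G) (kB_rel k H G) (\<lambda>(s, b). (r \<otimes>\<^bsub>k\<^esub> s, b)))\<rparr>)"

definition kB_class ::
    "('k, 'r) ring_scheme \<Rightarrow> 'a ugroup \<Rightarrow> 'a ugroup \<Rightarrow> 'a univ biset \<Rightarrow> ('k, 'a) kmor" where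
  "kB_class k H G X = pres_class (kB_gens k H G) (kB_rel k H G) (frag_of (\<one>\<^bsub>k\<^esub>, B_class H G X))"

definition kB_comp ::
    "('k, 'r) ring_scheme \<Rightarrow> 'a ugroup \<Rightarrow> 'a ugroup \<Rightarrow> 'a ugroup \<Rightarrow>
     ('k, 'a) kmor \<Rightarrow> ('k, 'a) kmor \<Rightarrow> ('k, 'a) kmor" where
  "kB_comp k K H G = pres_ext2 (kB_gens k K G) (kB_rel k K G)
     (\<lambda>(r, b) (s, a). (r \<otimes>\<^bsub>k\<^esub> s, B_comp K H G b a))"

definition kB_ext ::
    "('k, 'r) ring_scheme \<Rightarrow> 'a ugroup \<Rightarrow> 'a ugroup \<Rightarrow> 'a ugroup \<Rightarrow> 'a ugroup \<Rightarrow>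
     ('k, 'a) kmor \<Rightarrow> ('k, 'a) kmor \<Rightarrow> ('k, 'a) kmor" where
  "kB_ext k L K H G = pres_ext2 (kB_gens k (L \<boxtimes> H) (K \<boxtimes> G)) (kB_rel k (L \<boxtimes> H) (K \<boxtimes> G))
     (\<lambda>(r, b) (s, a). (r \<otimes>\<^bsub>k\<^esub> s, B_ext L K H G b a))"

definition kB_id :: "('k, 'r) ring_scheme \<Rightarrow> 'a ugroup \<Rightarrow> ('k, 'a) kmor" where
  "kB_id k G = kB_class k G G (id_biset G)"

text \<open>The object classes allowed for the full subcategory \<open>\<D>\<close>.\<close>

definition admissible :: "'a ugroup set \<Rightarrow> bool" where
  "admissible D \<longleftrightarrow>
     (\<forall>H\<in>D. group H \<and> finite (carrier H)) \<and>
     (\<forall>H\<in>D. \<forall>S N K. subgroup S H \<and> N \<lhd> H\<lparr>carrier := S\<rparr> \<and> group K \<and>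
        K \<cong> H\<lparr>carrier := S\<rparr> Mod N \<longrightarrow> K \<in> D) \<and>
     (\<forall>H\<in>D. \<forall>G\<in>D. \<forall>K. group K \<and> K \<cong> H \<times>\<times> G \<longrightarrow> K \<in> D)"


section \<open>Biset functors\<close>

definition module_hom ::
    "('k, 'r) ring_scheme \<Rightarrow> ('k, 'm) module \<Rightarrow> ('k, 'n) module \<Rightarrow> ('m \<Rightarrow> 'n) \<Rightarrow> bool" where
  "module_hom k M N f \<longleftrightarrow>
     f \<in> carrier M \<rightarrow> carrier N \<and>
     (\<forall>x\<in>carrier M. \<forall>y\<in>carrier M. f (x \<oplus>\<^bsub>M\<^esub> y) = f x \<oplus>\<^bsub>N\<^esub> f y) \<and>
     (\<forall>r\<in>carrier k. \<forall>x\<in>carrier M. f (r \<odot>\<^bsub>M\<^esub> x) = r \<odot>\<^bsub>N\<^esub> f x)"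

text \<open>\<open>Ar A G H\<close> sends \<open>\<alpha> : G \<rightarrow> H\<close>, i.e. \<open>\<alpha> \<in> carrier (kB k H G)\<close>, to \<open>A(\<alpha>) : A(G) \<rightarrow> A(H)\<close>.
  Source and target are arguments because the type of \<open>\<alpha>\<close> does not determine them.
  The modules \<open>A(G)\<close> are carriers in one type \<open>'m\<close>; only their values at objects of \<open>\<D>\<close> matter.\<close>

record ('k, 'a, 'm) biset_functor =
  Ob :: "'a ugroup \<Rightarrow> ('k, 'm) module"
  Ar :: "'a ugroup \<Rightarrow> 'a ugroup \<Rightarrow> ('k, 'a) kmor \<Rightarrow> 'm \<Rightarrow> 'm"

definition is_biset_functor ::
    "('k, 'r) ring_scheme \<Rightarrow> 'a ugroup set \<Rightarrow> ('k, 'a, 'm, 'z) biset_functor_scheme \<Rightarrow> bool" where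
  "is_biset_functor k D A \<longleftrightarrow>
     (\<forall>G\<in>D. module k (Ob A G)) \<and>
     (\<forall>G\<in>D. \<forall>H\<in>D. \<forall>\<alpha>\<in>carrier (kB k H G). module_hom k (Ob A G) (Ob A H) (Ar A G H \<alpha>)) \<and>
     (\<forall>G\<in>D. \<forall>x\<in>carrier (Ob A G). Ar A G G (kB_id k G) x = x) \<and>
     (\<forall>G\<in>D. \<forall>H\<in>D. \<forall>K\<in>D. \<forall>\<alpha>\<in>carrier (kB k H G). \<forall>\<beta>\<in>carrier (kB k K H). \<forall>x\<in>carrier (Ob A G).
        Ar A G K (kB_comp k K H G \<beta> \<alpha>) x = Ar A H K \<beta> (Ar A G H \<alpha> x)) \<and>
     (\<forall>G\<in>D. \<forall>H\<in>D. \<forall>x\<in>carrier (Ob A G). module_hom k (kB k H G) (Ob A H) (\<lambda>\<alpha>. Ar A G H \<alpha> x))"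

definition is_biset_functor_morphism ::
    "('k, 'r) ring_scheme \<Rightarrow> 'a ugroup set \<Rightarrow> ('k, 'a, 'm, 'y) biset_functor_scheme \<Rightarrow>
     ('k, 'a, 'n, 'z) biset_functor_scheme \<Rightarrow> ('a ugroup \<Rightarrow> 'm \<Rightarrow> 'n) \<Rightarrow> bool" where
  "is_biset_functor_morphism k D A C f \<longleftrightarrow>
     is_biset_functor k D A \<and> is_biset_functor k D C \<and>
     (\<forall>H\<in>D. module_hom k (Ob A H) (Ob C H) (f H)) \<and>
     (\<forall>G\<in>D. \<forall>H\<in>D. \<forall>\<alpha>\<in>carrier (kB k H G). \<forall>x\<in>carrier (Ob A G).
        f H (Ar A G H \<alpha> x) = Ar C G H \<alpha> (f G x))"


section \<open>Green biset functors\<close>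

record ('k, 'a, 'm) green_functor = "('k, 'a, 'm) biset_functor" +
  Prd :: "'a ugroup \<Rightarrow> 'a ugroup \<Rightarrow> 'm \<Rightarrow> 'm \<Rightarrow> 'm"
  Eps :: 'm

definition ar_iso ::
    "('k, 'r) ring_scheme \<Rightarrow> ('k, 'a, 'm, 'z) biset_functor_scheme \<Rightarrow> 'a ugroup \<Rightarrow> 'a ugroup \<Rightarrow>
     ('a univ \<Rightarrow> 'a univ) \<Rightarrow> 'm \<Rightarrow> 'm" where
  "ar_iso k A H G \<psi> = Ar A H G (kB_class k G H (iso_biset G \<psi>))"

definition assoc_map :: "'a univ \<Rightarrow> 'a univ" where
  "assoc_map x = UPair (UPair (ufst x) (ufst (usnd x))) (usnd (usnd x))"

definition is_green_functor ::
    "('k, 'r) ring_scheme \<Rightarrow> 'a ugroup set \<Rightarrow> ('k, 'a, 'm) green_functor \<Rightarrow> bool" where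
  "is_green_functor k D A \<longleftrightarrow>
     is_biset_functor k D A \<and>
     Eps A \<in> carrier (Ob A utriv) \<and>
     (\<forall>K\<in>D. \<forall>H\<in>D. \<forall>a\<in>carrier (Ob A K). module_hom k (Ob A H) (Ob A (K \<boxtimes> H)) (\<lambda>b. Prd A K H a b)) \<and>
     (\<forall>K\<in>D. \<forall>H\<in>D. \<forall>b\<in>carrier (Ob A H). module_hom k (Ob A K) (Ob A (K \<boxtimes> H)) (\<lambda>a. Prd A K H a b)) \<and>
     (\<forall>L\<in>D. \<forall>K\<in>D. \<forall>H\<in>D. \<forall>a\<in>carrier (Ob A L). \<forall>b\<in>carrier (Ob A K). \<forall>c\<in>carrier (Ob A H).
        Prd A (L \<boxtimes> K) H (Prd A L K a b) c =
        ar_iso k A (L \<boxtimes> (K \<boxtimes> H)) ((L \<boxtimes> K) \<boxtimes> H) assoc_map (Prd A L (K \<boxtimes> H) a (Prd A K H b c))) \<and>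
     (\<forall>H\<in>D. \<forall>a\<in>carrier (Ob A H).
        ar_iso k A (utriv \<boxtimes> H) H usnd (Prd A utriv H (Eps A) a) = a \<and>
        ar_iso k A (H \<boxtimes> utriv) H ufst (Prd A H utriv a (Eps A)) = a) \<and>
     (\<forall>K\<in>D. \<forall>T\<in>D. \<forall>H\<in>D. \<forall>L\<in>D. \<forall>\<alpha>\<in>carrier (kB k T K). \<forall>\<beta>\<in>carrier (kB k L H).
        \<forall>a\<in>carrier (Ob A K). \<forall>b\<in>carrier (Ob A H).
        Ar A (K \<boxtimes> H) (T \<boxtimes> L) (kB_ext k T K L H \<alpha> \<beta>) (Prd A K H a b) =
        Prd A T L (Ar A K T \<alpha> a) (Ar A H L \<beta> b))"

definition is_green_morphism ::
    "('k, 'r) ring_scheme \<Rightarrow> 'a ugroup set \<Rightarrow> ('k, 'a, 'm) green_functor \<Rightarrow>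
     ('k, 'a, 'n) green_functor \<Rightarrow> ('a ugroup \<Rightarrow> 'm \<Rightarrow> 'n) \<Rightarrow> bool" where
  "is_green_morphism k D A C f \<longleftrightarrow>
     is_green_functor k D A \<and> is_green_functor k D C \<and>
     is_biset_functor_morphism k D A C f \<and>
     (\<forall>K\<in>D. \<forall>H\<in>D. \<forall>a\<in>carrier (Ob A K). \<forall>b\<in>carrier (Ob A H).
        f (K \<boxtimes> H) (Prd A K H a b) = Prd C K H (f K a) (f H b)) \<and>
     f utriv (Eps A) = Eps C"

definition shifted ::
    "('k, 'r) ring_scheme \<Rightarrow> ('k, 'a, 'm) green_functor \<Rightarrow> 'a ugroup \<Rightarrow> ('k, 'a, 'm) green_functor" where
  "shifted k A G =
    \<lparr>Ob = (\<lambda>H. Ob A (H \<boxtimes> G)),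
     Ar = (\<lambda>H L \<alpha>. Ar A (H \<boxtimes> G) (L \<boxtimes> G) (kB_ext k L H G G \<alpha> (kB_id k G))),
     Prd = (\<lambda>K H a b. Ar A ((K \<boxtimes> G) \<boxtimes> (H \<boxtimes> G)) ((K \<boxtimes> H) \<boxtimes> G)
             (kB_class k ((K \<boxtimes> H) \<boxtimes> G) ((K \<boxtimes> G) \<boxtimes> (H \<boxtimes> G)) (U_biset K H G))
             (Prd A (K \<boxtimes> G) (H \<boxtimes> G) a b)),
     Eps = Ar A utriv (utriv \<boxtimes> G) (kB_class k (utriv \<boxtimes> G) utriv (inf_biset utriv)) (Eps A)\<rparr>"

definition res_map ::
    "('k, 'r) ring_scheme \<Rightarrow> ('k, 'a, 'm) green_functor \<Rightarrow> 'a ugroup \<Rightarrow> 'a ugroup \<Rightarrow> 'm \<Rightarrow> 'm" where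
  "res_map k A G H = Ar A (H \<boxtimes> G) H (kB_class k H (H \<boxtimes> G) (res_biset H G))"

end

theory Submission
  imports Defs
begin

text \<open>Every biset occurring in the definitions of \<open>A\<^sub>G\<close> and \<open>Res\<close> is, up to isomorphism, the biset \<open>R(\<phi>)\<close>
  of a homomorphism \<open>\<phi> : P \<rightarrow> Q\<close>: the \<open>(P, Q)\<close>-biset \<open>Q\<close> with \<open>P\<close> acting through \<open>\<phi>\<close>. Thus
  \<open>U\<^sub>K\<^sub>,\<^sub>H\<close> is \<open>R\<close> of the diagonal map \<open>((k, h), g) \<mapsto> ((k, g), (h, g))\<close>, \<open>Inf\<close> is \<open>R\<close> of a
  projection, \<open>Res\<close> is \<open>R\<close> of \<open>h \<mapsto> (h, 1)\<close>, and \<open>Iso(\<psi>)\<close> is \<open>R(\<psi>\<inverse>)\<close>. Moreover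
  \<open>R(\<phi>) \<circ> R(\<chi>) \<cong> R(\<chi> \<circ> \<phi>)\<close> and \<open>R(\<phi>) \<times> R(\<phi>') \<cong> R(\<phi> \<times> \<phi>')\<close>. Writing \<open>\<phi>\<^sup>*\<close> for \<open>A(R(\<phi>))\<close> (the
  constant \<open>pull\<close>), \<open>A\<close> becomes contravariant in homomorphisms, with
  \<open>\<phi>\<^sup>*a \<times> \<phi>'\<^sup>*b = (\<phi> \<times> \<phi>')\<^sup>*(a \<times> b)\<close>, and \<open>a \<times>\<^sup>d b\<close> is the pullback of \<open>a \<times> b\<close> along the diagonal.

  The associativity and unit laws of \<open>A\<^sub>G\<close>, the multiplicativity of \<open>Res\<close> and its compatibility with the
  identity elements then say that two homomorphisms agree. For instance
  \<open>Res(a \<times>\<^sup>d b) = Res(a) \<times> Res(b)\<close> holds because \<open>(k, h) \<mapsto> ((k, h), 1)\<close> followed by the diagonal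
  is the product of \<open>k \<mapsto> (k, 1)\<close> and \<open>h \<mapsto> (h, 1)\<close>.

  What remains involves arbitrary morphisms of the biset category: functoriality of \<open>A\<^sub>G\<close>, naturality of
  \<open>\<times>\<^sup>d\<close> and naturality of \<open>Res\<close>. Both sides of each identity are linear in these morphisms, so they are
  compared on bisets (\<open>kB_hom_eqI\<close>), where the claim is an isomorphism of bisets:
  \<open>biset_ext_id_comp\<close>, \<open>biset_comp_diagonal\<close> and \<open>biset_comp_restriction\<close>. Each of these isomorphisms comes from
  a balanced map on pairs of points, through \<open>biset_comp_iso\<close>. Reducing to bisets requires that composition
  and external product are biadditive on Grothendieck groups and bilinear after tensoring with \<open>k\<close>; as
  both constructions are given by generators and relations, this is the content of \<open>pres_ext2_bihom\<close> and
  \<open>tensor_map2_linear\<close>.\<close>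

section \<open>Presented abelian groups and their tensor products\<close>

lemma pres_rels_subgroup:
  assumes "\<forall>r\<in>R. Poly_Mapping.keys r \<subseteq> S"
  shows "subgroup (pres_rels S R) (free_Abelian_group S)"
  unfolding pres_rels_def
  by (rule group.generate_is_subgroup[OF group_free_Abelian_group]) (use assms in auto)

lemma pres_rels_incl: "r \<in> R \<Longrightarrow> r \<in> pres_rels S R"
  unfolding pres_rels_def by (rule generate.incl)

lemma pres_rels_zero [simp]: "0 \<in> pres_rels S R"
  unfolding pres_rels_def using generate.one[of "free_Abelian_group S" R] by simp

lemma pres_rels_add: "x \<in> pres_rels S R \<Longrightarrow> y \<in> pres_rels S R \<Longrightarrow> x + y \<in> pres_rels S R"
  unfolding pres_rels_def using generate.eng[of x "free_Abelian_group S" R y] by simp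

lemma pres_rels_keys:
  assumes "\<forall>r\<in>R. Poly_Mapping.keys r \<subseteq> S" "x \<in> pres_rels S R"
  shows "Poly_Mapping.keys x \<subseteq> S"
  using subsetD[OF subgroup.subset[OF pres_rels_subgroup[OF assms(1)]] assms(2)] by simp

lemma pres_rels_uminus:
  assumes "\<forall>r\<in>R. Poly_Mapping.keys r \<subseteq> S" "x \<in> pres_rels S R"
  shows "- x \<in> pres_rels S R"
  using subgroup.m_inv_closed[OF pres_rels_subgroup[OF assms(1)] assms(2)]
    pres_rels_keys[OF assms] by simp

lemma pres_rels_diff:
  assumes "\<forall>r\<in>R. Poly_Mapping.keys r \<subseteq> S" "x \<in> pres_rels S R" "y \<in> pres_rels S R"
  shows "x - y \<in> pres_rels S R"
  using pres_rels_add[OF assms(2) pres_rels_uminus[OF assms(1,3)]] by simp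

lemma pres_rels_image:
  assumes R: "\<forall>r\<in>R. Poly_Mapping.keys r \<subseteq> S" and R': "\<forall>r\<in>R'. Poly_Mapping.keys r \<subseteq> S'"
    and add: "\<And>x y. h (x + y) = h x + h y"
    and rel: "\<And>r. r \<in> R \<Longrightarrow> h r \<in> pres_rels S' R'"
    and x: "x \<in> pres_rels S R"
  shows "h x \<in> pres_rels S' R'"
proof -
  have h0: "h 0 = 0"
    using add[of 0 0] by simp
  have hm: "h (- y) = - h y" for y
    using add[of y "- y"] h0 by (simp add: eq_neg_iff_add_eq_0 add.commute)
  show ?thesis
    using x unfolding pres_rels_def
  proof (induction rule: generate.induct)
    case one
    then show ?case using h0 pres_rels_zero[of S' R'] by (simp add: pres_rels_def)
  next
    case (incl r)
    then show ?case using rel by (simp add: pres_rels_def)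
  next
    case (inv r)
    then show ?case
      using R hm pres_rels_uminus[OF R' rel] by (simp add: pres_rels_def)
  next
    case (eng x y)
    then show ?case using add pres_rels_add[of _ S' R'] by (simp add: pres_rels_def)
  qed
qed

lemma mem_pres_class: "g \<in> pres_class S R f \<longleftrightarrow> g - f \<in> pres_rels S R"
  unfolding pres_class_def r_coset_def
  by (auto, metis diff_add_cancel)

lemma pres_class_eq_iff:
  assumes "\<forall>r\<in>R. Poly_Mapping.keys r \<subseteq> S"
  shows "pres_class S R f = pres_class S R g \<longleftrightarrow> f - g \<in> pres_rels S R"
proof
  assume "pres_class S R f = pres_class S R g"
  moreover have "f \<in> pres_class S R f"
    by (simp add: mem_pres_class)
  ultimately show "f - g \<in> pres_rels S R"
    by (simp add: mem_pres_class)
next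
  assume d: "f - g \<in> pres_rels S R"
  have "h - f \<in> pres_rels S R \<longleftrightarrow> h - g \<in> pres_rels S R" for h
    using pres_rels_add[OF _ d, of "h - f"] pres_rels_diff[OF assms _ d, of "h - g"] by auto
  then show "pres_class S R f = pres_class S R g"
    by (auto simp: mem_pres_class)
qed

lemma carrier_pres_group:
  "carrier (pres_group S R) = pres_class S R ` {f. Poly_Mapping.keys f \<subseteq> S}"
  unfolding pres_group_def carrier_FactGroup pres_class_def by auto

lemma pres_group_carrierE:
  assumes "P \<in> carrier (pres_group S R)"
  obtains f where "Poly_Mapping.keys f \<subseteq> S" "P = pres_class S R f"
  using assms unfolding carrier_pres_group by auto

lemma pres_class_in_carrier:
  "Poly_Mapping.keys f \<subseteq> S \<Longrightarrow> pres_class S R f \<in> carrier (pres_group S R)"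
  unfolding carrier_pres_group by auto

lemma pres_group_normal:
  assumes "\<forall>r\<in>R. Poly_Mapping.keys r \<subseteq> S"
  shows "pres_rels S R \<lhd> free_Abelian_group S"
  using comm_group.subgroup_imp_normal[OF abelian_free_Abelian_group pres_rels_subgroup[OF assms]] .

lemma mult_pres_group:
  assumes "\<forall>r\<in>R. Poly_Mapping.keys r \<subseteq> S"
    and "Poly_Mapping.keys f \<subseteq> S" "Poly_Mapping.keys g \<subseteq> S"
  shows "pres_class S R f \<otimes>\<^bsub>pres_group S R\<^esub> pres_class S R g = pres_class S R (f + g)"
  using normal.rcos_sum[OF pres_group_normal[OF assms(1)], of f g] assms(2,3)
  by (simp add: pres_group_def pres_class_def)

lemma one_pres_group: "\<one>\<^bsub>pres_group S R\<^esub> = pres_class S R 0"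
  unfolding pres_group_def by (auto simp: mem_pres_class)

lemma keys_add_subset:
  "Poly_Mapping.keys f \<subseteq> S \<Longrightarrow> Poly_Mapping.keys g \<subseteq> S \<Longrightarrow> Poly_Mapping.keys (f + g) \<subseteq> S"
  using keys_add[of f g] by blast

lemma keys_diff_subset:
  "Poly_Mapping.keys f \<subseteq> S \<Longrightarrow> Poly_Mapping.keys g \<subseteq> S \<Longrightarrow> Poly_Mapping.keys (f - g) \<subseteq> S"
  using keys_diff[of f g] by blast

lemma keys_frag_extend_subset:
  "(\<And>x. x \<in> Poly_Mapping.keys f \<Longrightarrow> Poly_Mapping.keys (h x) \<subseteq> S) \<Longrightarrow>
   Poly_Mapping.keys (frag_extend h f) \<subseteq> S"
  using keys_frag_extend[of h f] by blast

lemma frag_extend_zero_fun: "frag_extend (\<lambda>x. 0) f = 0"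
  by (simp add: frag_extend_def)

lemma frag_extend_diff_fun:
  "frag_extend (\<lambda>x. h x - h' x) f = frag_extend h f - frag_extend h' f"
proof -
  have "Poly_Mapping.keys f \<subseteq> UNIV" by simp
  then show ?thesis
    by (induction f rule: frag_induction) (auto simp: frag_extend_diff)
qed

lemma frag_extend_add_fun:
  "frag_extend (\<lambda>x. h x + h' x) f = frag_extend h f + frag_extend h' f"
proof -
  have "Poly_Mapping.keys f \<subseteq> UNIV" by simp
  then show ?thesis
    by (induction f rule: frag_induction) (auto simp: frag_extend_diff)
qed

text \<open>The value of an extension does not depend on representatives as soon as relations go to
  relations: the union in its definition is then a union of equal cosets.\<close>

lemma pres_ext1_class:
  assumes R1: "\<forall>r\<in>R1. Poly_Mapping.keys r \<subseteq> S1" and R: "\<forall>r\<in>R. Poly_Mapping.keys r \<subseteq> S"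
    and rel: "\<And>r. r \<in> R1 \<Longrightarrow> frag_extend (\<lambda>x. frag_of (\<phi> x)) r \<in> pres_rels S R"
  shows "pres_ext1 S R \<phi> (pres_class S1 R1 f) = pres_class S R (frag_extend (\<lambda>x. frag_of (\<phi> x)) f)"
proof -
  have "pres_class S R (frag_extend (\<lambda>x. frag_of (\<phi> x)) f') =
      pres_class S R (frag_extend (\<lambda>x. frag_of (\<phi> x)) f)"
    if "f' \<in> pres_class S1 R1 f" for f'
    unfolding pres_class_eq_iff[OF R] frag_extend_diff[symmetric]
    using pres_rels_image[OF R1 R frag_extend_add rel] that by (simp add: mem_pres_class)
  moreover have "f \<in> pres_class S1 R1 f"
    by (simp add: mem_pres_class)
  ultimately show ?thesis
    unfolding pres_ext1_def by blast
qed

definition frag_extend2 :: "('x \<Rightarrow> 'y \<Rightarrow> 'z) \<Rightarrow> ('x \<Rightarrow>\<^sub>0 int) \<Rightarrow> ('y \<Rightarrow>\<^sub>0 int) \<Rightarrow> 'z \<Rightarrow>\<^sub>0 int" where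
  "frag_extend2 \<phi> f g = frag_extend (\<lambda>x. frag_extend (\<lambda>y. frag_of (\<phi> x y)) g) f"

lemma frag_extend2_simps [simp]:
  "frag_extend2 \<phi> 0 g = 0"
  "frag_extend2 \<phi> f 0 = 0"
  "frag_extend2 \<phi> (frag_of x) (frag_of y) = frag_of (\<phi> x y)"
  by (simp_all add: frag_extend2_def frag_extend_zero_fun)

lemma frag_extend2_add:
  "frag_extend2 \<phi> (f + f') g = frag_extend2 \<phi> f g + frag_extend2 \<phi> f' g"
  "frag_extend2 \<phi> f (g + g') = frag_extend2 \<phi> f g + frag_extend2 \<phi> f g'"
  by (simp_all add: frag_extend2_def frag_extend_add frag_extend_add_fun)

lemma frag_extend2_diff:
  "frag_extend2 \<phi> (f - f') g = frag_extend2 \<phi> f g - frag_extend2 \<phi> f' g"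
  "frag_extend2 \<phi> f (g - g') = frag_extend2 \<phi> f g - frag_extend2 \<phi> f g'"
  by (simp_all add: frag_extend2_def frag_extend_diff frag_extend_diff_fun)

lemma keys_frag_extend2:
  assumes "\<And>x y. \<lbrakk>x \<in> S1; y \<in> S2\<rbrakk> \<Longrightarrow> \<phi> x y \<in> S"
    and "Poly_Mapping.keys f \<subseteq> S1" "Poly_Mapping.keys g \<subseteq> S2"
  shows "Poly_Mapping.keys (frag_extend2 \<phi> f g) \<subseteq> S"
  unfolding frag_extend2_def
  by (intro keys_frag_extend_subset) (use assms in auto)

text \<open>It is enough to test a relation in one variable against a generator in the other, because the
  extension to free groups is biadditive.\<close>

definition relation_preserving2 ::
    "'x set \<Rightarrow> ('x \<Rightarrow>\<^sub>0 int) set \<Rightarrow> 'y set \<Rightarrow> ('y \<Rightarrow>\<^sub>0 int) set \<Rightarrow> 'z set \<Rightarrow> ('z \<Rightarrow>\<^sub>0 int) set \<Rightarrow>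
     ('x \<Rightarrow> 'y \<Rightarrow> 'z) \<Rightarrow> bool" where
  "relation_preserving2 S1 R1 S2 R2 S R \<phi> \<longleftrightarrow>
     (\<forall>r\<in>R1. Poly_Mapping.keys r \<subseteq> S1) \<and> (\<forall>r\<in>R2. Poly_Mapping.keys r \<subseteq> S2) \<and>
     (\<forall>r\<in>R. Poly_Mapping.keys r \<subseteq> S) \<and> (\<forall>x\<in>S1. \<forall>y\<in>S2. \<phi> x y \<in> S) \<and>
     (\<forall>r\<in>R1. \<forall>y\<in>S2. frag_extend2 \<phi> r (frag_of y) \<in> pres_rels S R) \<and>
     (\<forall>x\<in>S1. \<forall>r\<in>R2. frag_extend2 \<phi> (frag_of x) r \<in> pres_rels S R)"

lemma pres_ext2_class:
  assumes resp: "relation_preserving2 S1 R1 S2 R2 S R \<phi>"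
    and f: "Poly_Mapping.keys f \<subseteq> S1" and g: "Poly_Mapping.keys g \<subseteq> S2"
  shows "pres_ext2 S R \<phi> (pres_class S1 R1 f) (pres_class S2 R2 g) =
    pres_class S R (frag_extend2 \<phi> f g)"
proof -
  have R1: "\<forall>r\<in>R1. Poly_Mapping.keys r \<subseteq> S1" and R2: "\<forall>r\<in>R2. Poly_Mapping.keys r \<subseteq> S2"
    and R: "\<forall>r\<in>R. Poly_Mapping.keys r \<subseteq> S"
    using resp unfolding relation_preserving2_def by blast+
  have left: "frag_extend2 \<phi> r g' \<in> pres_rels S R"
    if r: "r \<in> R1" and g': "Poly_Mapping.keys g' \<subseteq> S2" for r g'
    using g'
  proof (induction g' rule: frag_induction)
    case (one y)
    then show ?case using resp r unfolding relation_preserving2_def by blast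
  qed (simp_all add: frag_extend2_diff pres_rels_diff[OF R])
  have right: "frag_extend2 \<phi> f r \<in> pres_rels S R" if r: "r \<in> R2" for r
    using f
  proof (induction f rule: frag_induction)
    case (one x)
    then show ?case using resp r unfolding relation_preserving2_def by blast
  qed (simp_all add: frag_extend2_diff pres_rels_diff[OF R])
  have left': "frag_extend2 \<phi> n g' \<in> pres_rels S R"
    if "n \<in> pres_rels S1 R1" "Poly_Mapping.keys g' \<subseteq> S2" for n g'
    using pres_rels_image[where h = "\<lambda>n. frag_extend2 \<phi> n g'", OF R1 R frag_extend2_add(1)]
      left that by blast
  have right': "frag_extend2 \<phi> f n \<in> pres_rels S R" if "n \<in> pres_rels S2 R2" for n
    using pres_rels_image[where h = "frag_extend2 \<phi> f", OF R2 R frag_extend2_add(2)] right that by blast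
  have same: "pres_class S R (frag_extend2 \<phi> f' g') = pres_class S R (frag_extend2 \<phi> f g)"
    if f': "f' - f \<in> pres_rels S1 R1" and g': "g' - g \<in> pres_rels S2 R2" for f' g'
  proof -
    have "Poly_Mapping.keys g' \<subseteq> S2"
      using keys_add_subset[OF pres_rels_keys[OF R2 g'] g] by simp
    then have "frag_extend2 \<phi> (f' - f) g' + frag_extend2 \<phi> f (g' - g) \<in> pres_rels S R"
      by (intro pres_rels_add left' right' f' g')
    then show ?thesis
      unfolding pres_class_eq_iff[OF R] frag_extend2_diff by simp
  qed
  have "f \<in> pres_class S1 R1 f" "g \<in> pres_class S2 R2 g"
    by (simp_all add: mem_pres_class)
  then have "(\<Union>f'\<in>pres_class S1 R1 f. \<Union>g'\<in>pres_class S2 R2 g.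
      pres_class S R (frag_extend2 \<phi> f' g')) = pres_class S R (frag_extend2 \<phi> f g)"
    by (intro SUP_eq_const same) (auto simp only: mem_pres_class)
  then show ?thesis
    unfolding pres_ext2_def frag_extend2_def .
qed

definition bihom :: "'x monoid \<Rightarrow> 'y monoid \<Rightarrow> 'z monoid \<Rightarrow> ('x \<Rightarrow> 'y \<Rightarrow> 'z) \<Rightarrow> bool" where
  "bihom M N P m \<longleftrightarrow> (\<forall>y\<in>carrier N. (\<lambda>x. m x y) \<in> hom M P) \<and> (\<forall>x\<in>carrier M. m x \<in> hom N P)"

lemma pres_ext2_bihom:
  fixes \<phi> :: "'x \<Rightarrow> 'y \<Rightarrow> 'z"
  assumes resp: "relation_preserving2 S1 R1 S2 R2 S R \<phi>"
  shows "bihom (pres_group S1 R1) (pres_group S2 R2) (pres_group S R) (pres_ext2 S R \<phi>)"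
proof -
  have R1: "\<forall>r\<in>R1. Poly_Mapping.keys r \<subseteq> S1" and R2: "\<forall>r\<in>R2. Poly_Mapping.keys r \<subseteq> S2"
    and R: "\<forall>r\<in>R. Poly_Mapping.keys r \<subseteq> S"
    and \<phi>: "\<And>x y. x \<in> S1 \<Longrightarrow> y \<in> S2 \<Longrightarrow> \<phi> x y \<in> S"
    using resp by (auto simp: relation_preserving2_def)
  have keys: "Poly_Mapping.keys (frag_extend2 \<phi> f g) \<subseteq> S"
    if "Poly_Mapping.keys f \<subseteq> S1" "Poly_Mapping.keys g \<subseteq> S2" for f g
    by (rule keys_frag_extend2[where ?S1.0 = S1 and ?S2.0 = S2]) (use \<phi> that in auto)
  note simps = mult_pres_group[OF R1] mult_pres_group[OF R2] mult_pres_group[OF R]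
    pres_ext2_class[OF resp] keys_add_subset frag_extend2_add pres_class_in_carrier
  show ?thesis
    unfolding bihom_def
  proof (intro conjI ballI homI; elim pres_group_carrierE; hypsubst)
    fix f :: "'x \<Rightarrow>\<^sub>0 int" and g :: "'y \<Rightarrow>\<^sub>0 int"
    assume "Poly_Mapping.keys f \<subseteq> S1" "Poly_Mapping.keys g \<subseteq> S2"
    with keys[of f g] show "pres_ext2 S R \<phi> (pres_class S1 R1 f) (pres_class S2 R2 g) \<in> carrier (pres_group S R)"
      "pres_ext2 S R \<phi> (pres_class S1 R1 f) (pres_class S2 R2 g) \<in> carrier (pres_group S R)"
      by (simp_all add: simps)
  next
    fix f f' :: "'x \<Rightarrow>\<^sub>0 int" and g :: "'y \<Rightarrow>\<^sub>0 int"
    assume "Poly_Mapping.keys f \<subseteq> S1" "Poly_Mapping.keys f' \<subseteq> S1" "Poly_Mapping.keys g \<subseteq> S2"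
    with keys[of f g] keys[of f' g]
    show "pres_ext2 S R \<phi> (pres_class S1 R1 f \<otimes>\<^bsub>pres_group S1 R1\<^esub> pres_class S1 R1 f') (pres_class S2 R2 g) =
      pres_ext2 S R \<phi> (pres_class S1 R1 f) (pres_class S2 R2 g) \<otimes>\<^bsub>pres_group S R\<^esub>
      pres_ext2 S R \<phi> (pres_class S1 R1 f') (pres_class S2 R2 g)"
      by (simp add: simps)
  next
    fix f :: "'x \<Rightarrow>\<^sub>0 int" and g g' :: "'y \<Rightarrow>\<^sub>0 int"
    assume "Poly_Mapping.keys f \<subseteq> S1" "Poly_Mapping.keys g \<subseteq> S2" "Poly_Mapping.keys g' \<subseteq> S2"
    with keys[of f g] keys[of f g']
    show "pres_ext2 S R \<phi> (pres_class S1 R1 f) (pres_class S2 R2 g \<otimes>\<^bsub>pres_group S2 R2\<^esub> pres_class S2 R2 g') =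
      pres_ext2 S R \<phi> (pres_class S1 R1 f) (pres_class S2 R2 g) \<otimes>\<^bsub>pres_group S R\<^esub>
      pres_ext2 S R \<phi> (pres_class S1 R1 f) (pres_class S2 R2 g')"
      by (simp add: simps)
  qed
qed

definition tensor_module :: "('k, 'r) ring_scheme \<Rightarrow> 'm monoid \<Rightarrow> ('k, ('k \<times> 'm \<Rightarrow>\<^sub>0 int) set) module" where
  "tensor_module k M = (let S = carrier k \<times> carrier M; R = tensor_rel k M; Q = pres_group S R in
    \<lparr>carrier = carrier Q, mult = undefined, one = undefined, zero = one Q, add = mult Q,
     smult = (\<lambda>r. pres_ext1 S R (\<lambda>(s, b). (r \<otimes>\<^bsub>k\<^esub> s, b)))\<rparr>)"

definition pure_tensor :: "('k, 'r) ring_scheme \<Rightarrow> 'm monoid \<Rightarrow> 'k \<Rightarrow> 'm \<Rightarrow> ('k \<times> 'm \<Rightarrow>\<^sub>0 int) set" where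
  "pure_tensor k M r m = pres_class (carrier k \<times> carrier M) (tensor_rel k M) (frag_of (r, m))"

definition scale_frag :: "('k, 'r) ring_scheme \<Rightarrow> 'k \<Rightarrow> ('k \<times> 'm \<Rightarrow>\<^sub>0 int) \<Rightarrow> 'k \<times> 'm \<Rightarrow>\<^sub>0 int" where
  "scale_frag k r = frag_extend (\<lambda>x. frag_of (case x of (s, b) \<Rightarrow> (r \<otimes>\<^bsub>k\<^esub> s, b)))"

lemma scale_frag_simps [simp]:
  "scale_frag k r 0 = 0"
  "scale_frag k r (frag_of (s, b)) = frag_of (r \<otimes>\<^bsub>k\<^esub> s, b)"
  "scale_frag k r (f + g) = scale_frag k r f + scale_frag k r g"
  "scale_frag k r (f - g) = scale_frag k r f - scale_frag k r g"
  by (simp_all add: scale_frag_def frag_extend_add frag_extend_diff)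

lemma keys_frag_relation:
  "a \<in> S \<Longrightarrow> b \<in> S \<Longrightarrow> c \<in> S \<Longrightarrow> Poly_Mapping.keys (frag_of a - (frag_of b + frag_of c)) \<subseteq> S"
  by (intro keys_diff_subset keys_add_subset) auto

lemma tensor_relI:
  "\<lbrakk>r \<in> carrier k; s \<in> carrier k; m \<in> carrier M\<rbrakk> \<Longrightarrow>
    frag_of (r \<oplus>\<^bsub>k\<^esub> s, m) - (frag_of (r, m) + frag_of (s, m)) \<in> tensor_rel k M"
  "\<lbrakk>r \<in> carrier k; m \<in> carrier M; n \<in> carrier M\<rbrakk> \<Longrightarrow>
    frag_of (r, m \<otimes>\<^bsub>M\<^esub> n) - (frag_of (r, m) + frag_of (r, n)) \<in> tensor_rel k M"
  unfolding tensor_rel_def by blast+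

lemma tensor_rel_keys:
  assumes "cring k" "group M"
  shows "\<forall>r\<in>tensor_rel k M. Poly_Mapping.keys r \<subseteq> carrier k \<times> carrier M"
proof -
  interpret k: cring k by fact
  interpret M: group M by fact
  show ?thesis
    unfolding tensor_rel_def
    by (intro ballI, elim UnE CollectE exE conjE; simp only:; intro keys_frag_relation) auto
qed

lemma keys_scale_frag:
  assumes "cring k" "r \<in> carrier k" "Poly_Mapping.keys f \<subseteq> carrier k \<times> carrier M"
  shows "Poly_Mapping.keys (scale_frag k r f) \<subseteq> carrier k \<times> carrier M"
proof -
  interpret k: cring k by fact
  show ?thesis
    unfolding scale_frag_def
    by (rule keys_frag_extend_subset) (use assms(2,3) in auto)
qed

lemma tensor_module_carrier:
  "carrier (tensor_module k M) = carrier (pres_group (carrier k \<times> carrier M) (tensor_rel k M))"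
  by (simp add: tensor_module_def Let_def)

lemma tensor_module_carrierE:
  assumes "x \<in> carrier (tensor_module k M)"
  obtains f where "Poly_Mapping.keys f \<subseteq> carrier k \<times> carrier M"
    "x = pres_class (carrier k \<times> carrier M) (tensor_rel k M) f"
  using assms unfolding tensor_module_carrier by (rule pres_group_carrierE)

lemma tensor_module_add:
  assumes "cring k" "group M"
    and "Poly_Mapping.keys f \<subseteq> carrier k \<times> carrier M" "Poly_Mapping.keys g \<subseteq> carrier k \<times> carrier M"
  shows "pres_class (carrier k \<times> carrier M) (tensor_rel k M) f \<oplus>\<^bsub>tensor_module k M\<^esub>
      pres_class (carrier k \<times> carrier M) (tensor_rel k M) g =
    pres_class (carrier k \<times> carrier M) (tensor_rel k M) (f + g)"
  using mult_pres_group[OF tensor_rel_keys[OF assms(1,2)] assms(3,4)]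
  by (simp add: tensor_module_def Let_def)

text \<open>Scalar multiplication is given on generators and sends relations to relations, so it can be computed
  on representatives.\<close>

lemma tensor_module_smult:
  assumes "cring k" "group M" "r \<in> carrier k"
  shows "r \<odot>\<^bsub>tensor_module k M\<^esub> pres_class (carrier k \<times> carrier M) (tensor_rel k M) f =
    pres_class (carrier k \<times> carrier M) (tensor_rel k M) (scale_frag k r f)"
proof -
  interpret k: cring k by fact
  interpret M: group M by fact
  have "\<forall>x\<in>tensor_rel k M. scale_frag k r x \<in> tensor_rel k M"
    unfolding Ball_def
    by (subst (1) tensor_rel_def) (use assms(3) in \<open>auto simp: k.r_distr tensor_relI\<close>)
  then have "pres_ext1 (carrier k \<times> carrier M) (tensor_rel k M) (\<lambda>(s, b). (r \<otimes>\<^bsub>k\<^esub> s, b))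
      (pres_class (carrier k \<times> carrier M) (tensor_rel k M) f) =
    pres_class (carrier k \<times> carrier M) (tensor_rel k M) (scale_frag k r f)"
    unfolding scale_frag_def
    by (intro pres_ext1_class tensor_rel_keys assms pres_rels_incl) auto
  then show ?thesis
    by (simp add: tensor_module_def Let_def)
qed

lemma pure_tensor_mult:
  assumes "cring k" "group M" "r \<in> carrier k" "m \<in> carrier M" "n \<in> carrier M"
  shows "pure_tensor k M r (m \<otimes>\<^bsub>M\<^esub> n) = pure_tensor k M r m \<oplus>\<^bsub>tensor_module k M\<^esub> pure_tensor k M r n"
  unfolding pure_tensor_def using assms pres_rels_incl[OF tensor_relI(2)[OF assms(3-5)]]
  by (simp add: tensor_module_add pres_class_eq_iff[OF tensor_rel_keys[OF assms(1,2)]])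

lemma smult_pure_tensor:
  assumes "cring k" "group M" "r \<in> carrier k"
  shows "r \<odot>\<^bsub>tensor_module k M\<^esub> pure_tensor k M s m = pure_tensor k M (r \<otimes>\<^bsub>k\<^esub> s) m"
  unfolding pure_tensor_def by (simp add: tensor_module_smult assms)

lemma tensor_rels_zero:
  assumes "cring k" "group M"
  shows "m \<in> carrier M \<Longrightarrow> frag_of (\<zero>\<^bsub>k\<^esub>, m) \<in> pres_rels (carrier k \<times> carrier M) (tensor_rel k M)"
    and "r \<in> carrier k \<Longrightarrow> frag_of (r, \<one>\<^bsub>M\<^esub>) \<in> pres_rels (carrier k \<times> carrier M) (tensor_rel k M)"
proof -
  interpret k: cring k by fact
  interpret M: group M by fact
  let ?N = "pres_rels (carrier k \<times> carrier M) (tensor_rel k M)"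
  note uminus = pres_rels_uminus[OF tensor_rel_keys[OF assms]]
  show "frag_of (\<zero>\<^bsub>k\<^esub>, m) \<in> ?N" if "m \<in> carrier M"
  proof -
    have "frag_of (\<zero>\<^bsub>k\<^esub> \<oplus>\<^bsub>k\<^esub> \<zero>\<^bsub>k\<^esub>, m) - (frag_of (\<zero>\<^bsub>k\<^esub>, m) + frag_of (\<zero>\<^bsub>k\<^esub>, m)) \<in> ?N"
      using that by (intro pres_rels_incl tensor_relI) simp_all
    from uminus[OF this] show ?thesis by simp
  qed
  show "frag_of (r, \<one>\<^bsub>M\<^esub>) \<in> ?N" if "r \<in> carrier k"
  proof -
    have "frag_of (r, \<one>\<^bsub>M\<^esub> \<otimes>\<^bsub>M\<^esub> \<one>\<^bsub>M\<^esub>) - (frag_of (r, \<one>\<^bsub>M\<^esub>) + frag_of (r, \<one>\<^bsub>M\<^esub>)) \<in> ?N"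
      using that by (intro pres_rels_incl tensor_relI) simp_all
    from uminus[OF this] show ?thesis by simp
  qed
qed

text \<open>Inverses in the group can be moved to the scalar, and thus be expressed by scalar multiples.\<close>

lemma pure_tensor_inv:
  assumes "cring k" "group M" "r \<in> carrier k" "m \<in> carrier M"
  shows "pure_tensor k M r (inv\<^bsub>M\<^esub> m) = pure_tensor k M (\<ominus>\<^bsub>k\<^esub> r) m"
proof -
  interpret k: cring k by fact
  interpret M: group M by fact
  let ?N = "pres_rels (carrier k \<times> carrier M) (tensor_rel k M)"
  note keys = tensor_rel_keys[OF assms(1,2)]
  have a: "frag_of (r, inv\<^bsub>M\<^esub> m \<otimes>\<^bsub>M\<^esub> m) - (frag_of (r, inv\<^bsub>M\<^esub> m) + frag_of (r, m)) \<in> ?N"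
    and b: "frag_of (r \<oplus>\<^bsub>k\<^esub> \<ominus>\<^bsub>k\<^esub> r, m) - (frag_of (r, m) + frag_of (\<ominus>\<^bsub>k\<^esub> r, m)) \<in> ?N"
    using assms by (intro pres_rels_incl tensor_relI; simp)+
  have a': "frag_of (r, inv\<^bsub>M\<^esub> m) + frag_of (r, m) \<in> ?N"
    using pres_rels_diff[OF keys tensor_rels_zero(2)[OF assms(1-3)] a] assms by (simp add: add.commute)
  have b': "frag_of (r, m) + frag_of (\<ominus>\<^bsub>k\<^esub> r, m) \<in> ?N"
    using pres_rels_diff[OF keys tensor_rels_zero(1)[OF assms(1,2,4)] b] assms by (simp add: k.r_neg add.commute)
  show ?thesis
    unfolding pure_tensor_def pres_class_eq_iff[OF keys]
    using pres_rels_diff[OF keys a' b'] by simp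
qed

lemma tensor_module_zero_scalar:
  assumes "cring k" "group M" and x: "x \<in> carrier (tensor_module k M)"
  shows "\<zero>\<^bsub>k\<^esub> \<odot>\<^bsub>tensor_module k M\<^esub> x = pres_class (carrier k \<times> carrier M) (tensor_rel k M) 0"
proof -
  interpret k: cring k by fact
  obtain f where f: "Poly_Mapping.keys f \<subseteq> carrier k \<times> carrier M"
    and x: "x = pres_class (carrier k \<times> carrier M) (tensor_rel k M) f"
    using x by (rule tensor_module_carrierE)
  note keys = tensor_rel_keys[OF assms(1,2)]
  have "scale_frag k \<zero>\<^bsub>k\<^esub> f \<in> pres_rels (carrier k \<times> carrier M) (tensor_rel k M)"
    using f
  proof (induction f rule: frag_induction)
    case (one y)
    then obtain s m where y: "y = (s, m)" "s \<in> carrier k" "m \<in> carrier M"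
      by auto
    then show ?case
      using tensor_rels_zero(1)[OF assms(1,2)] by simp
  qed (simp_all add: pres_rels_diff[OF keys])
  then show ?thesis
    by (simp add: x tensor_module_smult assms pres_class_eq_iff[OF keys])
qed

lemma tensor_module_minus_one_scalar:
  assumes "cring k" "group M" and f: "Poly_Mapping.keys f \<subseteq> carrier k \<times> carrier M"
  shows "(\<ominus>\<^bsub>k\<^esub> \<one>\<^bsub>k\<^esub>) \<odot>\<^bsub>tensor_module k M\<^esub> pres_class (carrier k \<times> carrier M) (tensor_rel k M) f =
    pres_class (carrier k \<times> carrier M) (tensor_rel k M) (- f)"
proof -
  interpret k: cring k by fact
  note keys = tensor_rel_keys[OF assms(1,2)]
  let ?N = "pres_rels (carrier k \<times> carrier M) (tensor_rel k M)"
  have "scale_frag k (\<ominus>\<^bsub>k\<^esub> \<one>\<^bsub>k\<^esub>) f + f \<in> ?N"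
    using f
  proof (induction f rule: frag_induction)
    case (one y)
    then obtain s m where y: "y = (s, m)" "s \<in> carrier k" "m \<in> carrier M"
      by auto
    have "frag_of ((\<ominus>\<^bsub>k\<^esub> s) \<oplus>\<^bsub>k\<^esub> s, m) - (frag_of (\<ominus>\<^bsub>k\<^esub> s, m) + frag_of (s, m)) \<in> ?N"
      using y by (intro pres_rels_incl) (rule tensor_relI; simp)
    from pres_rels_diff[OF keys tensor_rels_zero(1)[OF assms(1,2) y(3)] this] show ?case
      using y by (simp add: k.l_minus k.l_neg add.commute)
  next
    case (diff a b)
    then show ?case
      using pres_rels_diff[OF keys diff.IH] by (simp add: algebra_simps)
  qed simp
  then show ?thesis
    using f by (simp add: tensor_module_smult assms pres_class_eq_iff[OF keys])
qed

text \<open>Negation is multiplication by \<open>-1\<close>, so sums and scalar multiples of the tensors \<open>1 \<otimes> m\<close>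
  exhaust the module.\<close>

lemma tensor_module_induct:
  assumes k: "cring k" and M: "group M" and x: "x \<in> carrier (tensor_module k M)"
    and unit: "\<And>m. m \<in> carrier M \<Longrightarrow> P (pure_tensor k M \<one>\<^bsub>k\<^esub> m)"
    and add: "\<And>x y. \<lbrakk>x \<in> carrier (tensor_module k M); y \<in> carrier (tensor_module k M); P x; P y\<rbrakk> \<Longrightarrow>
      P (x \<oplus>\<^bsub>tensor_module k M\<^esub> y)"
    and smult: "\<And>r x. \<lbrakk>r \<in> carrier k; x \<in> carrier (tensor_module k M); P x\<rbrakk> \<Longrightarrow>
      P (r \<odot>\<^bsub>tensor_module k M\<^esub> x)"
  shows "P x"
proof -
  interpret k: cring k by fact
  interpret M: group M by fact
  let ?S = "carrier k \<times> carrier M"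
  let ?c = "pres_class ?S (tensor_rel k M)"
  have in_carrier: "?c f \<in> carrier (tensor_module k M)" if "Poly_Mapping.keys f \<subseteq> ?S" for f
    using that by (simp add: tensor_module_carrier pres_class_in_carrier)
  obtain f where f: "Poly_Mapping.keys f \<subseteq> ?S" and x: "x = ?c f"
    using x by (rule tensor_module_carrierE)
  have P_one: "P (?c (frag_of (\<one>\<^bsub>k\<^esub>, m)))" if "m \<in> carrier M" for m
    using unit[OF that] by (simp add: pure_tensor_def)
  have one_in: "?c (frag_of (\<one>\<^bsub>k\<^esub>, m)) \<in> carrier (tensor_module k M)" if "m \<in> carrier M" for m
    using that by (intro in_carrier) auto
  have "Poly_Mapping.keys f \<subseteq> ?S \<and> P (?c f)"
    using f
  proof (induction f rule: frag_induction)
    case zero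
    then show ?case
      using smult[OF k.zero_closed one_in[OF M.one_closed] P_one[OF M.one_closed]] M.one_closed
      by (simp add: tensor_module_zero_scalar[OF k M one_in])
  next
    case (one y)
    then obtain r m where y: "y = (r, m)" "r \<in> carrier k" "m \<in> carrier M"
      by auto
    then show ?case
      using smult[OF y(2) one_in[OF y(3)] P_one[OF y(3)]]
      by (simp add: tensor_module_smult k M)
  next
    case (diff a b)
    then have b: "Poly_Mapping.keys (- b) \<subseteq> ?S" and "P (?c (- b))"
      using smult[of "\<ominus>\<^bsub>k\<^esub> \<one>\<^bsub>k\<^esub>" "?c b"] in_carrier[of b]
      by (simp_all add: tensor_module_minus_one_scalar[OF k M])
    then have "P (?c (a + - b))"
      using diff add[OF in_carrier[of a] in_carrier[OF b]] by (simp add: tensor_module_add k M b)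
    then show ?case
      using diff keys_diff_subset[of a ?S b] by simp
  qed
  then show ?thesis by (simp add: x)
qed

text \<open>For a biadditive \<open>m\<close>, this is the bilinear map with \<open>(r \<otimes> x, s \<otimes> y) \<mapsto> r s \<otimes> m x y\<close>. Composition and
  external product in the linearized biset category are both of this form.\<close>

definition tensor_map2 ::
    "('k, 'r) ring_scheme \<Rightarrow> 'z monoid \<Rightarrow> ('x \<Rightarrow> 'y \<Rightarrow> 'z) \<Rightarrow>
     ('k \<times> 'x \<Rightarrow>\<^sub>0 int) set \<Rightarrow> ('k \<times> 'y \<Rightarrow>\<^sub>0 int) set \<Rightarrow> ('k \<times> 'z \<Rightarrow>\<^sub>0 int) set" where
  "tensor_map2 k P m = pres_ext2 (carrier k \<times> carrier P) (tensor_rel k P)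
     (\<lambda>(r, x) (s, y). (r \<otimes>\<^bsub>k\<^esub> s, m x y))"

locale tensor_bilinear =
  fixes k :: "('k, 'r) ring_scheme" and M1 :: "'x monoid" and M2 :: "'y monoid" and M3 :: "'z monoid"
    and m :: "'x \<Rightarrow> 'y \<Rightarrow> 'z"
  assumes k: "cring k" and M1: "group M1" and M2: "group M2" and M3: "group M3"
    and m: "bihom M1 M2 M3 m"
begin

sublocale k: cring k by (rule k)

abbreviation "S1 \<equiv> carrier k \<times> carrier M1"
abbreviation "S2 \<equiv> carrier k \<times> carrier M2"
abbreviation "S3 \<equiv> carrier k \<times> carrier M3"
abbreviation "\<phi> \<equiv> (\<lambda>(r, x) (s, y). (r \<otimes>\<^bsub>k\<^esub> s, m x y))"

lemma m_closed: "x \<in> carrier M1 \<Longrightarrow> y \<in> carrier M2 \<Longrightarrow> m x y \<in> carrier M3"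
  using m unfolding bihom_def hom_def by blast

lemma m_add_left:
  "\<lbrakk>x \<in> carrier M1; x' \<in> carrier M1; y \<in> carrier M2\<rbrakk> \<Longrightarrow> m (x \<otimes>\<^bsub>M1\<^esub> x') y = m x y \<otimes>\<^bsub>M3\<^esub> m x' y"
  using m unfolding bihom_def hom_def by blast

lemma m_add_right:
  "\<lbrakk>x \<in> carrier M1; y \<in> carrier M2; y' \<in> carrier M2\<rbrakk> \<Longrightarrow> m x (y \<otimes>\<^bsub>M2\<^esub> y') = m x y \<otimes>\<^bsub>M3\<^esub> m x y'"
  using m unfolding bihom_def hom_def by blast

lemma tensor_map2_relations: "relation_preserving2 S1 (tensor_rel k M1) S2 (tensor_rel k M2) S3 (tensor_rel k M3) \<phi>"
proof -
  have "frag_extend2 \<phi> r (frag_of y) \<in> pres_rels S3 (tensor_rel k M3)"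
    if r: "r \<in> tensor_rel k M1" and y: "y \<in> S2" for r y
  proof -
    obtain t n where y: "y = (t, n)" "t \<in> carrier k" "n \<in> carrier M2"
      using y by auto
    show ?thesis
      using r y unfolding tensor_rel_def[of k M1]
      by (auto simp: frag_extend2_diff frag_extend2_add k.l_distr m_add_left m_closed intro!: pres_rels_incl tensor_relI)
  qed
  moreover have "frag_extend2 \<phi> (frag_of x) r \<in> pres_rels S3 (tensor_rel k M3)"
    if x: "x \<in> S1" and r: "r \<in> tensor_rel k M2" for x r
  proof -
    obtain t n where x: "x = (t, n)" "t \<in> carrier k" "n \<in> carrier M1"
      using x by auto
    show ?thesis
      using r x unfolding tensor_rel_def[of k M2]
      by (auto simp: frag_extend2_diff frag_extend2_add k.r_distr m_add_right m_closed intro!: pres_rels_incl tensor_relI)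
  qed
  ultimately show ?thesis
    unfolding relation_preserving2_def
    using tensor_rel_keys[OF k M1] tensor_rel_keys[OF k M2] tensor_rel_keys[OF k M3]
    by (auto simp: m_closed)
qed

lemma tensor_map2_class:
  "\<lbrakk>Poly_Mapping.keys f \<subseteq> S1; Poly_Mapping.keys g \<subseteq> S2\<rbrakk> \<Longrightarrow>
   tensor_map2 k M3 m (pres_class S1 (tensor_rel k M1) f) (pres_class S2 (tensor_rel k M2) g) =
   pres_class S3 (tensor_rel k M3) (frag_extend2 \<phi> f g)"
  unfolding tensor_map2_def by (rule pres_ext2_class[OF tensor_map2_relations])

lemma tensor_map2_pure:
  "\<lbrakk>r \<in> carrier k; x \<in> carrier M1; s \<in> carrier k; y \<in> carrier M2\<rbrakk> \<Longrightarrow>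
   tensor_map2 k M3 m (pure_tensor k M1 r x) (pure_tensor k M2 s y) =
   pure_tensor k M3 (r \<otimes>\<^bsub>k\<^esub> s) (m x y)"
  unfolding pure_tensor_def by (simp add: tensor_map2_class)

lemma keys_tensor_map2:
  "\<lbrakk>Poly_Mapping.keys f \<subseteq> S1; Poly_Mapping.keys g \<subseteq> S2\<rbrakk> \<Longrightarrow>
   Poly_Mapping.keys (frag_extend2 \<phi> f g) \<subseteq> S3"
  by (rule keys_frag_extend2[where ?S1.0 = S1 and ?S2.0 = S2]) (auto simp: m_closed)

lemma frag_extend2_scale:
  assumes r: "r \<in> carrier k" and f: "Poly_Mapping.keys f \<subseteq> S1" and g: "Poly_Mapping.keys g \<subseteq> S2"
  shows "frag_extend2 \<phi> (scale_frag k r f) g = scale_frag k r (frag_extend2 \<phi> f g)"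
    and "frag_extend2 \<phi> f (scale_frag k r g) = scale_frag k r (frag_extend2 \<phi> f g)"
proof -
  have "frag_extend2 \<phi> (scale_frag k r f) g = scale_frag k r (frag_extend2 \<phi> f g) \<and>
    frag_extend2 \<phi> f (scale_frag k r g) = scale_frag k r (frag_extend2 \<phi> f g)"
    using f
  proof (induction f rule: frag_induction)
    case (one x)
    then obtain s b where x: "x = (s, b)" "s \<in> carrier k" by auto
    show ?case
      using g
    proof (induction g rule: frag_induction)
      case (one y)
      then obtain t c where y: "y = (t, c)" "t \<in> carrier k" by auto
      then show ?case
        using x r by (simp add: k.m_assoc k.m_lcomm)
    qed (simp_all add: x frag_extend2_diff)
  qed (simp_all add: frag_extend2_diff)
  then show "frag_extend2 \<phi> (scale_frag k r f) g = scale_frag k r (frag_extend2 \<phi> f g)"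
    and "frag_extend2 \<phi> f (scale_frag k r g) = scale_frag k r (frag_extend2 \<phi> f g)"
    by blast+
qed

lemma tensor_map2_linear:
  "y \<in> carrier (tensor_module k M2) \<Longrightarrow>
    module_hom k (tensor_module k M1) (tensor_module k M3) (\<lambda>x. tensor_map2 k M3 m x y)"
  "x \<in> carrier (tensor_module k M1) \<Longrightarrow>
    module_hom k (tensor_module k M2) (tensor_module k M3) (tensor_map2 k M3 m x)"
  unfolding module_hom_def
  by (intro conjI ballI funcsetI; elim tensor_module_carrierE;
      simp add: tensor_map2_class tensor_module_add tensor_module_smult k M1 M2 M3 keys_add_subset
        keys_scale_frag frag_extend2_add frag_extend2_scale keys_tensor_map2 tensor_module_carrier
        pres_class_in_carrier)+

end

section \<open>Bisets\<close>

lemma uprod_simps [simp]: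
  "UPair h g \<in> carrier (H \<boxtimes> G) \<longleftrightarrow> h \<in> carrier H \<and> g \<in> carrier G"
  "p \<otimes>\<^bsub>H \<boxtimes> G\<^esub> q = UPair (ufst p \<otimes>\<^bsub>H\<^esub> ufst q) (usnd p \<otimes>\<^bsub>G\<^esub> usnd q)"
  "\<one>\<^bsub>H \<boxtimes> G\<^esub> = UPair \<one>\<^bsub>H\<^esub> \<one>\<^bsub>G\<^esub>"
  by (auto simp: uprod_def)

lemma carrier_uprodE:
  assumes "p \<in> carrier (H \<boxtimes> G)"
  obtains h g where "p = UPair h g" "h \<in> carrier H" "g \<in> carrier G"
  using assms by (auto simp: uprod_def)

lemma ball_uprod: "(\<forall>p\<in>carrier (H \<boxtimes> G). P p) \<longleftrightarrow> (\<forall>h\<in>carrier H. \<forall>g\<in>carrier G. P (UPair h g))"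
  by (auto simp: uprod_def)

lemma carrier_uprod: "carrier (H \<boxtimes> G) = (\<lambda>(h, g). UPair h g) ` (carrier H \<times> carrier G)"
  by (auto simp: uprod_def)

lemma finite_uprod: "finite (carrier H) \<Longrightarrow> finite (carrier G) \<Longrightarrow> finite (carrier (H \<boxtimes> G))"
  by (simp add: carrier_uprod)

lemma group_uprod:
  assumes "group H" "group G"
  shows "group (H \<boxtimes> G)"
proof -
  interpret H: group H by fact
  interpret G: group G by fact
  show ?thesis
  proof (rule groupI)
    fix p assume "p \<in> carrier (H \<boxtimes> G)"
    then obtain h g where p: "p = UPair h g" "h \<in> carrier H" "g \<in> carrier G"
      by (rule carrier_uprodE)
    then show "\<exists>q\<in>carrier (H \<boxtimes> G). q \<otimes>\<^bsub>H \<boxtimes> G\<^esub> p = \<one>\<^bsub>H \<boxtimes> G\<^esub>"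
      by (intro bexI[of _ "UPair (inv\<^bsub>H\<^esub> h) (inv\<^bsub>G\<^esub> g)"]) simp_all
  qed (auto elim!: carrier_uprodE simp: H.m_assoc G.m_assoc)
qed

lemma group_utriv: "group utriv"
  by (rule groupI) (auto simp: utriv_def)

lemma is_bisetD:
  assumes "is_biset H G X"
  shows "finite (points X)"
    and "\<And>h x. \<lbrakk>h \<in> carrier H; x \<in> points X\<rbrakk> \<Longrightarrow> lact X h x \<in> points X"
    and "\<And>x g. \<lbrakk>x \<in> points X; g \<in> carrier G\<rbrakk> \<Longrightarrow> ract X x g \<in> points X"
    and "\<And>x. x \<in> points X \<Longrightarrow> lact X \<one>\<^bsub>H\<^esub> x = x"
    and "\<And>h h' x. \<lbrakk>h \<in> carrier H; h' \<in> carrier H; x \<in> points X\<rbrakk> \<Longrightarrow>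
      lact X (h \<otimes>\<^bsub>H\<^esub> h') x = lact X h (lact X h' x)"
    and "\<And>x. x \<in> points X \<Longrightarrow> ract X x \<one>\<^bsub>G\<^esub> = x"
    and "\<And>x g g'. \<lbrakk>x \<in> points X; g \<in> carrier G; g' \<in> carrier G\<rbrakk> \<Longrightarrow>
      ract X x (g \<otimes>\<^bsub>G\<^esub> g') = ract X (ract X x g) g'"
    and "\<And>h x g. \<lbrakk>h \<in> carrier H; x \<in> points X; g \<in> carrier G\<rbrakk> \<Longrightarrow>
      ract X (lact X h x) g = lact X h (ract X x g)"
  using assms unfolding is_biset_def by blast+

lemma biset_isoI:
  assumes "bij_betw f (points X) (points Y)"
    and "\<And>h x. \<lbrakk>h \<in> carrier H; x \<in> points X\<rbrakk> \<Longrightarrow> f (lact X h x) = lact Y h (f x)"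
    and "\<And>x g. \<lbrakk>x \<in> points X; g \<in> carrier G\<rbrakk> \<Longrightarrow> f (ract X x g) = ract Y (f x) g"
  shows "biset_iso H G X Y"
  using assms unfolding biset_iso_def by blast

lemma biset_iso_id:
  assumes "points X = points Y"
    and "\<And>h x. \<lbrakk>h \<in> carrier H; x \<in> points X\<rbrakk> \<Longrightarrow> lact X h x = lact Y h x"
    and "\<And>x g. \<lbrakk>x \<in> points X; g \<in> carrier G\<rbrakk> \<Longrightarrow> ract X x g = ract Y x g"
  shows "biset_iso H G X Y"
  by (rule biset_isoI[where f = id]) (use assms in auto)

subsection \<open>Composition\<close>

locale biset_pair =
  fixes K H G :: "'a ugroup" and Y X :: "'a univ biset"
  assumes H: "group H" and fin: "finite (carrier H)"
    and Y: "is_biset K H Y" and X: "is_biset H G X"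
begin

sublocale H: group H by (rule H)

lemmas Y_simps = is_bisetD(2-)[OF Y]
lemmas X_simps = is_bisetD(2-)[OF X]

lemma fset_orbit:
  "fset (uelems (orbit_pt H Y X y x)) = (\<lambda>h. UPair (ract Y y (inv\<^bsub>H\<^esub> h)) (lact X h x)) ` carrier H"
  unfolding orbit_pt_def by (simp add: Abs_fset_inverse fin)

lemma orbit_eqI:
  assumes "fset A = fset (uelems (orbit_pt H Y X y x))"
  shows "orbit_pt H Y X y x = USet A"
  using assms by (simp add: fset_inject orbit_pt_def)

lemma orbit_pt_balanced:
  assumes "y \<in> points Y" "x \<in> points X" "h \<in> carrier H"
  shows "orbit_pt H Y X (ract Y y h) x = orbit_pt H Y X y (lact X h x)"
proof -
  have "(\<lambda>h'. UPair (ract Y (ract Y y h) (inv\<^bsub>H\<^esub> h')) (lact X h' x)) ` carrier H =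
      (\<lambda>h'. UPair (ract Y y (inv\<^bsub>H\<^esub> h')) (lact X h' (lact X h x))) ` carrier H"
  proof (intro equalityI image_subsetI)
    fix h' assume h': "h' \<in> carrier H"
    show "UPair (ract Y (ract Y y h) (inv\<^bsub>H\<^esub> h')) (lact X h' x) \<in>
        (\<lambda>h'. UPair (ract Y y (inv\<^bsub>H\<^esub> h')) (lact X h' (lact X h x))) ` carrier H"
      by (rule image_eqI[of _ _ "h' \<otimes>\<^bsub>H\<^esub> inv\<^bsub>H\<^esub> h"])
         (use assms h' in \<open>simp_all flip: Y_simps(6) X_simps(4) add: H.inv_mult_group H.m_assoc\<close>)
  next
    fix h' assume h': "h' \<in> carrier H"
    show "UPair (ract Y y (inv\<^bsub>H\<^esub> h')) (lact X h' (lact X h x)) \<in>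
        (\<lambda>h'. UPair (ract Y (ract Y y h) (inv\<^bsub>H\<^esub> h')) (lact X h' x)) ` carrier H"
      by (rule image_eqI[of _ _ "h' \<otimes>\<^bsub>H\<^esub> h"])
         (use assms h' in \<open>simp_all flip: Y_simps(6) X_simps(4) add: H.inv_mult_group H.m_assoc[symmetric]\<close>)
  qed
  then show ?thesis
    by (simp add: orbit_pt_def)
qed

text \<open>The inverse in the action \<open>h \<cdot> (y, x) = (y h\<inverse>, h x)\<close> is moved to the other side: the
  orbits of \<open>(y' h, x)\<close> and \<open>(y', h x)\<close> are the same.\<close>

lemma orbit_pt_eq_iff:
  assumes "y \<in> points Y" "x \<in> points X" "y' \<in> points Y" "x' \<in> points X"
  shows "orbit_pt H Y X y x = orbit_pt H Y X y' x' \<longleftrightarrow>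
    (\<exists>h\<in>carrier H. y = ract Y y' h \<and> x' = lact X h x)"
proof
  assume eq: "orbit_pt H Y X y x = orbit_pt H Y X y' x'"
  have "UPair y' x' \<in> fset (uelems (orbit_pt H Y X y' x'))"
    unfolding fset_orbit using assms
    by (intro image_eqI[of _ _ "\<one>\<^bsub>H\<^esub>"]) (simp_all add: Y_simps X_simps)
  then obtain h where h: "h \<in> carrier H" "y' = ract Y y (inv\<^bsub>H\<^esub> h)" "x' = lact X h x"
    unfolding eq[symmetric] fset_orbit by auto
  then have "y = ract Y y' h"
    using assms by (simp flip: Y_simps(6) add: Y_simps(5))
  then show "\<exists>h\<in>carrier H. y = ract Y y' h \<and> x' = lact X h x"
    using h by blast
next
  assume "\<exists>h\<in>carrier H. y = ract Y y' h \<and> x' = lact X h x"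
  then obtain h where "h \<in> carrier H" "y = ract Y y' h" "x' = lact X h x" by blast
  then show "orbit_pt H Y X y x = orbit_pt H Y X y' x'"
    using orbit_pt_balanced[of y' x h] assms by simp
qed

lemma points_comp: "P \<in> points (biset_comp H Y X) \<longleftrightarrow>
    (\<exists>y\<in>points Y. \<exists>x\<in>points X. P = orbit_pt H Y X y x)"
  by (auto simp: biset_comp_def)

lemma ball_points_comp:
  "(\<forall>P\<in>points (biset_comp H Y X). Q P) \<longleftrightarrow> (\<forall>y\<in>points Y. \<forall>x\<in>points X. Q (orbit_pt H Y X y x))"
  unfolding Ball_def points_comp by blast

lemma orbit_in_comp: "y \<in> points Y \<Longrightarrow> x \<in> points X \<Longrightarrow> orbit_pt H Y X y x \<in> points (biset_comp H Y X)"
  by (auto simp: points_comp)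

lemma lact_comp:
  assumes "k \<in> carrier K" "y \<in> points Y" "x \<in> points X"
  shows "lact (biset_comp H Y X) k (orbit_pt H Y X y x) = orbit_pt H Y X (lact Y k y) x"
proof -
  have "fset (uelems (orbit_pt H Y X (lact Y k y) x)) =
      (\<lambda>p. UPair (lact Y k (ufst p)) (usnd p)) ` fset (uelems (orbit_pt H Y X y x))"
    unfolding fset_orbit image_image using assms by (intro image_cong) (simp_all add: Y_simps)
  then show ?thesis
    unfolding biset_comp_def biset.simps by (intro orbit_eqI[symmetric]) simp
qed

lemma ract_comp:
  assumes "g \<in> carrier G" "y \<in> points Y" "x \<in> points X"
  shows "ract (biset_comp H Y X) (orbit_pt H Y X y x) g = orbit_pt H Y X y (ract X x g)"
proof -
  have "fset (uelems (orbit_pt H Y X y (ract X x g))) =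
      (\<lambda>p. UPair (ufst p) (ract X (usnd p) g)) ` fset (uelems (orbit_pt H Y X y x))"
    unfolding fset_orbit image_image using assms by (intro image_cong) (simp_all add: X_simps)
  then show ?thesis
    unfolding biset_comp_def biset.simps by (intro orbit_eqI[symmetric]) simp
qed

lemma is_biset_comp:
  assumes "group K" "group G"
  shows "is_biset K G (biset_comp H Y X)"
proof -
  interpret K: group K by fact
  interpret G: group G by fact
  have "points (biset_comp H Y X) = (\<lambda>(y, x). orbit_pt H Y X y x) ` (points Y \<times> points X)"
    by (auto simp: biset_comp_def)
  then have "finite (points (biset_comp H Y X))"
    using is_bisetD(1)[OF X] is_bisetD(1)[OF Y] by simp
  then show ?thesis
    unfolding is_biset_def ball_points_comp
    by (simp add: lact_comp ract_comp orbit_in_comp Y_simps X_simps)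
qed

text \<open>A balanced map on \<open>Y \<times> X\<close> factors through the orbits; it is an isomorphism from \<open>Y \<circ> X\<close> as
  soon as it is onto and separates orbits. Every identity between composites below comes from one
  such map, written out on pairs of points.\<close>

lemma biset_comp_iso:
  assumes closed: "\<And>y x. \<lbrakk>y \<in> points Y; x \<in> points X\<rbrakk> \<Longrightarrow> F y x \<in> points Z"
    and balanced: "\<And>y x h. \<lbrakk>y \<in> points Y; x \<in> points X; h \<in> carrier H\<rbrakk> \<Longrightarrow>
      F (ract Y y h) x = F y (lact X h x)"
    and onto: "\<And>z. z \<in> points Z \<Longrightarrow> \<exists>y\<in>points Y. \<exists>x\<in>points X. F y x = z"
    and separates: "\<And>y x y' x'. \<lbrakk>y \<in> points Y; x \<in> points X; y' \<in> points Y; x' \<in> points X;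
      F y x = F y' x'\<rbrakk> \<Longrightarrow> \<exists>h\<in>carrier H. y = ract Y y' h \<and> x' = lact X h x"
    and left: "\<And>k y x. \<lbrakk>k \<in> carrier K; y \<in> points Y; x \<in> points X\<rbrakk> \<Longrightarrow>
      F (lact Y k y) x = lact Z k (F y x)"
    and right: "\<And>g y x. \<lbrakk>g \<in> carrier G; y \<in> points Y; x \<in> points X\<rbrakk> \<Longrightarrow>
      F y (ract X x g) = ract Z (F y x) g"
  shows "biset_iso K G (biset_comp H Y X) Z"
proof -
  define f where "f P = (let p = SOME p. p \<in> fset (uelems P) in F (ufst p) (usnd p))" for P
  have f: "f (orbit_pt H Y X y x) = F y x" if yx: "y \<in> points Y" "x \<in> points X" for y x
  proof -
    define p where "p = (SOME p. p \<in> fset (uelems (orbit_pt H Y X y x)))"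
    have "\<exists>p. p \<in> fset (uelems (orbit_pt H Y X y x))"
      unfolding fset_orbit using H.one_closed by blast
    then have "p \<in> fset (uelems (orbit_pt H Y X y x))"
      unfolding p_def by (rule someI_ex)
    then obtain h where h: "h \<in> carrier H" "p = UPair (ract Y y (inv\<^bsub>H\<^esub> h)) (lact X h x)"
      unfolding fset_orbit by auto
    have "F (ract Y y (inv\<^bsub>H\<^esub> h)) (lact X h x) = F (ract Y (ract Y y (inv\<^bsub>H\<^esub> h)) h) x"
      using balanced[of "ract Y y (inv\<^bsub>H\<^esub> h)" x h] yx h by (simp add: Y_simps(2))
    also have "ract Y (ract Y y (inv\<^bsub>H\<^esub> h)) h = y"
      using yx h by (simp flip: Y_simps(6) add: Y_simps(5))
    finally show ?thesis
      by (simp add: f_def p_def[symmetric] h)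
  qed
  have "bij_betw f (points (biset_comp H Y X)) (points Z)"
    unfolding bij_betw_def
  proof
    show "inj_on f (points (biset_comp H Y X))"
      by (rule inj_onI) (auto simp: points_comp f orbit_pt_eq_iff dest: separates)
    show "f ` points (biset_comp H Y X) = points Z"
    proof (intro equalityI image_subsetI subsetI)
      fix P assume "P \<in> points (biset_comp H Y X)"
      then show "f P \<in> points Z" by (auto simp: points_comp f closed)
    next
      fix z assume "z \<in> points Z"
      then obtain y x where yx: "y \<in> points Y" "x \<in> points X" "F y x = z"
        using onto by blast
      then show "z \<in> f ` points (biset_comp H Y X)"
        by (intro image_eqI[of _ _ "orbit_pt H Y X y x"]) (auto simp: f points_comp)
    qed
  qed
  then show ?thesis
    by (rule biset_isoI) (auto simp: points_comp lact_comp ract_comp f Y_simps X_simps left right)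
qed

end

subsection \<open>External products and disjoint unions\<close>

lemma points_ext: "z \<in> points (biset_ext Y X) \<longleftrightarrow> (\<exists>y\<in>points Y. \<exists>x\<in>points X. z = UPair y x)"
  by (auto simp: biset_ext_def)

lemma act_ext [simp]:
  "lact (biset_ext Y X) p z = UPair (lact Y (ufst p) (ufst z)) (lact X (usnd p) (usnd z))"
  "ract (biset_ext Y X) z p = UPair (ract Y (ufst z) (ufst p)) (ract X (usnd z) (usnd p))"
  by (simp_all add: biset_ext_def)

lemma is_biset_ext:
  assumes Y: "is_biset L K Y" and X: "is_biset H G X"
  shows "is_biset (L \<boxtimes> H) (K \<boxtimes> G) (biset_ext Y X)"
proof -
  have "points (biset_ext Y X) = (\<lambda>(y, x). UPair y x) ` (points Y \<times> points X)"
    by (auto simp: biset_ext_def)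
  then have "finite (points (biset_ext Y X))"
    using is_bisetD(1)[OF X] is_bisetD(1)[OF Y] by simp
  then show ?thesis
    unfolding is_biset_def ball_uprod
    by (auto simp: points_ext is_bisetD(2-)[OF Y] is_bisetD(2-)[OF X])
qed

lemma usum_map_simps [simp]:
  "usum_map f f' (UInl x) = UInl (f x)"
  "usum_map f f' (UInr x) = UInr (f' x)"
  by (simp_all add: usum_map_def)

lemma union_simps [simp]:
  "points (biset_union X Y) = UInl ` points X \<union> UInr ` points Y"
  "lact (biset_union X Y) h z = usum_map (lact X h) (lact Y h) z"
  "ract (biset_union X Y) z g = usum_map (\<lambda>x. ract X x g) (\<lambda>y. ract Y y g) z"
  by (simp_all add: biset_union_def)

lemma biset_isoE:
  assumes "biset_iso H G X Y"
  obtains f where "bij_betw f (points X) (points Y)"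
    and "\<And>h x. \<lbrakk>h \<in> carrier H; x \<in> points X\<rbrakk> \<Longrightarrow> f (lact X h x) = lact Y h (f x)"
    and "\<And>x g. \<lbrakk>x \<in> points X; g \<in> carrier G\<rbrakk> \<Longrightarrow> f (ract X x g) = ract Y (f x) g"
  using assms unfolding biset_iso_def by blast

lemma bij_betw_cases_ext:
  assumes f: "bij_betw f A (UInl ` S \<union> UInr ` T)" and z: "z \<in> A"
  obtains (inl) x where "x \<in> S" "f z = UInl x" | (inr) y where "y \<in> T" "f z = UInr y"
  using f z unfolding bij_betw_def by blast

lemma bij_betw_onto:
  assumes "bij_betw f A S" "b \<in> S"
  obtains a where "a \<in> A" "f a = b"
  using assms unfolding bij_betw_def by blast

text \<open>The external product and the composition preserve disjoint unions in each variable, which makes them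
  biadditive on Grothendieck groups. In all four cases the isomorphism keeps the tag of the component in which
  the decomposed factor lies.\<close>

lemma biset_ext_union_left:
  assumes "biset_iso L K Z (biset_union X Y)"
  shows "biset_iso (L \<boxtimes> H) (K \<boxtimes> G) (biset_ext Z W) (biset_union (biset_ext X W) (biset_ext Y W))"
proof -
  obtain f where f: "bij_betw f (points Z) (UInl ` points X \<union> UInr ` points Y)"
    and l: "\<And>h x. \<lbrakk>h \<in> carrier L; x \<in> points Z\<rbrakk> \<Longrightarrow> f (lact Z h x) = usum_map (lact X h) (lact Y h) (f x)"
    and r: "\<And>x g. \<lbrakk>x \<in> points Z; g \<in> carrier K\<rbrakk> \<Longrightarrow>
      f (ract Z x g) = usum_map (\<lambda>x. ract X x g) (\<lambda>y. ract Y y g) (f x)"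
    using assms by (rule biset_isoE) simp
  define F where "F p = usum_map (\<lambda>x. UPair x (usnd p)) (\<lambda>y. UPair y (usnd p)) (f (ufst p))" for p
  have F: "F (UPair z w) = usum_map (\<lambda>x. UPair x w) (\<lambda>y. UPair y w) (f z)" for z w
    by (simp add: F_def)
  have inj: "inj_on f (points Z)"
    using f by (rule bij_betw_imp_inj_on)
  show ?thesis
  proof (rule biset_isoI[where f = F])
    show "bij_betw F (points (biset_ext Z W)) (points (biset_union (biset_ext X W) (biset_ext Y W)))"
      unfolding bij_betw_def
    proof
      show "inj_on F (points (biset_ext Z W))"
      proof (rule inj_onI, unfold points_ext, elim bexE, simp only: F)
        fix z w z' w' assume z: "z \<in> points Z" "z' \<in> points Z"
          and eq: "usum_map (\<lambda>x. UPair x w) (\<lambda>y. UPair y w) (f z) =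
            usum_map (\<lambda>x. UPair x w') (\<lambda>y. UPair y w') (f z')"
        have "f z = f z' \<and> w = w'"
          using eq by (cases rule: bij_betw_cases_ext[OF f z(1)]; cases rule: bij_betw_cases_ext[OF f z(2)]) auto
        then show "UPair z w = UPair z' w'"
          using inj_onD[OF inj _ z] by simp
      qed
      show "F ` points (biset_ext Z W) = points (biset_union (biset_ext X W) (biset_ext Y W))"
      proof (intro equalityI image_subsetI subsetI)
        fix p assume "p \<in> points (biset_ext Z W)"
        then obtain z w where p: "p = UPair z w" "z \<in> points Z" "w \<in> points W"
          unfolding points_ext by blast
        show "F p \<in> points (biset_union (biset_ext X W) (biset_ext Y W))"
          using p by (cases rule: bij_betw_cases_ext[OF f p(2)]) (auto simp: F points_ext)
      next
        fix q assume "q \<in> points (biset_union (biset_ext X W) (biset_ext Y W))"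
        then consider x w where "q = UInl (UPair x w)" "x \<in> points X" "w \<in> points W"
          | y w where "q = UInr (UPair y w)" "y \<in> points Y" "w \<in> points W"
          by (auto simp: points_ext)
        then show "q \<in> F ` points (biset_ext Z W)"
        proof cases
          case (1 x w)
          then obtain z where z: "z \<in> points Z" "f z = UInl x"
            using bij_betw_onto[OF f, of "UInl x"] by blast
          with 1 show ?thesis by (intro image_eqI[of _ _ "UPair z w"]) (auto simp: F points_ext)
        next
          case (2 y w)
          then obtain z where z: "z \<in> points Z" "f z = UInr y"
            using bij_betw_onto[OF f, of "UInr y"] by blast
          with 2 show ?thesis by (intro image_eqI[of _ _ "UPair z w"]) (auto simp: F points_ext)
        qed
      qed
    qed
  next
    fix h p assume "h \<in> carrier (L \<boxtimes> H)" "p \<in> points (biset_ext Z W)"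
    then obtain l k z w where h: "h = UPair l k" "l \<in> carrier L" and p: "p = UPair z w" "z \<in> points Z"
      unfolding points_ext by (blast elim: carrier_uprodE)
    show "F (lact (biset_ext Z W) h p) = lact (biset_union (biset_ext X W) (biset_ext Y W)) h (F p)"
      by (cases rule: bij_betw_cases_ext[OF f p(2)]) (simp_all add: p h F l)
  next
    fix p g assume "p \<in> points (biset_ext Z W)" "g \<in> carrier (K \<boxtimes> G)"
    then obtain l k z w where g: "g = UPair l k" "l \<in> carrier K" and p: "p = UPair z w" "z \<in> points Z"
      unfolding points_ext by (blast elim: carrier_uprodE)
    show "F (ract (biset_ext Z W) p g) = ract (biset_union (biset_ext X W) (biset_ext Y W)) (F p) g"
      by (cases rule: bij_betw_cases_ext[OF f p(2)]) (simp_all add: p g F r)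
  qed
qed

lemma biset_ext_union_right:
  assumes "biset_iso H G Z (biset_union X Y)"
  shows "biset_iso (L \<boxtimes> H) (K \<boxtimes> G) (biset_ext W Z) (biset_union (biset_ext W X) (biset_ext W Y))"
proof -
  obtain f where f: "bij_betw f (points Z) (UInl ` points X \<union> UInr ` points Y)"
    and l: "\<And>h x. \<lbrakk>h \<in> carrier H; x \<in> points Z\<rbrakk> \<Longrightarrow> f (lact Z h x) = usum_map (lact X h) (lact Y h) (f x)"
    and r: "\<And>x g. \<lbrakk>x \<in> points Z; g \<in> carrier G\<rbrakk> \<Longrightarrow>
      f (ract Z x g) = usum_map (\<lambda>x. ract X x g) (\<lambda>y. ract Y y g) (f x)"
    using assms by (rule biset_isoE) simp
  define F where "F p = usum_map (UPair (ufst p)) (UPair (ufst p)) (f (usnd p))" for p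
  have F: "F (UPair w z) = usum_map (UPair w) (UPair w) (f z)" for z w
    by (simp add: F_def)
  have inj: "inj_on f (points Z)"
    using f by (rule bij_betw_imp_inj_on)
  show ?thesis
  proof (rule biset_isoI[where f = F])
    show "bij_betw F (points (biset_ext W Z)) (points (biset_union (biset_ext W X) (biset_ext W Y)))"
      unfolding bij_betw_def
    proof
      show "inj_on F (points (biset_ext W Z))"
      proof (rule inj_onI, unfold points_ext, elim bexE, simp only: F)
        fix z w z' w' assume z: "z \<in> points Z" "z' \<in> points Z"
          and eq: "usum_map (UPair w) (UPair w) (f z) = usum_map (UPair w') (UPair w') (f z')"
        have "f z = f z' \<and> w = w'"
          using eq by (cases rule: bij_betw_cases_ext[OF f z(1)]; cases rule: bij_betw_cases_ext[OF f z(2)]) auto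
        then show "UPair w z = UPair w' z'"
          using inj_onD[OF inj _ z] by simp
      qed
      show "F ` points (biset_ext W Z) = points (biset_union (biset_ext W X) (biset_ext W Y))"
      proof (intro equalityI image_subsetI subsetI)
        fix p assume "p \<in> points (biset_ext W Z)"
        then obtain z w where p: "p = UPair w z" "z \<in> points Z" "w \<in> points W"
          unfolding points_ext by blast
        show "F p \<in> points (biset_union (biset_ext W X) (biset_ext W Y))"
          using p by (cases rule: bij_betw_cases_ext[OF f p(2)]) (auto simp: F points_ext)
      next
        fix q assume "q \<in> points (biset_union (biset_ext W X) (biset_ext W Y))"
        then consider x w where "q = UInl (UPair w x)" "x \<in> points X" "w \<in> points W"
          | y w where "q = UInr (UPair w y)" "y \<in> points Y" "w \<in> points W"
          by (auto simp: points_ext)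
        then show "q \<in> F ` points (biset_ext W Z)"
        proof cases
          case (1 x w)
          then obtain z where z: "z \<in> points Z" "f z = UInl x"
            using bij_betw_onto[OF f, of "UInl x"] by blast
          with 1 show ?thesis by (intro image_eqI[of _ _ "UPair w z"]) (auto simp: F points_ext)
        next
          case (2 y w)
          then obtain z where z: "z \<in> points Z" "f z = UInr y"
            using bij_betw_onto[OF f, of "UInr y"] by blast
          with 2 show ?thesis by (intro image_eqI[of _ _ "UPair w z"]) (auto simp: F points_ext)
        qed
      qed
    qed
  next
    fix h p assume "h \<in> carrier (L \<boxtimes> H)" "p \<in> points (biset_ext W Z)"
    then obtain l k z w where h: "h = UPair l k" "k \<in> carrier H" and p: "p = UPair w z" "z \<in> points Z"
      unfolding points_ext by (blast elim: carrier_uprodE)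
    show "F (lact (biset_ext W Z) h p) = lact (biset_union (biset_ext W X) (biset_ext W Y)) h (F p)"
      by (cases rule: bij_betw_cases_ext[OF f p(2)]) (simp_all add: p h F l)
  next
    fix p g assume "p \<in> points (biset_ext W Z)" "g \<in> carrier (K \<boxtimes> G)"
    then obtain l k z w where g: "g = UPair l k" "k \<in> carrier G" and p: "p = UPair w z" "z \<in> points Z"
      unfolding points_ext by (blast elim: carrier_uprodE)
    show "F (ract (biset_ext W Z) p g) = ract (biset_union (biset_ext W X) (biset_ext W Y)) (F p) g"
      by (cases rule: bij_betw_cases_ext[OF f p(2)]) (simp_all add: p g F r)
  qed
qed

lemma biset_comp_union_left:
  assumes H: "group H" "finite (carrier H)" and X: "is_biset K H X" and Y: "is_biset K H Y"
    and Z: "is_biset K H Z" and W: "is_biset H G W"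
    and iso: "biset_iso K H Z (biset_union X Y)"
  shows "biset_iso K G (biset_comp H Z W) (biset_union (biset_comp H X W) (biset_comp H Y W))"
proof -
  interpret Z: biset_pair K H G Z W by (rule biset_pair.intro) (fact H Z W)+
  interpret X: biset_pair K H G X W by (rule biset_pair.intro) (fact H X W)+
  interpret Y: biset_pair K H G Y W by (rule biset_pair.intro) (fact H Y W)+
  obtain f where f: "bij_betw f (points Z) (UInl ` points X \<union> UInr ` points Y)"
    and l: "\<And>h x. \<lbrakk>h \<in> carrier K; x \<in> points Z\<rbrakk> \<Longrightarrow> f (lact Z h x) = usum_map (lact X h) (lact Y h) (f x)"
    and r: "\<And>x g. \<lbrakk>x \<in> points Z; g \<in> carrier H\<rbrakk> \<Longrightarrow>
      f (ract Z x g) = usum_map (\<lambda>x. ract X x g) (\<lambda>y. ract Y y g) (f x)"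
    using iso by (rule biset_isoE) simp
  note cases = bij_betw_cases_ext[OF f]
  have inj: "z = z'" if "f z = f z'" "z \<in> points Z" "z' \<in> points Z" for z z'
    using inj_onD[OF bij_betw_imp_inj_on[OF f] that] .
  define F where "F z w = usum_map (\<lambda>x. orbit_pt H X W x w) (\<lambda>y. orbit_pt H Y W y w) (f z)" for z w
  show ?thesis
  proof (rule Z.biset_comp_iso[where F = F])
    fix z w assume z: "z \<in> points Z" and w: "w \<in> points W"
    show "F z w \<in> points (biset_union (biset_comp H X W) (biset_comp H Y W))"
      using w by (cases rule: cases[OF z]) (auto simp: F_def X.orbit_in_comp Y.orbit_in_comp)
    show "F (ract Z z h) w = F z (lact W h w)" if "h \<in> carrier H" for h
      using w that
      by (cases rule: cases[OF z]) (simp_all add: F_def r z X.orbit_pt_balanced Y.orbit_pt_balanced)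
    show "F (lact Z k z) w = lact (biset_union (biset_comp H X W) (biset_comp H Y W)) k (F z w)"
      if "k \<in> carrier K" for k
      using w that by (cases rule: cases[OF z]) (simp_all add: F_def l z X.lact_comp Y.lact_comp)
    show "F z (ract W w g) = ract (biset_union (biset_comp H X W) (biset_comp H Y W)) (F z w) g"
      if "g \<in> carrier G" for g
      using w that by (cases rule: cases[OF z]) (simp_all add: F_def z X.ract_comp Y.ract_comp)
  next
    fix q assume "q \<in> points (biset_union (biset_comp H X W) (biset_comp H Y W))"
    then consider x w where "q = UInl (orbit_pt H X W x w)" "x \<in> points X" "w \<in> points W"
      | y w where "q = UInr (orbit_pt H Y W y w)" "y \<in> points Y" "w \<in> points W"
      by (auto simp: X.points_comp Y.points_comp)
    then show "\<exists>z\<in>points Z. \<exists>w\<in>points W. F z w = q"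
    proof cases
      case (1 x w)
      then obtain z where z: "z \<in> points Z" "f z = UInl x"
        using bij_betw_onto[OF f, of "UInl x"] by blast
      with 1 show ?thesis by (intro bexI[of _ z] bexI[of _ w]) (auto simp: F_def)
    next
      case (2 y w)
      then obtain z where z: "z \<in> points Z" "f z = UInr y"
        using bij_betw_onto[OF f, of "UInr y"] by blast
      with 2 show ?thesis by (intro bexI[of _ z] bexI[of _ w]) (auto simp: F_def)
    qed
  next
    fix z w z' w' assume z: "z \<in> points Z" and w: "w \<in> points W" and z': "z' \<in> points Z"
      and w': "w' \<in> points W" and eq: "F z w = F z' w'"
    have "\<exists>h\<in>carrier H. f z = f (ract Z z' h) \<and> w' = lact W h w"
      using eq w w' z' by (cases rule: cases[OF z]; cases rule: cases[OF z'])
        (auto simp: F_def X.orbit_pt_eq_iff Y.orbit_pt_eq_iff r)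
    then show "\<exists>h\<in>carrier H. z = ract Z z' h \<and> w' = lact W h w"
      using inj z z' by (blast intro: Z.Y_simps(2))
  qed
qed

lemma biset_comp_union_right:
  assumes H: "group H" "finite (carrier H)" and X: "is_biset H G X" and Y: "is_biset H G Y"
    and Z: "is_biset H G Z" and W: "is_biset K H W"
    and iso: "biset_iso H G Z (biset_union X Y)"
  shows "biset_iso K G (biset_comp H W Z) (biset_union (biset_comp H W X) (biset_comp H W Y))"
proof -
  interpret Z: biset_pair K H G W Z by (rule biset_pair.intro) (fact H Z W)+
  interpret X: biset_pair K H G W X by (rule biset_pair.intro) (fact H X W)+
  interpret Y: biset_pair K H G W Y by (rule biset_pair.intro) (fact H Y W)+
  obtain f where f: "bij_betw f (points Z) (UInl ` points X \<union> UInr ` points Y)"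
    and l: "\<And>h x. \<lbrakk>h \<in> carrier H; x \<in> points Z\<rbrakk> \<Longrightarrow> f (lact Z h x) = usum_map (lact X h) (lact Y h) (f x)"
    and r: "\<And>x g. \<lbrakk>x \<in> points Z; g \<in> carrier G\<rbrakk> \<Longrightarrow>
      f (ract Z x g) = usum_map (\<lambda>x. ract X x g) (\<lambda>y. ract Y y g) (f x)"
    using iso by (rule biset_isoE) simp
  note cases = bij_betw_cases_ext[OF f]
  have inj: "z = z'" if "f z = f z'" "z \<in> points Z" "z' \<in> points Z" for z z'
    using inj_onD[OF bij_betw_imp_inj_on[OF f] that] .
  define F where "F w z = usum_map (orbit_pt H W X w) (orbit_pt H W Y w) (f z)" for z w
  show ?thesis
  proof (rule Z.biset_comp_iso[where F = F])
    fix z w assume z: "z \<in> points Z" and w: "w \<in> points W"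
    show "F w z \<in> points (biset_union (biset_comp H W X) (biset_comp H W Y))"
      using w by (cases rule: cases[OF z]) (auto simp: F_def X.orbit_in_comp Y.orbit_in_comp)
    show "F (ract W w h) z = F w (lact Z h z)" if "h \<in> carrier H" for h
      using w that
      by (cases rule: cases[OF z]) (simp_all add: F_def l z X.orbit_pt_balanced Y.orbit_pt_balanced)
    show "F (lact W k w) z = lact (biset_union (biset_comp H W X) (biset_comp H W Y)) k (F w z)"
      if "k \<in> carrier K" for k
      using w that by (cases rule: cases[OF z]) (simp_all add: F_def z X.lact_comp Y.lact_comp)
    show "F w (ract Z z g) = ract (biset_union (biset_comp H W X) (biset_comp H W Y)) (F w z) g"
      if "g \<in> carrier G" for g
      using w that by (cases rule: cases[OF z]) (simp_all add: F_def r z X.ract_comp Y.ract_comp)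
  next
    fix q assume "q \<in> points (biset_union (biset_comp H W X) (biset_comp H W Y))"
    then consider x w where "q = UInl (orbit_pt H W X w x)" "x \<in> points X" "w \<in> points W"
      | y w where "q = UInr (orbit_pt H W Y w y)" "y \<in> points Y" "w \<in> points W"
      by (auto simp: X.points_comp Y.points_comp)
    then show "\<exists>w\<in>points W. \<exists>z\<in>points Z. F w z = q"
    proof cases
      case (1 x w)
      then obtain z where z: "z \<in> points Z" "f z = UInl x"
        using bij_betw_onto[OF f, of "UInl x"] by blast
      with 1 show ?thesis by (intro bexI[of _ z] bexI[of _ w]) (auto simp: F_def)
    next
      case (2 y w)
      then obtain z where z: "z \<in> points Z" "f z = UInr y"
        using bij_betw_onto[OF f, of "UInr y"] by blast
      with 2 show ?thesis by (intro bexI[of _ z] bexI[of _ w]) (auto simp: F_def)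
    qed
  next
    fix z w z' w' assume z: "z \<in> points Z" and w: "w \<in> points W" and z': "z' \<in> points Z"
      and w': "w' \<in> points W" and eq: "F w z = F w' z'"
    have "\<exists>h\<in>carrier H. w = ract W w' h \<and> f z' = f (lact Z h z)"
      using eq w w' z by (cases rule: cases[OF z]; cases rule: cases[OF z'])
        (auto simp: F_def X.orbit_pt_eq_iff Y.orbit_pt_eq_iff l)
    then show "\<exists>h\<in>carrier H. w = ract W w' h \<and> z' = lact Z h z"
      using inj z z' by (blast intro: Z.X_simps(1))
  qed
qed

text \<open>The external product with an identity biset commutes with composition: a pair of points
  \<open>((y, g), (x, g'))\<close> goes to \<open>([y, x], g g')\<close>.\<close>

lemma biset_ext_id_comp:
  assumes H: "group H" "finite (carrier H)" and G: "group G" "finite (carrier G)"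
    and Y: "is_biset K H Y" and X: "is_biset H L X"
    and idG: "is_biset G G (id_biset G)"
  shows "biset_iso (K \<boxtimes> G) (L \<boxtimes> G) (biset_comp (H \<boxtimes> G) (biset_ext Y (id_biset G)) (biset_ext X (id_biset G)))
    (biset_ext (biset_comp H Y X) (id_biset G))"
proof -
  interpret G: group G by fact
  interpret YX: biset_pair K H L Y X by (rule biset_pair.intro) (fact H Y X)+
  interpret E: biset_pair "K \<boxtimes> G" "H \<boxtimes> G" "L \<boxtimes> G" "biset_ext Y (id_biset G)" "biset_ext X (id_biset G)"
    by (rule biset_pair.intro) (intro group_uprod finite_uprod is_biset_ext H G Y X idG)+
  show ?thesis
  proof (rule E.biset_comp_iso[where
      F = "\<lambda>p q. UPair (orbit_pt H Y X (ufst p) (ufst q)) (usnd p \<otimes>\<^bsub>G\<^esub> usnd q)"], goal_cases)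
    case (1 p q)
    then show ?case by (auto simp: points_ext YX.orbit_in_comp id_biset_def)
  next
    case (2 p q h)
    then show ?case
      by (auto simp: points_ext YX.orbit_pt_balanced id_biset_def G.m_assoc elim!: carrier_uprodE)
  next
    case (3 z)
    then obtain y x g where z: "z = UPair (orbit_pt H Y X y x) g" and yx: "y \<in> points Y" "x \<in> points X"
      and g: "g \<in> carrier G"
      by (auto simp: points_ext YX.points_comp id_biset_def)
    then show ?case
      by (intro bexI[of _ "UPair y \<one>\<^bsub>G\<^esub>"] bexI[of _ "UPair x g"]) (auto simp: points_ext id_biset_def)
  next
    case (4 p q p' q')
    then obtain y g x a y' g' x' a' where p: "p = UPair y g" "q = UPair x a" "p' = UPair y' g'" "q' = UPair x' a'"
      and yx: "y \<in> points Y" "x \<in> points X" "y' \<in> points Y" "x' \<in> points X"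
      and g: "g \<in> carrier G" "a \<in> carrier G" "g' \<in> carrier G" "a' \<in> carrier G"
      by (auto simp: points_ext id_biset_def)
    from 4(5) p yx obtain h where h: "h \<in> carrier H" "y = ract Y y' h" "x' = lact X h x"
      by (auto simp: YX.orbit_pt_eq_iff)
    have "a' = inv\<^bsub>G\<^esub> g' \<otimes>\<^bsub>G\<^esub> (g \<otimes>\<^bsub>G\<^esub> a)"
      using 4(5) p g by (simp add: G.inv_solve_left)
    moreover have "g = g' \<otimes>\<^bsub>G\<^esub> (inv\<^bsub>G\<^esub> g' \<otimes>\<^bsub>G\<^esub> g)"
      using g by (simp flip: G.m_assoc)
    ultimately show ?case
      using p h g by (intro bexI[of _ "UPair h (inv\<^bsub>G\<^esub> g' \<otimes>\<^bsub>G\<^esub> g)"]) (auto simp: id_biset_def G.m_assoc)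
  next
    case (5 k p q)
    then show ?case
      by (auto simp: points_ext YX.lact_comp id_biset_def G.m_assoc elim!: carrier_uprodE)
  next
    case (6 g p q)
    then show ?case
      by (auto simp: points_ext YX.ract_comp id_biset_def G.m_assoc elim!: carrier_uprodE)
  qed
qed

subsection \<open>Bisets of group homomorphisms\<close>

text \<open>The identity, inflation, restriction and isomorphism bisets and the bisets \<open>U\<close> are all of this form,
  up to isomorphism. The construction reverses arrows: a homomorphism \<open>P \<rightarrow> Q\<close> gives a \<open>(P, Q)\<close>-biset,
  that is, a morphism from \<open>Q\<close> to \<open>P\<close>.\<close>

definition hom_biset :: "'a ugroup \<Rightarrow> ('a univ \<Rightarrow> 'a univ) \<Rightarrow> 'a univ biset" where
  "hom_biset Q \<phi> = \<lparr>points = carrier Q, lact = (\<lambda>p x. \<phi> p \<otimes>\<^bsub>Q\<^esub> x), ract = (\<lambda>x q. x \<otimes>\<^bsub>Q\<^esub> q)\<rparr>"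

lemma hom_biset_simps [simp]:
  "points (hom_biset Q \<phi>) = carrier Q"
  "lact (hom_biset Q \<phi>) p x = \<phi> p \<otimes>\<^bsub>Q\<^esub> x"
  "ract (hom_biset Q \<phi>) x q = x \<otimes>\<^bsub>Q\<^esub> q"
  by (simp_all add: hom_biset_def)

lemma is_biset_hom_biset:
  assumes "group P" "group Q" "finite (carrier Q)" and \<phi>: "\<phi> \<in> hom P Q"
  shows "is_biset P Q (hom_biset Q \<phi>)"
proof -
  interpret Q: group Q by fact
  show ?thesis
    unfolding is_biset_def
    by (simp add: assms hom_one[OF \<phi>] hom_mult[OF \<phi>] hom_in_carrier[OF \<phi>] Q.m_assoc)
qed

lemma hom_biset_cong:
  assumes "\<And>p. p \<in> carrier P \<Longrightarrow> \<phi> p = \<psi> p"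
  shows "biset_iso P Q (hom_biset Q \<phi>) (hom_biset Q \<psi>)"
  by (rule biset_iso_id) (simp_all add: assms)

lemma id_biset_eq_hom_biset: "id_biset G = hom_biset G (\<lambda>x. x)"
  by (simp add: id_biset_def hom_biset_def)

lemma inf_biset_eq_hom_biset: "inf_biset H = hom_biset H ufst"
  by (simp add: inf_biset_def hom_biset_def)

definition diagonal :: "'a univ \<Rightarrow> 'a univ" where
  "diagonal t = UPair (UPair (ufst (ufst t)) (usnd t)) (UPair (usnd (ufst t)) (usnd t))"

lemma U_biset_eq_hom_biset: "U_biset K H G = hom_biset ((K \<boxtimes> G) \<boxtimes> (H \<boxtimes> G)) diagonal"
  by (simp add: U_biset_def hom_biset_def diagonal_def)

lemma res_biset_iso_hom_biset:
  assumes "group G"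
  shows "biset_iso H (H \<boxtimes> G) (res_biset H G) (hom_biset (H \<boxtimes> G) (\<lambda>h. UPair h \<one>\<^bsub>G\<^esub>))"
proof -
  interpret G: group G by fact
  show ?thesis
    by (rule biset_iso_id) (auto simp: res_biset_def elim!: carrier_uprodE)
qed

text \<open>\<open>Iso(\<psi>)\<close> is restriction along the inverse of \<open>\<psi>\<close>, and that inverse is itself the isomorphism of bisets.\<close>

lemma iso_biset_iso_hom_biset:
  assumes \<theta>: "\<theta> \<in> hom G H" "bij_betw \<theta> (carrier G) (carrier H)"
    and \<psi>: "\<And>h. h \<in> carrier H \<Longrightarrow> \<psi> h \<in> carrier G \<and> \<theta> (\<psi> h) = h"
  shows "biset_iso G H (iso_biset G \<psi>) (hom_biset H \<theta>)"
  by (rule biset_isoI[where f = \<theta>]) (simp_all add: iso_biset_def \<theta> \<psi> hom_mult[OF \<theta>(1)])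

text \<open>The action laws hold in \<open>X\<close> because they hold after applying the injective equivariant map to \<open>Y\<close>.\<close>

lemma is_biset_transport:
  assumes iso: "biset_iso H G X Y" and Y: "is_biset H G Y"
    and closed: "\<And>h x. \<lbrakk>h \<in> carrier H; x \<in> points X\<rbrakk> \<Longrightarrow> lact X h x \<in> points X"
      "\<And>x g. \<lbrakk>x \<in> points X; g \<in> carrier G\<rbrakk> \<Longrightarrow> ract X x g \<in> points X"
    and "group H" "group G"
  shows "is_biset H G X"
proof -
  interpret H: group H by fact
  interpret G: group G by fact
  obtain f where f: "bij_betw f (points X) (points Y)"
    and l: "\<And>h x. \<lbrakk>h \<in> carrier H; x \<in> points X\<rbrakk> \<Longrightarrow> f (lact X h x) = lact Y h (f x)"
    and r: "\<And>x g. \<lbrakk>x \<in> points X; g \<in> carrier G\<rbrakk> \<Longrightarrow> f (ract X x g) = ract Y (f x) g"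
    using iso by (rule biset_isoE) blast
  have fin: "finite (points X)"
    using bij_betw_finite[OF f] is_bisetD(1)[OF Y] by simp
  have f_in: "f x \<in> points Y" if "x \<in> points X" for x
    using bij_betwE[OF f] that by blast
  have inj: "x = x'" if "f x = f x'" "x \<in> points X" "x' \<in> points X" for x x'
    using inj_onD[OF bij_betw_imp_inj_on[OF f] that] .
  show ?thesis
    unfolding is_biset_def
    by (intro conjI ballI fin closed; (assumption | rule inj);
        simp add: closed l r f_in is_bisetD(2-)[OF Y])
qed

definition restrict_left :: "('a univ \<Rightarrow> 'a univ) \<Rightarrow> 'a univ biset \<Rightarrow> 'a univ biset" where
  "restrict_left \<phi> X = X\<lparr>lact := (\<lambda>p. lact X (\<phi> p))\<rparr>"

lemma restrict_left_simps [simp]: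
  "points (restrict_left \<phi> X) = points X"
  "lact (restrict_left \<phi> X) p x = lact X (\<phi> p) x"
  "ract (restrict_left \<phi> X) x g = ract X x g"
  by (simp_all add: restrict_left_def)

lemma is_biset_restrict_left:
  assumes "group P" "group Q" and \<phi>: "\<phi> \<in> hom P Q" and X: "is_biset Q G X"
  shows "is_biset P G (restrict_left \<phi> X)"
  unfolding is_biset_def
  by (simp add: assms hom_one[OF \<phi>] hom_mult[OF \<phi>] hom_in_carrier[OF \<phi>] is_bisetD[OF X])

text \<open>Composing with the biset of a homomorphism on the left restricts the left action: the pair
  \<open>(q, x)\<close> goes to \<open>q x\<close>.\<close>

lemma hom_biset_comp_left:
  assumes P: "group P" and Q: "group Q" "finite (carrier Q)" and \<phi>: "\<phi> \<in> hom P Q"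
    and X: "is_biset Q G X"
  shows "biset_iso P G (biset_comp Q (hom_biset Q \<phi>) X) (restrict_left \<phi> X)"
proof -
  interpret Q: group Q by fact
  interpret C: biset_pair P Q G "hom_biset Q \<phi>" X
    by (rule biset_pair.intro) (intro is_biset_hom_biset P Q \<phi> X)+
  show ?thesis
  proof (rule C.biset_comp_iso[where F = "\<lambda>q x. lact X q x"], goal_cases)
    case (3 x)
    then show ?case
      by (intro bexI[of _ "\<one>\<^bsub>Q\<^esub>"] bexI[of _ x]) (auto simp: C.X_simps)
  next
    case (4 q x q' x')
    then have "lact X (inv\<^bsub>Q\<^esub> q') (lact X q x) = lact X (inv\<^bsub>Q\<^esub> q') (lact X q' x')"
      by simp
    then have "x' = lact X (inv\<^bsub>Q\<^esub> q' \<otimes>\<^bsub>Q\<^esub> q) x"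
      using 4(1-4) by (simp flip: C.X_simps(4) add: C.X_simps(3))
    moreover have "q = q' \<otimes>\<^bsub>Q\<^esub> (inv\<^bsub>Q\<^esub> q' \<otimes>\<^bsub>Q\<^esub> q)"
      using 4 by (simp flip: Q.m_assoc)
    ultimately show ?case
      using 4 by (intro bexI[of _ "inv\<^bsub>Q\<^esub> q' \<otimes>\<^bsub>Q\<^esub> q"]) simp_all
  qed (simp_all add: C.X_simps hom_in_carrier[OF \<phi>])
qed

lemma hom_biset_comp:
  assumes P: "group P" and Q: "group Q" "finite (carrier Q)" and R: "group R" "finite (carrier R)"
    and \<phi>: "\<phi> \<in> hom P Q" and \<chi>: "\<chi> \<in> hom Q R"
  shows "biset_iso P R (biset_comp Q (hom_biset Q \<phi>) (hom_biset R \<chi>)) (hom_biset R (\<lambda>p. \<chi> (\<phi> p)))"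
  using hom_biset_comp_left[OF P Q \<phi> is_biset_hom_biset[OF Q(1) R \<chi>]]
  by (simp add: restrict_left_def hom_biset_def)

lemma hom_biset_ext:
  "biset_iso (P \<boxtimes> P') (Q \<boxtimes> Q') (biset_ext (hom_biset Q \<phi>) (hom_biset Q' \<phi>'))
    (hom_biset (Q \<boxtimes> Q') (\<lambda>p. UPair (\<phi> (ufst p)) (\<phi>' (usnd p))))"
  by (rule biset_iso_id) (auto simp: points_ext uprod_def)

text \<open>Both sides of the naturality square of restriction are \<open>X \<times> G\<close> with \<open>L\<close> acting through
  \<open>L \<times> 1\<close>: a point \<open>(x, (h, g))\<close> of \<open>X \<times> (H \<times> G)\<close> goes to \<open>(x h, g)\<close>.\<close>

lemma biset_comp_restriction:
  assumes H: "group H" "finite (carrier H)" and G: "group G" "finite (carrier G)"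
    and X: "is_biset L H X"
  shows "biset_iso L (H \<boxtimes> G) (biset_comp H X (hom_biset (H \<boxtimes> G) (\<lambda>h. UPair h \<one>\<^bsub>G\<^esub>)))
    (restrict_left (\<lambda>l. UPair l \<one>\<^bsub>G\<^esub>) (biset_ext X (id_biset G)))"
proof -
  interpret H: group H by fact
  interpret G: group G by fact
  have "(\<lambda>h. UPair h \<one>\<^bsub>G\<^esub>) \<in> hom H (H \<boxtimes> G)"
    by (rule homI) simp_all
  then interpret C: biset_pair L H "H \<boxtimes> G" X "hom_biset (H \<boxtimes> G) (\<lambda>h. UPair h \<one>\<^bsub>G\<^esub>)"
    by (intro biset_pair.intro is_biset_hom_biset group_uprod finite_uprod H G X)
  show ?thesis
  proof (rule C.biset_comp_iso[where F = "\<lambda>x p. UPair (ract X x (ufst p)) (usnd p)"], goal_cases)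
    case (1 x p)
    then show ?case
      by (auto simp: points_ext id_biset_def C.Y_simps elim!: carrier_uprodE)
  next
    case (2 x p h)
    then show ?case
      by (auto simp: C.Y_simps elim!: carrier_uprodE)
  next
    case (3 z)
    then obtain x g where z: "z = UPair x g" "x \<in> points X" "g \<in> carrier G"
      by (auto simp: points_ext id_biset_def)
    then show ?case
      by (intro bexI[of _ x] bexI[of _ "UPair \<one>\<^bsub>H\<^esub> g"]) (auto simp: C.Y_simps)
  next
    case (4 x p x' p')
    then obtain h g h' g' where p: "p = UPair h g" "p' = UPair h' g'"
      and h: "h \<in> carrier H" "g \<in> carrier G" "h' \<in> carrier H" "g' \<in> carrier G"
      by (auto elim!: carrier_uprodE)
    have "ract X (ract X x h) (inv\<^bsub>H\<^esub> h) = ract X (ract X x' h') (inv\<^bsub>H\<^esub> h)"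
      using 4(5) p by simp
    then have "x = ract X x' (h' \<otimes>\<^bsub>H\<^esub> inv\<^bsub>H\<^esub> h)"
      using 4 h by (simp flip: C.Y_simps(6)) (simp add: C.Y_simps(5))
    moreover have "h' = (h' \<otimes>\<^bsub>H\<^esub> inv\<^bsub>H\<^esub> h) \<otimes>\<^bsub>H\<^esub> h"
      using h by (simp add: H.m_assoc)
    ultimately show ?case
      using 4(5) p h by (intro bexI[of _ "h' \<otimes>\<^bsub>H\<^esub> inv\<^bsub>H\<^esub> h"]) simp_all
  next
    case (5 l x p)
    then show ?case
      by (auto simp: C.Y_simps id_biset_def elim!: carrier_uprodE)
  next
    case (6 g x p)
    then show ?case
      by (auto simp: C.Y_simps id_biset_def elim!: carrier_uprodE)
  qed
qed

text \<open>The bisets \<open>U\<close> are natural because \<open>(Y \<times> X \<times> G) \<circ> U\<close> is \<open>(Y \<times> G) \<times> (X \<times> G)\<close> with \<open>G\<close>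
  acting diagonally: a point \<open>((y, x), g)\<close> paired with \<open>((k, a), (h, b))\<close> goes to
  \<open>((y k, g a), (x h, g b))\<close>.\<close>

lemma biset_comp_diagonal:
  assumes K: "group K" "finite (carrier K)" and H: "group H" "finite (carrier H)"
    and G: "group G" "finite (carrier G)"
    and Y: "is_biset T K Y" and X: "is_biset L H X" and idG: "is_biset G G (id_biset G)"
  shows "biset_iso ((T \<boxtimes> L) \<boxtimes> G) ((K \<boxtimes> G) \<boxtimes> (H \<boxtimes> G))
    (biset_comp ((K \<boxtimes> H) \<boxtimes> G) (biset_ext (biset_ext Y X) (id_biset G)) (hom_biset ((K \<boxtimes> G) \<boxtimes> (H \<boxtimes> G)) diagonal))
    (restrict_left diagonal (biset_ext (biset_ext Y (id_biset G)) (biset_ext X (id_biset G))))"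
proof -
  interpret K: group K by fact
  interpret H: group H by fact
  interpret G: group G by fact
  note Ys = is_bisetD[OF Y] and Xs = is_bisetD[OF X]
  have "diagonal \<in> hom ((K \<boxtimes> H) \<boxtimes> G) ((K \<boxtimes> G) \<boxtimes> (H \<boxtimes> G))"
    by (rule homI) (auto simp: diagonal_def elim!: carrier_uprodE)
  then interpret C: biset_pair "(T \<boxtimes> L) \<boxtimes> G" "(K \<boxtimes> H) \<boxtimes> G" "(K \<boxtimes> G) \<boxtimes> (H \<boxtimes> G)"
      "biset_ext (biset_ext Y X) (id_biset G)" "hom_biset ((K \<boxtimes> G) \<boxtimes> (H \<boxtimes> G)) diagonal"
    by (intro biset_pair.intro is_biset_hom_biset is_biset_ext group_uprod finite_uprod H G K X Y idG)
  define F where "F z p = UPair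
      (UPair (ract Y (ufst (ufst z)) (ufst (ufst p))) (usnd z \<otimes>\<^bsub>G\<^esub> usnd (ufst p)))
      (UPair (ract X (usnd (ufst z)) (ufst (usnd p))) (usnd z \<otimes>\<^bsub>G\<^esub> usnd (usnd p)))" for z p
  show ?thesis
  proof (rule C.biset_comp_iso[where F = F], goal_cases)
    case (1 z p)
    then show ?case
      by (auto simp: F_def points_ext id_biset_def Ys Xs elim!: carrier_uprodE)
  next
    case (2 z p t)
    then show ?case
      by (auto simp: F_def points_ext id_biset_def diagonal_def Ys Xs G.m_assoc elim!: carrier_uprodE)
  next
    case (3 w)
    then obtain y a x b where w: "w = UPair (UPair y a) (UPair x b)" "y \<in> points Y" "x \<in> points X"
        "a \<in> carrier G" "b \<in> carrier G"
      by (auto simp: points_ext id_biset_def)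
    then show ?case
      by (intro bexI[of _ "UPair (UPair y x) \<one>\<^bsub>G\<^esub>"] bexI[of _ "UPair (UPair \<one>\<^bsub>K\<^esub> a) (UPair \<one>\<^bsub>H\<^esub> b)"])
         (auto simp: F_def points_ext id_biset_def Ys Xs)
  next
    case (4 z p z' p')
    then obtain y x g y' x' g' where z: "z = UPair (UPair y x) g" "z' = UPair (UPair y' x') g'"
      and yx: "y \<in> points Y" "x \<in> points X" "y' \<in> points Y" "x' \<in> points X"
      and g: "g \<in> carrier G" "g' \<in> carrier G"
      by (auto simp: points_ext id_biset_def)
    obtain k a h b k' a' h' b' where p: "p = UPair (UPair k a) (UPair h b)" "p' = UPair (UPair k' a') (UPair h' b')"
      and k: "k \<in> carrier K" "k' \<in> carrier K" and h: "h \<in> carrier H" "h' \<in> carrier H"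
      and ab: "a \<in> carrier G" "b \<in> carrier G" "a' \<in> carrier G" "b' \<in> carrier G"
      using 4(2,4) by (auto elim!: carrier_uprodE)
    have eqs: "ract Y y k = ract Y y' k'" "ract X x h = ract X x' h'"
      "g \<otimes>\<^bsub>G\<^esub> a = g' \<otimes>\<^bsub>G\<^esub> a'" "g \<otimes>\<^bsub>G\<^esub> b = g' \<otimes>\<^bsub>G\<^esub> b'"
      using 4(5) by (simp_all add: F_def z p)
    have "ract Y (ract Y y k) (inv\<^bsub>K\<^esub> k) = ract Y (ract Y y' k') (inv\<^bsub>K\<^esub> k)"
      using eqs by simp
    then have y: "y = ract Y y' (k' \<otimes>\<^bsub>K\<^esub> inv\<^bsub>K\<^esub> k)"
      using yx k by (simp flip: Ys(7)) (simp add: Ys(6))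
    have "ract X (ract X x h) (inv\<^bsub>H\<^esub> h) = ract X (ract X x' h') (inv\<^bsub>H\<^esub> h)"
      using eqs by simp
    then have x: "x = ract X x' (h' \<otimes>\<^bsub>H\<^esub> inv\<^bsub>H\<^esub> h)"
      using yx h by (simp flip: Xs(7)) (simp add: Xs(6))
    have g': "g = g' \<otimes>\<^bsub>G\<^esub> (inv\<^bsub>G\<^esub> g' \<otimes>\<^bsub>G\<^esub> g)"
      using g by (simp flip: G.m_assoc)
    have "a' = inv\<^bsub>G\<^esub> g' \<otimes>\<^bsub>G\<^esub> (g \<otimes>\<^bsub>G\<^esub> a)" "b' = inv\<^bsub>G\<^esub> g' \<otimes>\<^bsub>G\<^esub> (g \<otimes>\<^bsub>G\<^esub> b)"
      using eqs g ab by (simp_all add: G.inv_solve_left)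
    then have a': "a' = (inv\<^bsub>G\<^esub> g' \<otimes>\<^bsub>G\<^esub> g) \<otimes>\<^bsub>G\<^esub> a" and b': "b' = (inv\<^bsub>G\<^esub> g' \<otimes>\<^bsub>G\<^esub> g) \<otimes>\<^bsub>G\<^esub> b"
      using g ab by (simp_all add: G.m_assoc)
    have k': "k' = (k' \<otimes>\<^bsub>K\<^esub> inv\<^bsub>K\<^esub> k) \<otimes>\<^bsub>K\<^esub> k" and h': "h' = (h' \<otimes>\<^bsub>H\<^esub> inv\<^bsub>H\<^esub> h) \<otimes>\<^bsub>H\<^esub> h"
      using k h by (simp_all add: K.m_assoc H.m_assoc)
    \<comment> \<open>The element moving one pair to the other is forced by the equalities of the components.\<close>
    define t where "t = UPair (UPair (k' \<otimes>\<^bsub>K\<^esub> inv\<^bsub>K\<^esub> k) (h' \<otimes>\<^bsub>H\<^esub> inv\<^bsub>H\<^esub> h)) (inv\<^bsub>G\<^esub> g' \<otimes>\<^bsub>G\<^esub> g)"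
    have "z = ract (biset_ext (biset_ext Y X) (id_biset G)) z' t"
      using y x g' by (simp add: z t_def id_biset_def)
    moreover have "p' = lact (hom_biset ((K \<boxtimes> G) \<boxtimes> (H \<boxtimes> G)) diagonal) t p"
      using k' h' a' b' by (simp add: p t_def diagonal_def)
    moreover have "t \<in> carrier ((K \<boxtimes> H) \<boxtimes> G)"
      using k h g by (simp add: t_def)
    ultimately show ?case by blast
  next
    case (5 t z p)
    then show ?case
      by (auto simp: F_def points_ext id_biset_def diagonal_def Ys Xs G.m_assoc elim!: carrier_uprodE)
  next
    case (6 q z p)
    then show ?case
      by (auto simp: F_def points_ext id_biset_def Ys Xs G.m_assoc elim!: carrier_uprodE)
  qed
qed

section \<open>The linearized biset category\<close>

lemma mem_bisets: "X \<in> bisets H G \<longleftrightarrow> is_biset H G X"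
  by (simp add: bisets_def)

lemma B_rel_keys: "\<forall>r\<in>B_rel H G. Poly_Mapping.keys r \<subseteq> bisets H G"
  unfolding B_rel_def by (auto dest!: subsetD[OF keys_frag_relation, rotated -1])

lemma B_relI:
  "\<lbrakk>is_biset H G X; is_biset H G Y; is_biset H G Z; biset_iso H G Z (biset_union X Y)\<rbrakk> \<Longrightarrow>
    frag_of Z - (frag_of X + frag_of Y) \<in> B_rel H G"
  unfolding B_rel_def bisets_def by blast

lemma group_pres_group:
  assumes "\<forall>r\<in>R. Poly_Mapping.keys r \<subseteq> S"
  shows "group (pres_group S R)"
  unfolding pres_group_def by (rule normal.factorgroup_is_group[OF pres_group_normal[OF assms]])

lemma group_B: "group (B H G)"
  unfolding B_def by (rule group_pres_group[OF B_rel_keys])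

lemma B_class_in_carrier: "is_biset H G X \<Longrightarrow> B_class H G X \<in> carrier (B H G)"
  unfolding B_class_def B_def by (rule pres_class_in_carrier) (simp add: bisets_def)

definition empty_biset :: "'a univ biset" where
  "empty_biset = \<lparr>points = {}, lact = (\<lambda>_ x. x), ract = (\<lambda>x _. x)\<rparr>"

lemma points_empty_biset [simp]: "points empty_biset = {}"
  by (simp add: empty_biset_def)

lemma is_biset_empty: "is_biset H G empty_biset"
  by (simp add: is_biset_def)

lemma empty_biset_rels: "frag_of empty_biset \<in> pres_rels (bisets H G) (B_rel H G)"
proof -
  have "biset_iso H G empty_biset (biset_union empty_biset empty_biset)"
    by (rule biset_isoI[where f = id]) (simp_all add: bij_betw_def)
  then have "frag_of empty_biset - (frag_of empty_biset + frag_of empty_biset) \<in> pres_rels (bisets H G) (B_rel H G)"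
    by (intro pres_rels_incl B_relI is_biset_empty)
  from pres_rels_uminus[OF B_rel_keys this] show ?thesis by simp
qed

text \<open>Isomorphic bisets have the same class: one is the disjoint union of the other with the empty
  biset, and the empty biset is its own double, so its class vanishes.\<close>

lemma B_class_cong:
  assumes X: "is_biset H G X" and Y: "is_biset H G Y" and iso: "biset_iso H G X Y"
  shows "B_class H G X = B_class H G Y"
proof -
  obtain f where f: "bij_betw f (points X) (points Y)"
    and l: "\<And>h x. \<lbrakk>h \<in> carrier H; x \<in> points X\<rbrakk> \<Longrightarrow> f (lact X h x) = lact Y h (f x)"
    and r: "\<And>x g. \<lbrakk>x \<in> points X; g \<in> carrier G\<rbrakk> \<Longrightarrow> f (ract X x g) = ract Y (f x) g"
    using iso by (rule biset_isoE) blast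
  have "bij_betw (UInl \<circ> f) (points X) (UInl ` points Y)"
    by (rule bij_betw_trans[OF f]) (simp add: bij_betw_def inj_on_def)
  then have "biset_iso H G X (biset_union Y empty_biset)"
    by (intro biset_isoI[where f = "UInl \<circ> f"]) (simp_all add: l r)
  then have "frag_of X - (frag_of Y + frag_of empty_biset) \<in> pres_rels (bisets H G) (B_rel H G)"
    by (intro pres_rels_incl B_relI is_biset_empty X Y)
  from pres_rels_add[OF this empty_biset_rels] show ?thesis
    unfolding B_class_def pres_class_eq_iff[OF B_rel_keys] by simp
qed

text \<open>An operation on bisets that preserves disjoint unions in each variable sends the defining relations of the
  Grothendieck groups to defining relations.\<close>

lemma relation_preserving2_bisets:
  assumes closed: "\<And>Y X. \<lbrakk>is_biset L K Y; is_biset H G X\<rbrakk> \<Longrightarrow> is_biset P Q (m Y X)"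
    and left: "\<And>X Y Z W. \<lbrakk>is_biset L K X; is_biset L K Y; is_biset L K Z; is_biset H G W;
      biset_iso L K Z (biset_union X Y)\<rbrakk> \<Longrightarrow> biset_iso P Q (m Z W) (biset_union (m X W) (m Y W))"
    and right: "\<And>X Y Z W. \<lbrakk>is_biset H G X; is_biset H G Y; is_biset H G Z; is_biset L K W;
      biset_iso H G Z (biset_union X Y)\<rbrakk> \<Longrightarrow> biset_iso P Q (m W Z) (biset_union (m W X) (m W Y))"
  shows "relation_preserving2 (bisets L K) (B_rel L K) (bisets H G) (B_rel H G) (bisets P Q) (B_rel P Q) m"
proof -
  have "frag_extend2 m r (frag_of W) \<in> pres_rels (bisets P Q) (B_rel P Q)"
    if "r \<in> B_rel L K" and W: "is_biset H G W" for r W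
  proof -
    from that(1) obtain X Y Z where r: "r = frag_of Z - (frag_of X + frag_of Y)"
      and XYZ: "is_biset L K X" "is_biset L K Y" "is_biset L K Z"
      and "biset_iso L K Z (biset_union X Y)"
      unfolding B_rel_def bisets_def by blast
    then have "frag_of (m Z W) - (frag_of (m X W) + frag_of (m Y W)) \<in> B_rel P Q"
      by (intro B_relI closed left W)
    then show ?thesis
      by (simp add: r frag_extend2_diff frag_extend2_add pres_rels_incl)
  qed
  moreover have "frag_extend2 m (frag_of W) r \<in> pres_rels (bisets P Q) (B_rel P Q)"
    if "r \<in> B_rel H G" and W: "is_biset L K W" for r W
  proof -
    from that(1) obtain X Y Z where r: "r = frag_of Z - (frag_of X + frag_of Y)"
      and XYZ: "is_biset H G X" "is_biset H G Y" "is_biset H G Z"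
      and "biset_iso H G Z (biset_union X Y)"
      unfolding B_rel_def bisets_def by blast
    then have "frag_of (m W Z) - (frag_of (m W X) + frag_of (m W Y)) \<in> B_rel P Q"
      by (intro B_relI closed right W)
    then show ?thesis
      by (simp add: r frag_extend2_diff frag_extend2_add pres_rels_incl)
  qed
  ultimately show ?thesis
    unfolding relation_preserving2_def using B_rel_keys[of L K] B_rel_keys[of H G] B_rel_keys[of P Q]
    by (simp add: bisets_def closed)
qed

lemma B_comp_relations:
  assumes "group K" "group G" "group H" "finite (carrier H)"
  shows "relation_preserving2 (bisets K H) (B_rel K H) (bisets H G) (B_rel H G)
    (bisets K G) (B_rel K G) (biset_comp H)"
proof (rule relation_preserving2_bisets)
  fix Y X assume "is_biset K H Y" "is_biset H G X"
  then interpret biset_pair K H G Y X by (intro biset_pair.intro assms)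
  show "is_biset K G (biset_comp H Y X)" by (intro is_biset_comp assms)
qed (intro biset_comp_union_left biset_comp_union_right assms; assumption)+

lemma B_ext_relations:
  "relation_preserving2 (bisets L K) (B_rel L K) (bisets H G) (B_rel H G)
    (bisets (L \<boxtimes> H) (K \<boxtimes> G)) (B_rel (L \<boxtimes> H) (K \<boxtimes> G)) biset_ext"
  by (intro relation_preserving2_bisets is_biset_ext biset_ext_union_left biset_ext_union_right)

lemma B_comp_class:
  assumes "group K" "group G" "group H" "finite (carrier H)" "is_biset K H Y" "is_biset H G X"
  shows "B_comp K H G (B_class K H Y) (B_class H G X) = B_class K G (biset_comp H Y X)"
  unfolding B_comp_def B_class_def
  using assms(5,6) by (simp add: pres_ext2_class[OF B_comp_relations[OF assms(1-4)]] mem_bisets)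

lemma B_ext_class:
  assumes "is_biset L K Y" "is_biset H G X"
  shows "B_ext L K H G (B_class L K Y) (B_class H G X) = B_class (L \<boxtimes> H) (K \<boxtimes> G) (biset_ext Y X)"
  unfolding B_ext_def B_class_def
  using assms by (simp add: pres_ext2_class[OF B_ext_relations] mem_bisets)

lemma B_comp_bihom:
  assumes "group K" "group G" "group H" "finite (carrier H)"
  shows "bihom (B K H) (B H G) (B K G) (B_comp K H G)"
  unfolding B_def B_comp_def by (rule pres_ext2_bihom[OF B_comp_relations[OF assms]])

lemma B_ext_bihom: "bihom (B L K) (B H G) (B (L \<boxtimes> H) (K \<boxtimes> G)) (B_ext L K H G)"
  unfolding B_def B_ext_def by (rule pres_ext2_bihom[OF B_ext_relations])

lemma kB_eq: "kB k H G = tensor_module k (B H G)"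
  by (simp add: kB_def tensor_module_def Let_def)

lemma kB_class_eq: "kB_class k H G X = pure_tensor k (B H G) \<one>\<^bsub>k\<^esub> (B_class H G X)"
  by (simp add: kB_class_def pure_tensor_def)

lemma kB_comp_eq: "kB_comp k K H G = tensor_map2 k (B K G) (B_comp K H G)"
  by (simp add: kB_comp_def tensor_map2_def)

lemma kB_ext_eq: "kB_ext k L K H G = tensor_map2 k (B (L \<boxtimes> H) (K \<boxtimes> G)) (B_ext L K H G)"
  by (simp add: kB_ext_def tensor_map2_def)

lemma kB_class_in_carrier:
  assumes "cring k" "is_biset H G X"
  shows "kB_class k H G X \<in> carrier (kB k H G)"
proof -
  interpret k: cring k by fact
  show ?thesis
    unfolding kB_class_def kB_eq tensor_module_carrier
    by (rule pres_class_in_carrier) (simp add: B_class_in_carrier assms)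
qed

lemma kB_class_cong:
  "\<lbrakk>is_biset H G X; is_biset H G Y; biset_iso H G X Y\<rbrakk> \<Longrightarrow> kB_class k H G X = kB_class k H G Y"
  by (simp add: kB_class_def B_class_cong)

lemma kB_comp_linear:
  assumes "cring k" "group K" "group G" "group H" "finite (carrier H)"
  shows "\<alpha> \<in> carrier (kB k H G) \<Longrightarrow> module_hom k (kB k K H) (kB k K G) (\<lambda>\<beta>. kB_comp k K H G \<beta> \<alpha>)"
    and "\<beta> \<in> carrier (kB k K H) \<Longrightarrow> module_hom k (kB k H G) (kB k K G) (kB_comp k K H G \<beta>)"
proof -
  interpret tensor_bilinear k "B K H" "B H G" "B K G" "B_comp K H G"
    by (intro tensor_bilinear.intro group_B B_comp_bihom assms)
  show "\<alpha> \<in> carrier (kB k H G) \<Longrightarrow> module_hom k (kB k K H) (kB k K G) (\<lambda>\<beta>. kB_comp k K H G \<beta> \<alpha>)"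
    and "\<beta> \<in> carrier (kB k K H) \<Longrightarrow> module_hom k (kB k H G) (kB k K G) (kB_comp k K H G \<beta>)"
    unfolding kB_eq kB_comp_eq by (rule tensor_map2_linear; assumption)+
qed

lemma kB_ext_linear:
  assumes "cring k"
  shows "\<alpha> \<in> carrier (kB k H G) \<Longrightarrow>
      module_hom k (kB k L K) (kB k (L \<boxtimes> H) (K \<boxtimes> G)) (\<lambda>\<beta>. kB_ext k L K H G \<beta> \<alpha>)"
    and "\<beta> \<in> carrier (kB k L K) \<Longrightarrow>
      module_hom k (kB k H G) (kB k (L \<boxtimes> H) (K \<boxtimes> G)) (kB_ext k L K H G \<beta>)"
proof -
  interpret tensor_bilinear k "B L K" "B H G" "B (L \<boxtimes> H) (K \<boxtimes> G)" "B_ext L K H G"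
    by (intro tensor_bilinear.intro group_B B_ext_bihom assms)
  show "\<alpha> \<in> carrier (kB k H G) \<Longrightarrow>
      module_hom k (kB k L K) (kB k (L \<boxtimes> H) (K \<boxtimes> G)) (\<lambda>\<beta>. kB_ext k L K H G \<beta> \<alpha>)"
    and "\<beta> \<in> carrier (kB k L K) \<Longrightarrow>
      module_hom k (kB k H G) (kB k (L \<boxtimes> H) (K \<boxtimes> G)) (kB_ext k L K H G \<beta>)"
    unfolding kB_eq kB_ext_eq by (rule tensor_map2_linear; assumption)+
qed

lemma kB_comp_class:
  assumes "cring k" "group K" "group G" "group H" "finite (carrier H)" "is_biset K H Y" "is_biset H G X"
  shows "kB_comp k K H G (kB_class k K H Y) (kB_class k H G X) = kB_class k K G (biset_comp H Y X)"
proof -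
  interpret tensor_bilinear k "B K H" "B H G" "B K G" "B_comp K H G"
    by (intro tensor_bilinear.intro group_B B_comp_bihom assms)
  show ?thesis
    by (simp add: kB_comp_eq kB_class_eq tensor_map2_pure B_class_in_carrier B_comp_class assms)
qed

lemma kB_ext_class:
  assumes "cring k" "is_biset L K Y" "is_biset H G X"
  shows "kB_ext k L K H G (kB_class k L K Y) (kB_class k H G X) =
    kB_class k (L \<boxtimes> H) (K \<boxtimes> G) (biset_ext Y X)"
proof -
  interpret tensor_bilinear k "B L K" "B H G" "B (L \<boxtimes> H) (K \<boxtimes> G)" "B_ext L K H G"
    by (intro tensor_bilinear.intro group_B B_ext_bihom assms)
  show ?thesis
    by (simp add: kB_ext_eq kB_class_eq tensor_map2_pure B_class_in_carrier B_ext_class assms)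
qed

lemma module_homD:
  assumes "module_hom k M N f"
  shows "x \<in> carrier M \<Longrightarrow> f x \<in> carrier N"
    and "\<lbrakk>x \<in> carrier M; y \<in> carrier M\<rbrakk> \<Longrightarrow> f (x \<oplus>\<^bsub>M\<^esub> y) = f x \<oplus>\<^bsub>N\<^esub> f y"
    and "\<lbrakk>r \<in> carrier k; x \<in> carrier M\<rbrakk> \<Longrightarrow> f (r \<odot>\<^bsub>M\<^esub> x) = r \<odot>\<^bsub>N\<^esub> f x"
  using assms unfolding module_hom_def by auto

lemma module_hom_compose:
  assumes "module_hom k M N f" "module_hom k N P g"
  shows "module_hom k M P (\<lambda>x. g (f x))"
  unfolding module_hom_def
  by (auto simp: module_homD[OF assms(1)] module_homD[OF assms(2)])

text \<open>The classes of bisets span the morphisms, so linear maps are compared on bisets. A difference of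
  classes is rewritten as a sum involving the scalar \<open>-1\<close>, as additivity and homogeneity speak only of sums
  and scalar multiples.\<close>

lemma kB_hom_eqI:
  assumes k: "cring k" and f: "module_hom k (kB k H G) M f" and g: "module_hom k (kB k H G) M g"
    and eq: "\<And>X. is_biset H G X \<Longrightarrow> f (kB_class k H G X) = g (kB_class k H G X)"
    and \<alpha>: "\<alpha> \<in> carrier (kB k H G)"
  shows "f \<alpha> = g \<alpha>"
proof -
  interpret k: cring k by fact
  interpret B: group "B H G" by (rule group_B)
  let ?c = "pres_class (bisets H G) (B_rel H G)"
  let ?T = "kB k H G"
  have pure_in: "pure_tensor k (B H G) \<one>\<^bsub>k\<^esub> m \<in> carrier ?T" if "m \<in> carrier (B H G)" for m
    unfolding kB_eq tensor_module_carrier pure_tensor_def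
    by (rule pres_class_in_carrier) (simp add: that)
  have c_in: "?c u \<in> carrier (B H G)" if "Poly_Mapping.keys u \<subseteq> bisets H G" for u
    unfolding B_def by (rule pres_class_in_carrier[OF that])
  have c_add: "?c u \<otimes>\<^bsub>B H G\<^esub> ?c v = ?c (u + v)"
    if "Poly_Mapping.keys u \<subseteq> bisets H G" "Poly_Mapping.keys v \<subseteq> bisets H G" for u v
    unfolding B_def by (rule mult_pres_group[OF B_rel_keys that])
  have gen: "f (pure_tensor k (B H G) \<one>\<^bsub>k\<^esub> m) = g (pure_tensor k (B H G) \<one>\<^bsub>k\<^esub> m)"
    if m: "m \<in> carrier (B H G)" for m
  proof -
    obtain u where u: "Poly_Mapping.keys u \<subseteq> bisets H G" and m: "m = ?c u"
      using m unfolding B_def by (rule pres_group_carrierE)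
    have "Poly_Mapping.keys u \<subseteq> bisets H G \<and>
        f (pure_tensor k (B H G) \<one>\<^bsub>k\<^esub> (?c u)) = g (pure_tensor k (B H G) \<one>\<^bsub>k\<^esub> (?c u))"
      using u
    proof (induction u rule: frag_induction)
      case zero
      have "?c 0 = B_class H G empty_biset"
        using pres_rels_uminus[OF B_rel_keys empty_biset_rels]
        by (simp add: B_class_def pres_class_eq_iff[OF B_rel_keys])
      then show ?case
        using eq[OF is_biset_empty] by (simp add: kB_class_eq)
    next
      case (one X)
      then show ?case
        using eq[of X] by (simp add: bisets_def kB_class_eq B_class_def)
    next
      case (diff a b)
      have "?c (- b) = inv\<^bsub>B H G\<^esub> (?c b)"
        using diff c_in[of b] c_in[of "- b"] c_add[of "- b" b]
        by (intro B.inv_equality[symmetric]) (simp_all add: B_def one_pres_group)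
      then have "?c (a - b) = ?c a \<otimes>\<^bsub>B H G\<^esub> inv\<^bsub>B H G\<^esub> (?c b)"
        using diff c_add[of a "- b"] by simp
      then have "pure_tensor k (B H G) \<one>\<^bsub>k\<^esub> (?c (a - b)) =
          pure_tensor k (B H G) \<one>\<^bsub>k\<^esub> (?c a) \<oplus>\<^bsub>?T\<^esub> (\<ominus>\<^bsub>k\<^esub> \<one>\<^bsub>k\<^esub>) \<odot>\<^bsub>?T\<^esub> pure_tensor k (B H G) \<one>\<^bsub>k\<^esub> (?c b)"
        using diff c_in[of a] c_in[of b]
        by (simp add: pure_tensor_mult pure_tensor_inv smult_pure_tensor kB_eq k group_B)
      moreover have "(\<ominus>\<^bsub>k\<^esub> \<one>\<^bsub>k\<^esub>) \<odot>\<^bsub>?T\<^esub> pure_tensor k (B H G) \<one>\<^bsub>k\<^esub> (?c b) \<in> carrier ?T"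
        using diff c_in[of b] pure_tensor_inv[OF k group_B, of "\<one>\<^bsub>k\<^esub>" "?c b" H G] pure_in[of "inv\<^bsub>B H G\<^esub> (?c b)"]
        by (simp add: smult_pure_tensor kB_eq k group_B)
      ultimately show ?case
        using diff keys_diff_subset[of a "bisets H G" b] pure_in c_in[of a] c_in[of b]
        by (simp add: module_homD[OF f] module_homD[OF g])
    qed
    then show ?thesis by (simp add: m)
  qed
  show ?thesis
  proof (rule tensor_module_induct[OF k group_B \<alpha>[unfolded kB_eq], where P = "\<lambda>x. f x = g x"])
    show "f (pure_tensor k (B H G) \<one>\<^bsub>k\<^esub> m) = g (pure_tensor k (B H G) \<one>\<^bsub>k\<^esub> m)"
      if "m \<in> carrier (B H G)" for m
      using that by (rule gen)
  qed (use module_homD(2,3)[OF f] module_homD(2,3)[OF g] in \<open>simp_all add: kB_eq\<close>)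
qed

section \<open>Green biset functors\<close>

locale green_biset_functor =
  fixes k :: "('k, 'r) ring_scheme" and D :: "'a ugroup set" and A :: "('k, 'a, 'm) green_functor"
  assumes k: "cring k" and D: "admissible D" and A: "is_green_functor k D A"
begin

lemma D_group: "H \<in> D \<Longrightarrow> group H"
  and D_finite: "H \<in> D \<Longrightarrow> finite (carrier H)"
  using D unfolding admissible_def by blast+

lemma D_prod:
  assumes "H \<in> D" "G \<in> D"
  shows "H \<boxtimes> G \<in> D"
proof -
  have "(\<lambda>p. (ufst p, usnd p)) \<in> iso (H \<boxtimes> G) (H \<times>\<times> G)"
    by (rule isoI, force simp: hom_def carrier_uprod)
       (rule bij_betwI[where g = "\<lambda>(h, g). UPair h g"]; auto simp: carrier_uprod)
  then have "H \<boxtimes> G \<cong> H \<times>\<times> G"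
    unfolding is_iso_def by blast
  moreover have "group (H \<boxtimes> G)"
    using assms by (intro group_uprod D_group)
  ultimately show ?thesis
    using D assms unfolding admissible_def by blast
qed

lemma D_triv:
  assumes "H \<in> D"
  shows "utriv \<in> D"
proof -
  interpret H: group H using assms by (rule D_group)
  let ?T = "H\<lparr>carrier := {\<one>\<^bsub>H\<^esub>}\<rparr>"
  have sub: "subgroup {\<one>\<^bsub>H\<^esub>} H"
    by (rule H.triv_subgroup)
  interpret T: group ?T
    by (rule H.subgroup_imp_group[OF sub])
  have "{\<one>\<^bsub>H\<^esub>} \<lhd> ?T"
    using T.one_is_normal by simp
  moreover have "utriv \<cong> ?T Mod {\<one>\<^bsub>H\<^esub>}"
  proof -
    have "(\<lambda>_. {\<one>\<^bsub>H\<^esub>}) \<in> iso utriv (?T Mod {\<one>\<^bsub>H\<^esub>})"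
      by (rule isoI)
         (auto simp: utriv_def hom_def bij_betw_def carrier_FactGroup r_coset_def set_mult_def)
    then show ?thesis unfolding is_iso_def by blast
  qed
  ultimately show ?thesis
    using D assms sub group_utriv unfolding admissible_def by blast
qed

lemma A_functor: "is_biset_functor k D A"
  using A by (simp add: is_green_functor_def)

lemma Ob_module: "H \<in> D \<Longrightarrow> module k (Ob A H)"
  and Ar_linear: "\<lbrakk>L \<in> D; H \<in> D; \<alpha> \<in> carrier (kB k H L)\<rbrakk> \<Longrightarrow> module_hom k (Ob A L) (Ob A H) (Ar A L H \<alpha>)"
  and Ar_id: "\<lbrakk>H \<in> D; x \<in> carrier (Ob A H)\<rbrakk> \<Longrightarrow> Ar A H H (kB_id k H) x = x"
  and Ar_comp: "\<lbrakk>L \<in> D; H \<in> D; K \<in> D; \<alpha> \<in> carrier (kB k H L); \<beta> \<in> carrier (kB k K H); x \<in> carrier (Ob A L)\<rbrakk> \<Longrightarrow>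
    Ar A L K (kB_comp k K H L \<beta> \<alpha>) x = Ar A H K \<beta> (Ar A L H \<alpha> x)"
  and Ar_linear_mor: "\<lbrakk>L \<in> D; H \<in> D; x \<in> carrier (Ob A L)\<rbrakk> \<Longrightarrow>
    module_hom k (kB k H L) (Ob A H) (\<lambda>\<alpha>. Ar A L H \<alpha> x)"
  using A_functor unfolding is_biset_functor_def by blast+

lemma Eps_in: "Eps A \<in> carrier (Ob A utriv)"
  and Prd_linear_right: "\<lbrakk>K \<in> D; H \<in> D; a \<in> carrier (Ob A K)\<rbrakk> \<Longrightarrow>
    module_hom k (Ob A H) (Ob A (K \<boxtimes> H)) (\<lambda>b. Prd A K H a b)"
  and Prd_linear_left: "\<lbrakk>K \<in> D; H \<in> D; b \<in> carrier (Ob A H)\<rbrakk> \<Longrightarrow>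
    module_hom k (Ob A K) (Ob A (K \<boxtimes> H)) (\<lambda>a. Prd A K H a b)"
  and Prd_assoc: "\<lbrakk>L \<in> D; K \<in> D; H \<in> D; a \<in> carrier (Ob A L); b \<in> carrier (Ob A K); c \<in> carrier (Ob A H)\<rbrakk> \<Longrightarrow>
    Prd A (L \<boxtimes> K) H (Prd A L K a b) c =
    ar_iso k A (L \<boxtimes> (K \<boxtimes> H)) ((L \<boxtimes> K) \<boxtimes> H) assoc_map (Prd A L (K \<boxtimes> H) a (Prd A K H b c))"
  and Prd_unit_left: "\<lbrakk>H \<in> D; a \<in> carrier (Ob A H)\<rbrakk> \<Longrightarrow>
    ar_iso k A (utriv \<boxtimes> H) H usnd (Prd A utriv H (Eps A) a) = a"
  and Prd_unit_right: "\<lbrakk>H \<in> D; a \<in> carrier (Ob A H)\<rbrakk> \<Longrightarrow>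
    ar_iso k A (H \<boxtimes> utriv) H ufst (Prd A H utriv a (Eps A)) = a"
  and Prd_natural: "\<lbrakk>K \<in> D; T \<in> D; H \<in> D; L \<in> D; \<alpha> \<in> carrier (kB k T K); \<beta> \<in> carrier (kB k L H);
      a \<in> carrier (Ob A K); b \<in> carrier (Ob A H)\<rbrakk> \<Longrightarrow>
    Ar A (K \<boxtimes> H) (T \<boxtimes> L) (kB_ext k T K L H \<alpha> \<beta>) (Prd A K H a b) = Prd A T L (Ar A K T \<alpha> a) (Ar A H L \<beta> b)"
  using A unfolding is_green_functor_def by ((elim conjE, simp)+)

lemma Prd_in:
  "\<lbrakk>K \<in> D; H \<in> D; a \<in> carrier (Ob A K); b \<in> carrier (Ob A H)\<rbrakk> \<Longrightarrow> Prd A K H a b \<in> carrier (Ob A (K \<boxtimes> H))"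
  using module_homD(1)[OF Prd_linear_right] .

subsection \<open>The action of bisets and of homomorphisms\<close>

definition act :: "'a ugroup \<Rightarrow> 'a ugroup \<Rightarrow> 'a univ biset \<Rightarrow> 'm \<Rightarrow> 'm" where
  "act H L X = Ar A L H (kB_class k H L X)"

lemma act_in: "\<lbrakk>L \<in> D; H \<in> D; is_biset H L X; x \<in> carrier (Ob A L)\<rbrakk> \<Longrightarrow> act H L X x \<in> carrier (Ob A H)"
  unfolding act_def by (rule module_homD(1)[OF Ar_linear]) (auto intro: kB_class_in_carrier k)

lemma act_cong: "\<lbrakk>is_biset H L X; is_biset H L Y; biset_iso H L X Y\<rbrakk> \<Longrightarrow> act H L X = act H L Y"
  unfolding act_def by (simp add: kB_class_cong)

lemma act_comp:
  assumes "L \<in> D" "H \<in> D" "K \<in> D" "is_biset K H Y" "is_biset H L X" "x \<in> carrier (Ob A L)"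
  shows "act K H Y (act H L X x) = act K L (biset_comp H Y X) x"
  unfolding act_def using assms
  by (simp add: Ar_comp[symmetric] kB_comp_class kB_class_in_carrier k D_group D_finite)

lemma act_ext:
  assumes "K \<in> D" "T \<in> D" "H \<in> D" "L \<in> D" "is_biset T K Y" "is_biset L H X"
    and "a \<in> carrier (Ob A K)" "b \<in> carrier (Ob A H)"
  shows "Prd A T L (act T K Y a) (act L H X b) = act (T \<boxtimes> L) (K \<boxtimes> H) (biset_ext Y X) (Prd A K H a b)"
  unfolding act_def using assms
  by (simp add: Prd_natural[symmetric] kB_ext_class kB_class_in_carrier k)

text \<open>This is \<open>\<phi>\<^sup>* : A(Q) \<rightarrow> A(P)\<close> for \<open>\<phi> : P \<rightarrow> Q\<close>.\<close>

definition pull :: "'a ugroup \<Rightarrow> 'a ugroup \<Rightarrow> ('a univ \<Rightarrow> 'a univ) \<Rightarrow> 'm \<Rightarrow> 'm" where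
  "pull P Q \<phi> = act P Q (hom_biset Q \<phi>)"

lemma hom_biset_D: "\<lbrakk>P \<in> D; Q \<in> D; \<phi> \<in> hom P Q\<rbrakk> \<Longrightarrow> is_biset P Q (hom_biset Q \<phi>)"
  by (intro is_biset_hom_biset D_group D_finite)

lemma pull_in: "\<lbrakk>P \<in> D; Q \<in> D; \<phi> \<in> hom P Q; x \<in> carrier (Ob A Q)\<rbrakk> \<Longrightarrow> pull P Q \<phi> x \<in> carrier (Ob A P)"
  unfolding pull_def by (intro act_in hom_biset_D)

lemma hom_cong:
  assumes "group P" "\<phi> \<in> hom P Q" "\<And>p. p \<in> carrier P \<Longrightarrow> \<phi> p = \<psi> p"
  shows "\<psi> \<in> hom P Q"
proof -
  interpret P: group P by fact
  show ?thesis
    using assms(2,3) by (auto simp: hom_def Pi_def)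
qed

lemma pull_cong:
  assumes "P \<in> D" "Q \<in> D" "\<phi> \<in> hom P Q" "\<And>p. p \<in> carrier P \<Longrightarrow> \<phi> p = \<psi> p"
  shows "pull P Q \<phi> = pull P Q \<psi>"
  unfolding pull_def using assms hom_cong[OF D_group assms(3,4)]
  by (intro act_cong hom_biset_D hom_biset_cong)

lemma hom_compose_fun: "\<lbrakk>\<phi> \<in> hom P Q; \<chi> \<in> hom Q R\<rbrakk> \<Longrightarrow> (\<lambda>p. \<chi> (\<phi> p)) \<in> hom P R"
  by (rule homI) (simp_all add: hom_in_carrier hom_mult)

lemma pull_pull:
  assumes "P \<in> D" "Q \<in> D" "R \<in> D" "\<phi> \<in> hom P Q" "\<chi> \<in> hom Q R" "x \<in> carrier (Ob A R)"
  shows "pull P Q \<phi> (pull Q R \<chi> x) = pull P R (\<lambda>p. \<chi> (\<phi> p)) x"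
proof -
  have "biset_pair P Q R (hom_biset Q \<phi>) (hom_biset R \<chi>)"
    using assms by (intro biset_pair.intro hom_biset_D D_group D_finite)
  then have "is_biset P R (biset_comp Q (hom_biset Q \<phi>) (hom_biset R \<chi>))"
    using assms by (intro biset_pair.is_biset_comp D_group)
  then have "act P R (biset_comp Q (hom_biset Q \<phi>) (hom_biset R \<chi>)) = pull P R (\<lambda>p. \<chi> (\<phi> p))"
    unfolding pull_def using assms hom_compose_fun[OF assms(4,5)]
    by (intro act_cong hom_biset_D hom_biset_comp D_group D_finite)
  then show ?thesis
    using assms unfolding pull_def by (simp add: act_comp hom_biset_D)
qed

lemma pull_pull3:
  assumes "P \<in> D" "Q \<in> D" "R \<in> D" "S \<in> D" "\<phi> \<in> hom P Q" "\<chi> \<in> hom Q R" "\<omega> \<in> hom R S" "x \<in> carrier (Ob A S)"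
  shows "pull P Q \<phi> (pull Q R \<chi> (pull R S \<omega> x)) = pull P S (\<lambda>p. \<omega> (\<chi> (\<phi> p))) x"
  using pull_pull[OF assms(2-4,6-8)] pull_pull[OF assms(1,2,4,5) hom_compose_fun[OF assms(6,7)] assms(8)] by simp

lemma pull_id: "\<lbrakk>H \<in> D; x \<in> carrier (Ob A H)\<rbrakk> \<Longrightarrow> pull H H (\<lambda>x. x) x = x"
  unfolding pull_def act_def id_biset_eq_hom_biset[symmetric] kB_id_def[symmetric] by (rule Ar_id)

lemma hom_prod:
  "\<lbrakk>\<phi> \<in> hom P Q; \<phi>' \<in> hom P' Q'\<rbrakk> \<Longrightarrow> (\<lambda>p. UPair (\<phi> (ufst p)) (\<phi>' (usnd p))) \<in> hom (P \<boxtimes> P') (Q \<boxtimes> Q')"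
  by (rule homI) (auto elim!: carrier_uprodE simp: hom_in_carrier[of \<phi>] hom_in_carrier[of \<phi>'] hom_mult[of \<phi>] hom_mult[of \<phi>'])

lemma act_hom_ext:
  assumes "P \<in> D" "P' \<in> D" "Q \<in> D" "Q' \<in> D" "\<phi> \<in> hom P Q" "\<phi>' \<in> hom P' Q'"
  shows "act (P \<boxtimes> P') (Q \<boxtimes> Q') (biset_ext (hom_biset Q \<phi>) (hom_biset Q' \<phi>')) =
    pull (P \<boxtimes> P') (Q \<boxtimes> Q') (\<lambda>p. UPair (\<phi> (ufst p)) (\<phi>' (usnd p)))"
  unfolding pull_def using assms
  by (intro act_cong hom_biset_ext is_biset_ext hom_biset_D hom_prod D_prod)

lemma pull_ext:
  assumes "P \<in> D" "P' \<in> D" "Q \<in> D" "Q' \<in> D" "\<phi> \<in> hom P Q" "\<phi>' \<in> hom P' Q'"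
    and "a \<in> carrier (Ob A Q)" "b \<in> carrier (Ob A Q')"
  shows "Prd A P P' (pull P Q \<phi> a) (pull P' Q' \<phi>' b) =
    pull (P \<boxtimes> P') (Q \<boxtimes> Q') (\<lambda>p. UPair (\<phi> (ufst p)) (\<phi>' (usnd p))) (Prd A Q Q' a b)"
  unfolding act_hom_ext[OF assms(1-6), symmetric]
  unfolding pull_def
  by (intro act_ext hom_biset_D assms)

lemma kB_class_iso_biset:
  assumes "H \<in> D" "P \<in> D" and \<theta>: "\<theta> \<in> hom P H" "bij_betw \<theta> (carrier P) (carrier H)"
    and \<psi>: "\<And>h. h \<in> carrier H \<Longrightarrow> \<psi> h \<in> carrier P \<and> \<theta> (\<psi> h) = h"
  shows "kB_class k P H (iso_biset P \<psi>) = kB_class k P H (hom_biset H \<theta>)"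
proof -
  interpret P: group P using assms D_group by blast
  have iso: "biset_iso P H (iso_biset P \<psi>) (hom_biset H \<theta>)"
    by (rule iso_biset_iso_hom_biset) (fact \<theta> \<psi>)+
  moreover have "is_biset P H (iso_biset P \<psi>)"
    using assms by (intro is_biset_transport[OF iso] hom_biset_D D_group) (simp_all add: iso_biset_def)
  ultimately show ?thesis
    using assms by (intro kB_class_cong hom_biset_D)
qed

lemma ar_iso_pull:
  assumes "H \<in> D" "P \<in> D" and "\<theta> \<in> hom P H" "bij_betw \<theta> (carrier P) (carrier H)"
    and "\<And>h. h \<in> carrier H \<Longrightarrow> \<psi> h \<in> carrier P \<and> \<theta> (\<psi> h) = h"
  shows "ar_iso k A H P \<psi> = pull P H \<theta>"
  unfolding ar_iso_def pull_def act_def using kB_class_iso_biset[OF assms] by simp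

end

lemma hom_unit_right: "group H \<Longrightarrow> group G \<Longrightarrow> (\<lambda>h. UPair h \<one>\<^bsub>G\<^esub>) \<in> hom H (H \<boxtimes> G)"
  by (rule homI) (simp_all add: group.is_monoid)

lemma hom_unit_left: "group H \<Longrightarrow> group G \<Longrightarrow> (\<lambda>h. UPair \<one>\<^bsub>G\<^esub> h) \<in> hom H (G \<boxtimes> H)"
  by (rule homI) (simp_all add: group.is_monoid)

lemma hom_diagonal: "diagonal \<in> hom ((K \<boxtimes> H) \<boxtimes> G) ((K \<boxtimes> G) \<boxtimes> (H \<boxtimes> G))"
  by (rule homI) (auto simp: diagonal_def elim!: carrier_uprodE)

lemma hom_ufst: "ufst \<in> hom (H \<boxtimes> G) H"
  by (rule homI) (auto elim!: carrier_uprodE)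

lemma hom_ident: "(\<lambda>x. x) \<in> hom H H"
  by (auto simp: hom_def)

definition assoc_inv :: "'a univ \<Rightarrow> 'a univ" where
  "assoc_inv x = UPair (ufst (ufst x)) (UPair (usnd (ufst x)) (usnd x))"

lemma hom_assoc_inv: "assoc_inv \<in> hom ((L \<boxtimes> K) \<boxtimes> H) (L \<boxtimes> (K \<boxtimes> H))"
  by (rule homI) (auto simp: assoc_inv_def elim!: carrier_uprodE)

lemma bij_assoc_inv: "bij_betw assoc_inv (carrier ((L \<boxtimes> K) \<boxtimes> H)) (carrier (L \<boxtimes> (K \<boxtimes> H)))"
  by (rule bij_betwI[where g = assoc_map]) (auto simp: assoc_inv_def assoc_map_def elim!: carrier_uprodE)

lemma one_utriv: "carrier utriv = {\<one>\<^bsub>utriv\<^esub>}"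
  by (simp add: utriv_def)

lemma bij_unit_left: "bij_betw (\<lambda>h. UPair \<one>\<^bsub>utriv\<^esub> h) (carrier H) (carrier (utriv \<boxtimes> H))"
  by (rule bij_betwI[where g = usnd]) (auto simp: one_utriv elim!: carrier_uprodE)

lemma bij_unit_right: "bij_betw (\<lambda>h. UPair h \<one>\<^bsub>utriv\<^esub>) (carrier H) (carrier (H \<boxtimes> utriv))"
  by (rule bij_betwI[where g = ufst]) (auto simp: one_utriv elim!: carrier_uprodE)

context green_biset_functor
begin

lemma ar_iso_assoc:
  "\<lbrakk>L \<in> D; K \<in> D; H \<in> D\<rbrakk> \<Longrightarrow>
    ar_iso k A (L \<boxtimes> (K \<boxtimes> H)) ((L \<boxtimes> K) \<boxtimes> H) assoc_map = pull ((L \<boxtimes> K) \<boxtimes> H) (L \<boxtimes> (K \<boxtimes> H)) assoc_inv"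
  by (intro ar_iso_pull D_prod hom_assoc_inv bij_assoc_inv)
     (auto simp: assoc_inv_def assoc_map_def elim!: carrier_uprodE)

lemma ar_iso_unit_left:
  "H \<in> D \<Longrightarrow> ar_iso k A (utriv \<boxtimes> H) H usnd = pull H (utriv \<boxtimes> H) (UPair \<one>\<^bsub>utriv\<^esub>)"
  by (intro ar_iso_pull D_prod hom_unit_left bij_unit_left D_triv D_group group_utriv)
     (auto simp: one_utriv elim!: carrier_uprodE)

lemma ar_iso_unit_right:
  "H \<in> D \<Longrightarrow> ar_iso k A (H \<boxtimes> utriv) H ufst = pull H (H \<boxtimes> utriv) (\<lambda>h. UPair h \<one>\<^bsub>utriv\<^esub>)"
  by (intro ar_iso_pull D_prod hom_unit_right bij_unit_right D_triv D_group group_utriv)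
     (auto simp: one_utriv elim!: carrier_uprodE)

end

section \<open>The shifted functor\<close>

locale green_shift = green_biset_functor +
  fixes G assumes G: "G \<in> D"
begin

abbreviation "AG \<equiv> shifted k A G"

lemma DG: "H \<in> D \<Longrightarrow> H \<boxtimes> G \<in> D"
  by (rule D_prod[OF _ G])

lemma idG: "is_biset G G (id_biset G)"
  unfolding id_biset_eq_hom_biset by (intro hom_biset_D G hom_ident)

lemma kB_idG: "kB_id k G \<in> carrier (kB k G G)"
  unfolding kB_id_def by (intro kB_class_in_carrier k idG)

lemma Ob_shifted: "Ob AG H = Ob A (H \<boxtimes> G)"
  by (simp add: shifted_def)

lemma Ar_shifted: "Ar AG H L \<alpha> = Ar A (H \<boxtimes> G) (L \<boxtimes> G) (kB_ext k L H G G \<alpha> (kB_id k G))"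
  by (simp add: shifted_def)

lemma Prd_shifted: "Prd AG K H a b =
    pull ((K \<boxtimes> H) \<boxtimes> G) ((K \<boxtimes> G) \<boxtimes> (H \<boxtimes> G)) diagonal (Prd A (K \<boxtimes> G) (H \<boxtimes> G) a b)"
  by (simp add: shifted_def pull_def act_def U_biset_eq_hom_biset)

lemma Eps_shifted: "Eps AG = pull (utriv \<boxtimes> G) utriv ufst (Eps A)"
  by (simp add: shifted_def pull_def act_def inf_biset_eq_hom_biset)

lemma Ar_shifted_class:
  "is_biset L H X \<Longrightarrow> Ar AG H L (kB_class k L H X) = act (L \<boxtimes> G) (H \<boxtimes> G) (biset_ext X (id_biset G))"
  by (simp add: Ar_shifted kB_id_def kB_ext_class k idG act_def)

lemma Ar_shifted_hom:
  assumes "P \<in> D" "Q \<in> D" "\<phi> \<in> hom P Q"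
  shows "Ar AG Q P (kB_class k P Q (hom_biset Q \<phi>)) =
    pull (P \<boxtimes> G) (Q \<boxtimes> G) (\<lambda>p. UPair (\<phi> (ufst p)) (usnd p))"
  using assms act_hom_ext[OF assms(1) G assms(2) G assms(3) hom_ident]
  by (simp add: Ar_shifted_class hom_biset_D id_biset_eq_hom_biset)

lemma kB_ext_idG_in: "\<alpha> \<in> carrier (kB k H L) \<Longrightarrow>
    kB_ext k H L G G \<alpha> (kB_id k G) \<in> carrier (kB k (H \<boxtimes> G) (L \<boxtimes> G))"
  using module_homD(1)[OF kB_ext_linear(1)[OF k kB_idG]] .

lemma Ar_shifted_linear:
  "\<lbrakk>L \<in> D; H \<in> D; \<alpha> \<in> carrier (kB k H L)\<rbrakk> \<Longrightarrow> module_hom k (Ob AG L) (Ob AG H) (Ar AG L H \<alpha>)"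
  unfolding Ob_shifted Ar_shifted by (intro Ar_linear DG kB_ext_idG_in)

lemma Ar_shifted_linear_mor:
  "\<lbrakk>L \<in> D; H \<in> D; x \<in> carrier (Ob AG L)\<rbrakk> \<Longrightarrow> module_hom k (kB k H L) (Ob AG H) (\<lambda>\<alpha>. Ar AG L H \<alpha> x)"
  unfolding Ob_shifted Ar_shifted
  by (rule module_hom_compose[OF kB_ext_linear(1)[OF k kB_idG] Ar_linear_mor]) (simp_all add: DG)

text \<open>Both sides are linear in \<open>\<alpha>\<close> and in \<open>\<beta>\<close>, and on bisets they agree because \<open>- \<times> Id\<^sub>G\<close> commutes with
  composition.\<close>

lemma Ar_shifted_comp:
  assumes D: "L \<in> D" "H \<in> D" "K \<in> D" and \<alpha>: "\<alpha> \<in> carrier (kB k H L)" and \<beta>: "\<beta> \<in> carrier (kB k K H)"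
    and x: "x \<in> carrier (Ob AG L)"
  shows "Ar AG L K (kB_comp k K H L \<beta> \<alpha>) x = Ar AG H K \<beta> (Ar AG L H \<alpha> x)"
proof -
  note comp_lin = kB_comp_linear[OF k D_group[OF D(3)] D_group[OF D(1)] D_group[OF D(2)] D_finite[OF D(2)]]
  have "Ar AG L K (kB_comp k K H L (kB_class k K H Y) (kB_class k H L X)) x =
      Ar AG H K (kB_class k K H Y) (Ar AG L H (kB_class k H L X) x)"
    if Y: "is_biset K H Y" and X: "is_biset H L X" for Y X
  proof -
    have Y': "is_biset (K \<boxtimes> G) (H \<boxtimes> G) (biset_ext Y (id_biset G))"
      and X': "is_biset (H \<boxtimes> G) (L \<boxtimes> G) (biset_ext X (id_biset G))"
      by (intro is_biset_ext Y X idG)+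
    have "biset_pair K H L Y X"
      by (intro biset_pair.intro Y X D_group D_finite D)
    then have YX: "is_biset K L (biset_comp H Y X)"
      by (intro biset_pair.is_biset_comp D_group D)
    have "biset_pair (K \<boxtimes> G) (H \<boxtimes> G) (L \<boxtimes> G) (biset_ext Y (id_biset G)) (biset_ext X (id_biset G))"
      by (intro biset_pair.intro Y' X' D_group D_finite DG D)
    then have "is_biset (K \<boxtimes> G) (L \<boxtimes> G) (biset_comp (H \<boxtimes> G) (biset_ext Y (id_biset G)) (biset_ext X (id_biset G)))"
      by (intro biset_pair.is_biset_comp D_group DG D)
    then have "act (K \<boxtimes> G) (L \<boxtimes> G) (biset_comp (H \<boxtimes> G) (biset_ext Y (id_biset G)) (biset_ext X (id_biset G))) =
        act (K \<boxtimes> G) (L \<boxtimes> G) (biset_ext (biset_comp H Y X) (id_biset G))"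
      by (intro act_cong biset_ext_id_comp is_biset_ext YX idG Y X D_group D_finite G D)
    then show ?thesis
      using x Y X Y' X' YX D
      by (simp add: kB_comp_class k D_group D_finite Ar_shifted_class act_comp DG Ob_shifted)
  qed
  then have "Ar AG L K (kB_comp k K H L \<beta> (kB_class k H L X)) x =
      Ar AG H K \<beta> (Ar AG L H (kB_class k H L X) x)"
    if X: "is_biset H L X" for X
  proof -
    have X_in: "kB_class k H L X \<in> carrier (kB k H L)"
      by (rule kB_class_in_carrier[OF k X])
    show ?thesis
      by (rule kB_hom_eqI[OF k module_hom_compose[OF comp_lin(1)[OF X_in] Ar_shifted_linear_mor[OF D(1,3) x]]
            Ar_shifted_linear_mor[OF D(2,3) module_homD(1)[OF Ar_shifted_linear[OF D(1,2) X_in] x]] _ \<beta>])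
         (rule \<open>\<And>Y X. \<lbrakk>is_biset K H Y; is_biset H L X\<rbrakk> \<Longrightarrow> _ Y X\<close>[OF _ X])
  qed
  then show ?thesis
    by (rule kB_hom_eqI[OF k module_hom_compose[OF comp_lin(2)[OF \<beta>] Ar_shifted_linear_mor[OF D(1,3) x]]
          module_hom_compose[OF Ar_shifted_linear_mor[OF D(1,2) x] Ar_shifted_linear[OF D(2,3) \<beta>]] _ \<alpha>])
qed

lemma Ar_shifted_id:
  assumes "H \<in> D" "x \<in> carrier (Ob AG H)"
  shows "Ar AG H H (kB_id k H) x = x"
proof -
  have "Ar AG H H (kB_id k H) x = pull (H \<boxtimes> G) (H \<boxtimes> G) (\<lambda>p. UPair (ufst p) (usnd p)) x"
    unfolding kB_id_def id_biset_eq_hom_biset using assms by (subst Ar_shifted_hom) (simp_all add: hom_ident)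
  also have "pull (H \<boxtimes> G) (H \<boxtimes> G) (\<lambda>p. UPair (ufst p) (usnd p)) = pull (H \<boxtimes> G) (H \<boxtimes> G) (\<lambda>p. p)"
    using assms by (intro pull_cong[symmetric] DG hom_ident) (auto simp: carrier_uprod)
  also have "pull (H \<boxtimes> G) (H \<boxtimes> G) (\<lambda>p. p) x = x"
    using assms by (simp add: pull_id DG Ob_shifted)
  finally show ?thesis .
qed

lemma shifted_biset_functor: "is_biset_functor k D AG"
  unfolding is_biset_functor_def
  using Ar_shifted_linear Ar_shifted_id Ar_shifted_comp Ar_shifted_linear_mor
  by (simp add: Ob_shifted Ob_module DG)

lemma diagonal_linear: "\<lbrakk>K \<in> D; H \<in> D\<rbrakk> \<Longrightarrow>
    module_hom k (Ob A ((K \<boxtimes> G) \<boxtimes> (H \<boxtimes> G))) (Ob A ((K \<boxtimes> H) \<boxtimes> G))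
      (pull ((K \<boxtimes> H) \<boxtimes> G) ((K \<boxtimes> G) \<boxtimes> (H \<boxtimes> G)) diagonal)"
  unfolding pull_def act_def
  by (intro Ar_linear D_prod G kB_class_in_carrier k hom_biset_D hom_diagonal)

lemma Prd_shifted_linear_right: "\<lbrakk>K \<in> D; H \<in> D; a \<in> carrier (Ob AG K)\<rbrakk> \<Longrightarrow>
    module_hom k (Ob AG H) (Ob AG (K \<boxtimes> H)) (\<lambda>b. Prd AG K H a b)"
  unfolding Ob_shifted Prd_shifted
  by (rule module_hom_compose[OF Prd_linear_right diagonal_linear]) (simp_all add: DG)

lemma Prd_shifted_linear_left: "\<lbrakk>K \<in> D; H \<in> D; b \<in> carrier (Ob AG H)\<rbrakk> \<Longrightarrow>
    module_hom k (Ob AG K) (Ob AG (K \<boxtimes> H)) (\<lambda>a. Prd AG K H a b)"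
  unfolding Ob_shifted Prd_shifted
  by (rule module_hom_compose[OF Prd_linear_left diagonal_linear]) (simp_all add: DG)

lemma ar_iso_shifted:
  assumes "H \<in> D" "P \<in> D" and "\<theta> \<in> hom P H" "bij_betw \<theta> (carrier P) (carrier H)"
    and "\<And>h. h \<in> carrier H \<Longrightarrow> \<psi> h \<in> carrier P \<and> \<theta> (\<psi> h) = h"
  shows "ar_iso k AG H P \<psi> = pull (P \<boxtimes> G) (H \<boxtimes> G) (\<lambda>p. UPair (\<theta> (ufst p)) (usnd p))"
  unfolding ar_iso_def by (simp add: kB_class_iso_biset[OF assms] Ar_shifted_hom[OF assms(2,1,3)])

lemma hom_diagonal_left: "(\<lambda>p. UPair (diagonal (ufst p)) (usnd p)) \<in>
    hom (((K \<boxtimes> H) \<boxtimes> G') \<boxtimes> P) (((K \<boxtimes> G') \<boxtimes> (H \<boxtimes> G')) \<boxtimes> P)"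
  by (rule hom_prod[OF hom_diagonal hom_ident])

lemma hom_diagonal_right: "(\<lambda>p. UPair (ufst p) (diagonal (usnd p))) \<in>
    hom (P \<boxtimes> ((K \<boxtimes> H) \<boxtimes> G')) (P \<boxtimes> ((K \<boxtimes> G') \<boxtimes> (H \<boxtimes> G')))"
  by (rule hom_prod[OF hom_ident hom_diagonal])

text \<open>Both sides are the pullback of \<open>a \<times> (b \<times> c)\<close> along
  \<open>(((l, k), h), g) \<mapsto> ((l, g), ((k, g), (h, g)))\<close>. Factors to which no homomorphism is applied are
  written as pullbacks along the identity, so that \<open>pull_ext\<close> applies.\<close>

lemma Prd_shifted_assoc:
  assumes D: "L \<in> D" "K \<in> D" "H \<in> D"
    and a: "a \<in> carrier (Ob AG L)" and b: "b \<in> carrier (Ob AG K)" and c: "c \<in> carrier (Ob AG H)"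
  shows "Prd AG (L \<boxtimes> K) H (Prd AG L K a b) c =
    ar_iso k AG (L \<boxtimes> (K \<boxtimes> H)) ((L \<boxtimes> K) \<boxtimes> H) assoc_map (Prd AG L (K \<boxtimes> H) a (Prd AG K H b c))"
proof -
  let ?LG = "L \<boxtimes> G" and ?KG = "K \<boxtimes> G" and ?HG = "H \<boxtimes> G"
  let ?P = "((L \<boxtimes> K) \<boxtimes> H) \<boxtimes> G" and ?Q = "?LG \<boxtimes> (?KG \<boxtimes> ?HG)"
  note DGs = DG[OF D(1)] DG[OF D(2)] DG[OF D(3)]
  note abc = a[unfolded Ob_shifted] b[unfolded Ob_shifted] c[unfolded Ob_shifted]
  define x where "x = Prd A ?LG (?KG \<boxtimes> ?HG) a (Prd A ?KG ?HG b c)"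
  have ab: "Prd A ?LG ?KG a b \<in> carrier (Ob A (?LG \<boxtimes> ?KG))"
    and bc: "Prd A ?KG ?HG b c \<in> carrier (Ob A (?KG \<boxtimes> ?HG))"
    by (intro Prd_in D_prod G D abc)+
  have x: "x \<in> carrier (Ob A ?Q)"
    unfolding x_def by (intro Prd_in D_prod G D abc bc)
  have "Prd A ((L \<boxtimes> K) \<boxtimes> G) ?HG (pull ((L \<boxtimes> K) \<boxtimes> G) (?LG \<boxtimes> ?KG) diagonal (Prd A ?LG ?KG a b)) (pull ?HG ?HG (\<lambda>x. x) c) =
      pull (((L \<boxtimes> K) \<boxtimes> G) \<boxtimes> ?HG) ((?LG \<boxtimes> ?KG) \<boxtimes> ?HG) (\<lambda>p. UPair (diagonal (ufst p)) (usnd p))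
        (Prd A (?LG \<boxtimes> ?KG) ?HG (Prd A ?LG ?KG a b) c)"
    by (intro pull_ext D_prod G D hom_diagonal hom_ident ab abc)
  also have "Prd A (?LG \<boxtimes> ?KG) ?HG (Prd A ?LG ?KG a b) c = pull ((?LG \<boxtimes> ?KG) \<boxtimes> ?HG) ?Q assoc_inv x"
    unfolding x_def using Prd_assoc[OF DGs abc] ar_iso_assoc[OF DGs] by simp
  finally have "Prd AG (L \<boxtimes> K) H (Prd AG L K a b) c =
      pull ?P (((L \<boxtimes> K) \<boxtimes> G) \<boxtimes> ?HG) diagonal
        (pull (((L \<boxtimes> K) \<boxtimes> G) \<boxtimes> ?HG) ((?LG \<boxtimes> ?KG) \<boxtimes> ?HG) (\<lambda>p. UPair (diagonal (ufst p)) (usnd p))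
          (pull ((?LG \<boxtimes> ?KG) \<boxtimes> ?HG) ?Q assoc_inv x))"
    unfolding Prd_shifted using pull_id[OF DGs(3) abc(3)] by simp
  also have "\<dots> = pull ?P ?Q (\<lambda>p. assoc_inv (UPair (diagonal (ufst (diagonal p))) (usnd (diagonal p)))) x"
    by (intro pull_pull3 D_prod G D x hom_diagonal hom_assoc_inv hom_diagonal_left)
  also have "\<dots> = pull ?P ?Q (\<lambda>p. UPair (ufst (diagonal (UPair (assoc_inv (ufst p)) (usnd p))))
      (diagonal (usnd (diagonal (UPair (assoc_inv (ufst p)) (usnd p)))))) x"
  proof (rule fun_cong[OF pull_cong])
    show "(\<lambda>p. assoc_inv (UPair (diagonal (ufst (diagonal p))) (usnd (diagonal p)))) \<in> hom ?P ?Q"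
      by (rule hom_compose_fun[OF hom_compose_fun[OF hom_diagonal hom_diagonal_left] hom_assoc_inv])
  qed (auto intro!: D_prod G D simp: assoc_inv_def diagonal_def elim!: carrier_uprodE)
  also have "\<dots> = pull ?P ((L \<boxtimes> (K \<boxtimes> H)) \<boxtimes> G) (\<lambda>p. UPair (assoc_inv (ufst p)) (usnd p))
      (pull ((L \<boxtimes> (K \<boxtimes> H)) \<boxtimes> G) (?LG \<boxtimes> ((K \<boxtimes> H) \<boxtimes> G)) diagonal
        (pull (?LG \<boxtimes> ((K \<boxtimes> H) \<boxtimes> G)) ?Q (\<lambda>p. UPair (ufst p) (diagonal (usnd p))) x))"
    by (rule pull_pull3[symmetric])
       (intro D_prod G D x hom_diagonal hom_diagonal_right hom_prod[OF hom_assoc_inv hom_ident])+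
  also have "pull (?LG \<boxtimes> ((K \<boxtimes> H) \<boxtimes> G)) ?Q (\<lambda>p. UPair (ufst p) (diagonal (usnd p))) x =
      Prd A ?LG ((K \<boxtimes> H) \<boxtimes> G) (pull ?LG ?LG (\<lambda>x. x) a) (Prd AG K H b c)"
    unfolding x_def Prd_shifted
    by (rule pull_ext[symmetric]) (intro D_prod G D hom_diagonal hom_ident bc abc)+
  also have "pull ((L \<boxtimes> (K \<boxtimes> H)) \<boxtimes> G) (?LG \<boxtimes> ((K \<boxtimes> H) \<boxtimes> G)) diagonal \<dots> = Prd AG L (K \<boxtimes> H) a (Prd AG K H b c)"
    unfolding Prd_shifted[of L] using pull_id[OF DGs(1) abc(1)] by simp
  also have "pull ?P ((L \<boxtimes> (K \<boxtimes> H)) \<boxtimes> G) (\<lambda>p. UPair (assoc_inv (ufst p)) (usnd p)) =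
      ar_iso k AG (L \<boxtimes> (K \<boxtimes> H)) ((L \<boxtimes> K) \<boxtimes> H) assoc_map"
    by (rule ar_iso_shifted[symmetric, OF _ _ hom_assoc_inv bij_assoc_inv])
       (auto intro!: D_prod D simp: assoc_inv_def assoc_map_def elim!: carrier_uprodE)
  finally show ?thesis .
qed

lemma D_utriv: "utriv \<in> D"
  by (rule D_triv[OF G])

text \<open>The pullbacks defining the left side combine to the pullback of \<open>\<epsilon> \<times> a\<close> along
  \<open>(h, g) \<mapsto> (1, (h, g))\<close>, which is \<open>a\<close> by the unit law of \<open>A\<close>.\<close>

lemma Prd_shifted_unit_left:
  assumes H: "H \<in> D" and a: "a \<in> carrier (Ob AG H)"
  shows "ar_iso k AG (utriv \<boxtimes> H) H usnd (Prd AG utriv H (Eps AG) a) = a"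
proof -
  let ?HG = "H \<boxtimes> G" and ?E = "utriv \<boxtimes> G" and ?u = "\<one>\<^bsub>utriv\<^esub>"
  note aG = a[unfolded Ob_shifted]
  define x where "x = Prd A utriv ?HG (Eps A) a"
  have x: "x \<in> carrier (Ob A (utriv \<boxtimes> ?HG))"
    unfolding x_def by (intro Prd_in D_utriv DG H Eps_in aG)
  have unit: "UPair ?u \<in> hom H (utriv \<boxtimes> H)"
    by (intro hom_unit_left D_group H group_utriv)
  have unitG: "UPair ?u \<in> hom ?HG (utriv \<boxtimes> ?HG)"
    by (intro hom_unit_left D_group DG H group_utriv)
  have ufst_id: "(\<lambda>p. UPair (ufst (ufst p)) (usnd p)) \<in> hom (?E \<boxtimes> ?HG) (utriv \<boxtimes> ?HG)"
    by (rule hom_prod[OF hom_ufst hom_ident])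
  have unit_id: "(\<lambda>p. UPair (UPair ?u (ufst p)) (usnd p)) \<in> hom ?HG ((utriv \<boxtimes> H) \<boxtimes> G)"
    by (rule hom_prod[OF unit hom_ident])
  have "Prd A ?E ?HG (Eps AG) (pull ?HG ?HG (\<lambda>x. x) a) =
      pull (?E \<boxtimes> ?HG) (utriv \<boxtimes> ?HG) (\<lambda>p. UPair (ufst (ufst p)) (usnd p)) x"
    unfolding x_def Eps_shifted by (intro pull_ext D_utriv DG D_prod G H hom_ufst hom_ident Eps_in aG)
  then have "ar_iso k AG (utriv \<boxtimes> H) H usnd (Prd AG utriv H (Eps AG) a) =
      pull ?HG ((utriv \<boxtimes> H) \<boxtimes> G) (\<lambda>p. UPair (UPair ?u (ufst p)) (usnd p))
        (pull ((utriv \<boxtimes> H) \<boxtimes> G) (?E \<boxtimes> ?HG) diagonal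
          (pull (?E \<boxtimes> ?HG) (utriv \<boxtimes> ?HG) (\<lambda>p. UPair (ufst (ufst p)) (usnd p)) x))"
    using pull_id[OF DG[OF H] aG] unfolding Prd_shifted
    by (subst ar_iso_shifted[OF _ _ unit bij_unit_left])
       (auto intro!: D_prod D_utriv H simp: one_utriv elim!: carrier_uprodE)
  also have "\<dots> = pull ?HG (utriv \<boxtimes> ?HG) (\<lambda>p. UPair (ufst (ufst (diagonal (UPair (UPair ?u (ufst p)) (usnd p)))))
      (usnd (diagonal (UPair (UPair ?u (ufst p)) (usnd p))))) x"
    by (intro pull_pull3 D_prod DG D_utriv G H x hom_diagonal ufst_id unit_id)
  also have "\<dots> = pull ?HG (utriv \<boxtimes> ?HG) (UPair ?u) x"
    by (rule fun_cong[OF pull_cong[symmetric, OF _ _ unitG]])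
       (auto intro!: D_prod D_utriv G H simp: diagonal_def elim!: carrier_uprodE)
  also have "\<dots> = a"
    unfolding x_def using Prd_unit_left[OF DG[OF H] aG] ar_iso_unit_left[OF DG[OF H]] by simp
  finally show ?thesis .
qed

lemma Prd_shifted_unit_right:
  assumes H: "H \<in> D" and a: "a \<in> carrier (Ob AG H)"
  shows "ar_iso k AG (H \<boxtimes> utriv) H ufst (Prd AG H utriv a (Eps AG)) = a"
proof -
  let ?HG = "H \<boxtimes> G" and ?E = "utriv \<boxtimes> G" and ?u = "\<one>\<^bsub>utriv\<^esub>"
  note aG = a[unfolded Ob_shifted]
  define x where "x = Prd A ?HG utriv a (Eps A)"
  have x: "x \<in> carrier (Ob A (?HG \<boxtimes> utriv))"
    unfolding x_def by (intro Prd_in D_utriv DG H Eps_in aG)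
  have unit: "(\<lambda>h. UPair h ?u) \<in> hom H (H \<boxtimes> utriv)"
    by (intro hom_unit_right D_group H group_utriv)
  have unitG: "(\<lambda>h. UPair h ?u) \<in> hom ?HG (?HG \<boxtimes> utriv)"
    by (intro hom_unit_right D_group DG H group_utriv)
  have id_ufst: "(\<lambda>p. UPair (ufst p) (ufst (usnd p))) \<in> hom (?HG \<boxtimes> ?E) (?HG \<boxtimes> utriv)"
    by (rule hom_prod[OF hom_ident hom_ufst])
  have unit_id: "(\<lambda>p. UPair (UPair (ufst p) ?u) (usnd p)) \<in> hom ?HG ((H \<boxtimes> utriv) \<boxtimes> G)"
    by (rule hom_prod[OF unit hom_ident])
  have "Prd A ?HG ?E (pull ?HG ?HG (\<lambda>x. x) a) (Eps AG) =
      pull (?HG \<boxtimes> ?E) (?HG \<boxtimes> utriv) (\<lambda>p. UPair (ufst p) (ufst (usnd p))) x"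
    unfolding x_def Eps_shifted by (intro pull_ext D_utriv DG D_prod G H hom_ufst hom_ident Eps_in aG)
  then have "ar_iso k AG (H \<boxtimes> utriv) H ufst (Prd AG H utriv a (Eps AG)) =
      pull ?HG ((H \<boxtimes> utriv) \<boxtimes> G) (\<lambda>p. UPair (UPair (ufst p) ?u) (usnd p))
        (pull ((H \<boxtimes> utriv) \<boxtimes> G) (?HG \<boxtimes> ?E) diagonal
          (pull (?HG \<boxtimes> ?E) (?HG \<boxtimes> utriv) (\<lambda>p. UPair (ufst p) (ufst (usnd p))) x))"
    using pull_id[OF DG[OF H] aG] unfolding Prd_shifted
    by (subst ar_iso_shifted[OF _ _ unit bij_unit_right])
       (auto intro!: D_prod D_utriv H simp: one_utriv elim!: carrier_uprodE)
  also have "\<dots> = pull ?HG (?HG \<boxtimes> utriv) (\<lambda>p. UPair (ufst (diagonal (UPair (UPair (ufst p) ?u) (usnd p))))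
      (ufst (usnd (diagonal (UPair (UPair (ufst p) ?u) (usnd p)))))) x"
    by (intro pull_pull3 D_prod DG D_utriv G H x hom_diagonal id_ufst unit_id)
  also have "\<dots> = pull ?HG (?HG \<boxtimes> utriv) (\<lambda>h. UPair h ?u) x"
    by (rule fun_cong[OF pull_cong[symmetric, OF _ _ unitG]])
       (auto intro!: D_prod D_utriv G H simp: diagonal_def elim!: carrier_uprodE)
  also have "\<dots> = a"
    unfolding x_def using Prd_unit_right[OF DG[OF H] aG] ar_iso_unit_right[OF DG[OF H]] by simp
  finally show ?thesis .
qed

text \<open>Both sides are the action on \<open>a \<times> b\<close> of \<open>(Y \<times> G) \<times> (X \<times> G)\<close> with \<open>(T \<times> L) \<times> G\<close> acting along the
  diagonal.\<close>

lemma Prd_shifted_natural_bisets: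
  assumes D: "K \<in> D" "T \<in> D" "H \<in> D" "L \<in> D" and Y: "is_biset T K Y" and X: "is_biset L H X"
    and a: "a \<in> carrier (Ob AG K)" and b: "b \<in> carrier (Ob AG H)"
  shows "Ar AG (K \<boxtimes> H) (T \<boxtimes> L) (kB_ext k T K L H (kB_class k T K Y) (kB_class k L H X)) (Prd AG K H a b) =
    Prd AG T L (Ar AG K T (kB_class k T K Y) a) (Ar AG H L (kB_class k L H X) b)"
proof -
  let ?S = "(K \<boxtimes> G) \<boxtimes> (H \<boxtimes> G)" and ?R = "(T \<boxtimes> G) \<boxtimes> (L \<boxtimes> G)"
  let ?YX = "biset_ext (biset_ext Y X) (id_biset G)"
  let ?YG = "biset_ext Y (id_biset G)" and ?XG = "biset_ext X (id_biset G)"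
  note aG = a[unfolded Ob_shifted] and bG = b[unfolded Ob_shifted]
  define x where "x = Prd A (K \<boxtimes> G) (H \<boxtimes> G) a b"
  have x: "x \<in> carrier (Ob A ?S)"
    unfolding x_def by (intro Prd_in DG D aG bG)
  have YX: "is_biset ((T \<boxtimes> L) \<boxtimes> G) ((K \<boxtimes> H) \<boxtimes> G) ?YX"
    and YG: "is_biset (T \<boxtimes> G) (K \<boxtimes> G) ?YG" and XG: "is_biset (L \<boxtimes> G) (H \<boxtimes> G) ?XG"
    by (intro is_biset_ext Y X idG)+
  have YGXG: "is_biset ?R ?S (biset_ext ?YG ?XG)"
    by (intro is_biset_ext YG XG)
  have U: "is_biset ((K \<boxtimes> H) \<boxtimes> G) ?S (hom_biset ?S diagonal)"
    and U': "is_biset ((T \<boxtimes> L) \<boxtimes> G) ?R (hom_biset ?R diagonal)"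
    by (intro hom_biset_D D_prod G D hom_diagonal)+
  have restrict: "is_biset ((T \<boxtimes> L) \<boxtimes> G) ?S (restrict_left diagonal (biset_ext ?YG ?XG))"
    by (rule is_biset_restrict_left[OF _ _ hom_diagonal YGXG]; intro D_group D_prod G D)
  have left_biset: "is_biset ((T \<boxtimes> L) \<boxtimes> G) ?S (biset_comp ((K \<boxtimes> H) \<boxtimes> G) ?YX (hom_biset ?S diagonal))"
    by (rule biset_pair.is_biset_comp[OF biset_pair.intro]; intro YX U D_group D_finite D_prod G D)
  have right_biset: "is_biset ((T \<boxtimes> L) \<boxtimes> G) ?S (biset_comp ?R (hom_biset ?R diagonal) (biset_ext ?YG ?XG))"
    by (rule biset_pair.is_biset_comp[OF biset_pair.intro]; intro YGXG U' D_group D_finite D_prod G D)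
  have "Ar AG (K \<boxtimes> H) (T \<boxtimes> L) (kB_ext k T K L H (kB_class k T K Y) (kB_class k L H X)) (Prd AG K H a b) =
      act ((T \<boxtimes> L) \<boxtimes> G) ((K \<boxtimes> H) \<boxtimes> G) ?YX (act ((K \<boxtimes> H) \<boxtimes> G) ?S (hom_biset ?S diagonal) x)"
    by (simp add: kB_ext_class k Y X Ar_shifted_class is_biset_ext Prd_shifted x_def pull_def)
  also have "\<dots> = act ((T \<boxtimes> L) \<boxtimes> G) ?S (biset_comp ((K \<boxtimes> H) \<boxtimes> G) ?YX (hom_biset ?S diagonal)) x"
    by (intro act_comp D_prod G D YX U x)
  also have "act ((T \<boxtimes> L) \<boxtimes> G) ?S (biset_comp ((K \<boxtimes> H) \<boxtimes> G) ?YX (hom_biset ?S diagonal)) =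
      act ((T \<boxtimes> L) \<boxtimes> G) ?S (restrict_left diagonal (biset_ext ?YG ?XG))"
    by (intro act_cong left_biset restrict biset_comp_diagonal D_group D_finite D G Y X idG)
  also have "\<dots> = act ((T \<boxtimes> L) \<boxtimes> G) ?S (biset_comp ?R (hom_biset ?R diagonal) (biset_ext ?YG ?XG))"
    by (intro act_cong[symmetric] right_biset restrict hom_biset_comp_left D_group D_finite D_prod D G hom_diagonal YGXG)
  also have "\<dots> x = act ((T \<boxtimes> L) \<boxtimes> G) ?R (hom_biset ?R diagonal) (act ?R ?S (biset_ext ?YG ?XG) x)"
    by (intro act_comp[symmetric] D_prod G D U' YGXG x)
  also have "act ?R ?S (biset_ext ?YG ?XG) x = Prd A (T \<boxtimes> G) (L \<boxtimes> G) (act (T \<boxtimes> G) (K \<boxtimes> G) ?YG a) (act (L \<boxtimes> G) (H \<boxtimes> G) ?XG b)"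
    unfolding x_def by (intro act_ext[symmetric] DG D YG XG aG bG)
  finally show ?thesis
    by (simp add: Prd_shifted pull_def Ar_shifted_class Y X)
qed

lemma Prd_shifted_natural:
  assumes D: "K \<in> D" "T \<in> D" "H \<in> D" "L \<in> D"
    and \<alpha>: "\<alpha> \<in> carrier (kB k T K)" and \<beta>: "\<beta> \<in> carrier (kB k L H)"
    and a: "a \<in> carrier (Ob AG K)" and b: "b \<in> carrier (Ob AG H)"
  shows "Ar AG (K \<boxtimes> H) (T \<boxtimes> L) (kB_ext k T K L H \<alpha> \<beta>) (Prd AG K H a b) =
    Prd AG T L (Ar AG K T \<alpha> a) (Ar AG H L \<beta> b)"
proof -
  have ab: "Prd AG K H a b \<in> carrier (Ob AG (K \<boxtimes> H))"
    using module_homD(1)[OF Prd_shifted_linear_right[OF D(1,3) a] b] .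
  note lin = Ar_shifted_linear_mor[OF D_prod[OF D(1,3)] D_prod[OF D(2,4)] ab]
  have "Ar AG (K \<boxtimes> H) (T \<boxtimes> L) (kB_ext k T K L H \<alpha> (kB_class k L H X)) (Prd AG K H a b) =
      Prd AG T L (Ar AG K T \<alpha> a) (Ar AG H L (kB_class k L H X) b)"
    if X: "is_biset L H X" for X
  proof -
    have X_in: "kB_class k L H X \<in> carrier (kB k L H)"
      by (rule kB_class_in_carrier[OF k X])
    note Xb = module_homD(1)[OF Ar_shifted_linear[OF D(3,4) X_in] b]
    show ?thesis
      by (rule kB_hom_eqI[OF k module_hom_compose[OF kB_ext_linear(1)[OF k X_in] lin]
            module_hom_compose[OF Ar_shifted_linear_mor[OF D(1,2) a] Prd_shifted_linear_left[OF D(2,4) Xb]] _ \<alpha>])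
         (rule Prd_shifted_natural_bisets[OF D _ X a b])
  qed
  then show ?thesis
    by (rule kB_hom_eqI[OF k module_hom_compose[OF kB_ext_linear(2)[OF k \<alpha>] lin]
          module_hom_compose[OF Ar_shifted_linear_mor[OF D(3,4) b]
            Prd_shifted_linear_right[OF D(2,4) module_homD(1)[OF Ar_shifted_linear[OF D(1,2) \<alpha>] a]]] _ \<beta>])
qed

lemma shifted_green_functor: "is_green_functor k D AG"
proof -
  have "Eps AG \<in> carrier (Ob AG utriv)"
    unfolding Eps_shifted Ob_shifted by (intro pull_in DG D_utriv hom_ufst Eps_in)
  then show ?thesis
    unfolding is_green_functor_def
    by (intro conjI ballI shifted_biset_functor Prd_shifted_linear_right Prd_shifted_linear_left
        Prd_shifted_assoc Prd_shifted_unit_left Prd_shifted_unit_right Prd_shifted_natural)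
qed

section \<open>Restriction along the unit of the shifting group\<close>

lemma res_map_eq:
  assumes "H \<in> D"
  shows "res_map k A G H = pull H (H \<boxtimes> G) (\<lambda>h. UPair h \<one>\<^bsub>G\<^esub>)"
proof -
  note iso = res_biset_iso_hom_biset[OF D_group[OF G], of H]
  interpret H: group H by (rule D_group[OF assms])
  interpret G: group G by (rule D_group[OF G])
  have hom: "is_biset H (H \<boxtimes> G) (hom_biset (H \<boxtimes> G) (\<lambda>h. UPair h \<one>\<^bsub>G\<^esub>))"
    by (intro hom_biset_D hom_unit_right D_group DG G assms)
  moreover have "is_biset H (H \<boxtimes> G) (res_biset H G)"
    by (rule is_biset_transport[OF iso hom])
       (auto simp: res_biset_def D_group assms G D_prod elim!: carrier_uprodE)
  ultimately have "act H (H \<boxtimes> G) (res_biset H G) = pull H (H \<boxtimes> G) (\<lambda>h. UPair h \<one>\<^bsub>G\<^esub>)"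
    unfolding pull_def by (intro act_cong iso)
  then show ?thesis
    by (simp add: res_map_def act_def)
qed

lemma res_hom: "H \<in> D \<Longrightarrow> (\<lambda>h. UPair h \<one>\<^bsub>G\<^esub>) \<in> hom H (H \<boxtimes> G)"
  by (intro hom_unit_right D_group G)

lemma res_map_linear: "H \<in> D \<Longrightarrow> module_hom k (Ob AG H) (Ob A H) (res_map k A G H)"
  unfolding Ob_shifted res_map_eq pull_def act_def
  by (intro Ar_linear DG kB_class_in_carrier k hom_biset_D res_hom)

text \<open>By linearity this is a statement about a biset \<open>X\<close>, and there both sides are the action of \<open>X \<times> G\<close> with
  \<open>H\<close> acting through \<open>H \<times> 1\<close>.\<close>

lemma res_map_natural:
  assumes D: "L \<in> D" "H \<in> D" and \<alpha>: "\<alpha> \<in> carrier (kB k H L)" and x: "x \<in> carrier (Ob AG L)"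
  shows "res_map k A G H (Ar AG L H \<alpha> x) = Ar A L H \<alpha> (res_map k A G L x)"
proof (rule kB_hom_eqI[OF k _ _ _ \<alpha>])
  show "module_hom k (kB k H L) (Ob A H) (\<lambda>\<alpha>. res_map k A G H (Ar AG L H \<alpha> x))"
    by (rule module_hom_compose[OF Ar_shifted_linear_mor[OF D x] res_map_linear[OF D(2)]])
  show "module_hom k (kB k H L) (Ob A H) (\<lambda>\<alpha>. Ar A L H \<alpha> (res_map k A G L x))"
    by (rule Ar_linear_mor[OF D module_homD(1)[OF res_map_linear[OF D(1)] x]])
  fix X assume X: "is_biset H L X"
  let ?\<iota> = "\<lambda>h. UPair h \<one>\<^bsub>G\<^esub>"
  let ?XG = "biset_ext X (id_biset G)"
  note xG = x[unfolded Ob_shifted]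
  have XG: "is_biset (H \<boxtimes> G) (L \<boxtimes> G) ?XG"
    by (intro is_biset_ext X idG)
  have RH: "is_biset H (H \<boxtimes> G) (hom_biset (H \<boxtimes> G) ?\<iota>)" and RL: "is_biset L (L \<boxtimes> G) (hom_biset (L \<boxtimes> G) ?\<iota>)"
    by (intro hom_biset_D res_hom DG D)+
  have restrict: "is_biset H (L \<boxtimes> G) (restrict_left ?\<iota> ?XG)"
    by (rule is_biset_restrict_left[OF _ _ res_hom[OF D(2)] XG]; intro D_group DG D)
  have left_biset: "is_biset H (L \<boxtimes> G) (biset_comp (H \<boxtimes> G) (hom_biset (H \<boxtimes> G) ?\<iota>) ?XG)"
    by (rule biset_pair.is_biset_comp[OF biset_pair.intro]; intro RH XG D_group D_finite DG D)
  have right_biset: "is_biset H (L \<boxtimes> G) (biset_comp L X (hom_biset (L \<boxtimes> G) ?\<iota>))"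
    by (rule biset_pair.is_biset_comp[OF biset_pair.intro]; intro X RL D_group D_finite DG D)
  have "res_map k A G H (Ar AG L H (kB_class k H L X) x) = act H (L \<boxtimes> G) (biset_comp (H \<boxtimes> G) (hom_biset (H \<boxtimes> G) ?\<iota>) ?XG) x"
    unfolding Ar_shifted_class[OF X] res_map_eq[OF D(2)] pull_def by (intro act_comp DG D RH XG xG)
  also have "act H (L \<boxtimes> G) (biset_comp (H \<boxtimes> G) (hom_biset (H \<boxtimes> G) ?\<iota>) ?XG) = act H (L \<boxtimes> G) (restrict_left ?\<iota> ?XG)"
    by (intro act_cong left_biset restrict hom_biset_comp_left D_group D_finite DG D res_hom XG)
  also have "\<dots> = act H (L \<boxtimes> G) (biset_comp L X (hom_biset (L \<boxtimes> G) ?\<iota>))"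
    by (intro act_cong[symmetric] right_biset restrict biset_comp_restriction D_group D_finite D G X)
  also have "\<dots> x = act H L X (act L (L \<boxtimes> G) (hom_biset (L \<boxtimes> G) ?\<iota>) x)"
    by (intro act_comp[symmetric] DG D X RL xG)
  finally show "res_map k A G H (Ar AG L H (kB_class k H L X) x) = Ar A L H (kB_class k H L X) (res_map k A G L x)"
    unfolding res_map_eq[OF D(1)] pull_def by (simp add: act_def)
qed

text \<open>On \<open>(k, h)\<close> both sides use the homomorphism with value \<open>((k, 1), (h, 1))\<close>.\<close>

lemma res_map_Prd:
  assumes D: "K \<in> D" "H \<in> D" and a: "a \<in> carrier (Ob AG K)" and b: "b \<in> carrier (Ob AG H)"
  shows "res_map k A G (K \<boxtimes> H) (Prd AG K H a b) = Prd A K H (res_map k A G K a) (res_map k A G H b)"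
proof -
  let ?\<iota> = "\<lambda>h. UPair h \<one>\<^bsub>G\<^esub>" and ?S = "(K \<boxtimes> G) \<boxtimes> (H \<boxtimes> G)"
  note abG = a[unfolded Ob_shifted] b[unfolded Ob_shifted]
  have ab: "Prd A (K \<boxtimes> G) (H \<boxtimes> G) a b \<in> carrier (Ob A ?S)"
    by (intro Prd_in DG D abG)
  have "res_map k A G (K \<boxtimes> H) (Prd AG K H a b) = pull (K \<boxtimes> H) ?S (\<lambda>p. diagonal (?\<iota> p)) (Prd A (K \<boxtimes> G) (H \<boxtimes> G) a b)"
    unfolding res_map_eq[OF D_prod[OF D]] Prd_shifted
    by (intro pull_pull D_prod G D res_hom hom_diagonal ab)
  also have "pull (K \<boxtimes> H) ?S (\<lambda>p. diagonal (?\<iota> p)) = pull (K \<boxtimes> H) ?S (\<lambda>p. UPair (?\<iota> (ufst p)) (?\<iota> (usnd p)))"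
    by (rule pull_cong[OF _ _ hom_compose_fun[OF res_hom hom_diagonal]])
       (auto intro!: D_prod G D simp: diagonal_def elim!: carrier_uprodE)
  also have "\<dots> (Prd A (K \<boxtimes> G) (H \<boxtimes> G) a b) = Prd A K H (pull K (K \<boxtimes> G) ?\<iota> a) (pull H (H \<boxtimes> G) ?\<iota> b)"
    by (rule pull_ext[symmetric]) (intro DG D res_hom abG)+
  finally show ?thesis
    by (simp add: res_map_eq D)
qed

text \<open>The section \<open>h \<mapsto> (h, 1)\<close> of the projection \<open>1 \<times> G \<rightarrow> 1\<close> undoes the inflation of \<open>\<epsilon>\<close>.\<close>

lemma res_map_Eps: "res_map k A G utriv (Eps AG) = Eps A"
proof -
  have "res_map k A G utriv (Eps AG) = pull utriv utriv (\<lambda>h. ufst (UPair h \<one>\<^bsub>G\<^esub>)) (Eps A)"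
    unfolding res_map_eq[OF D_utriv] Eps_shifted by (intro pull_pull DG D_utriv res_hom hom_ufst Eps_in)
  then show ?thesis
    by (simp add: pull_id D_utriv Eps_in)
qed

end

theorem proposition4p3:
  fixes k :: "('k, 'r) ring_scheme"
    and D :: "'a ugroup set"
    and A :: "('k, 'a, 'm) green_functor"
    and G :: "'a ugroup"
  assumes "cring k"
    and "admissible D"
    and "is_green_functor k D A"
    and "G \<in> D"
  shows "is_green_morphism k D (shifted k A G) A (res_map k A G)"
proof -
  interpret green_shift k D A G
    using assms by (intro green_shift.intro green_biset_functor.intro green_shift_axioms.intro)
  show ?thesis
    unfolding is_green_morphism_def is_biset_functor_morphism_def
    by (intro conjI ballI shifted_green_functor A shifted_biset_functor A_functor res_map_linear
        res_map_natural res_map_Prd res_map_Eps)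
qed

end
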